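(* Let $1\le p<\infty$ and let $(X,d,\mu)$ be a metric measure space as in the context. Assume that $X$ is locally compact and that $\mu$ is locally doubling and supports a local $p$-Poincaré inequality. Let $g\in L^p_{\rm loc}(X)$ be an upper gradient of a function $u:X\to[-\infty,\infty]$. Then $u\in L^p_{\rm loc}(X)$, and $u$ is in particular measurable.
   Context: $X=(X,d,\mu)$ is a metric space with at least two points, equipped with a positive complete Borel measure $\mu$ such that $0<\mu(B)<\infty$ for all balls $B$. Balls are open and come with predetermined centre and radius; $\lambda B(x,r)=B(x,\lambda r)$. Curves are nonconstant, compact (defined on compact intervals), rectifiable and parameterized by arc length, $\gamma:[0,l_\gamma]\to X$. A Borel function $g:X\to[0,\infty]$ is an upper gradient of $u:X\to[-\infty,\infty]$ (not assumed measurable) if $|u(\gamma(0))-u(\gamma(l_\gamma))|\le\int_\gamma g\,ds$ for all curves $\gamma$, where the left-hand side is considered to be $\infty$ if at least one of its terms is infinite. $u\in L^p_{\rm loc}(X)$ means that for every $x\in X$ there is a ball $B_x\ni x$ with $u\in L^p(B_x)$. $\mu$ is doubling within an open set $\Omega$ if there is $C$ with $\mu(2B)\le C\mu(B)$ for all balls $B\subset\Omega$. The $p$-Poincaré inequality holds within $\Omega$ if there are $C>0$, $\lambda\ge1$ such that for all balls $B\subset\Omega$ with radius $r_B$, all integrable $u$ on $\lambda B$ and all upper gradients $g$ of $u$ in $\lambda B$, $\frac1{\mu(B)}\int_B|u-u_B|\,d\mu\le C r_B\bigl(\frac1{\mu(\lambda B)}\int_{\lambda B}g^p\,d\mu\bigr)^{1/p}$,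 where $u_B=\frac1{\mu(B)}\int_Bu\,d\mu$. Each property is local if for every $x\in X$ there is $r>0$ such that it holds within $B(x,r)$.
   Formalization: The formal theorem also assumes that u is finite at isolated points of X; without this the claim fails (two points, counting measure, g=0, u=∞), and the condition is necessary for u∈L^p_loc since isolated points have positive measure. *)

theory Defs
  imports "HOL-Analysis.Analysis"
begin

text \<open>
  Real powers on \<open>[0,\<infinity>]\<close>, used for positive exponents only. The metric space is the whole type;
  in notions relative to a set \<open>A\<close>, only the values on \<open>A\<close> of the functions involved matter.
\<close>

definition ennreal_powr :: "ennreal \<Rightarrow> real \<Rightarrow> ennreal" where
  "ennreal_powr x p = (if x = \<infinity> then \<infinity> else ennreal (enn2real x powr p))"

text \<open>
  The length of \<open>\<gamma>\<close> restricted to \<open>{a..b}\<close>: the supremum over all finite increasing sequences of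
  points in \<open>{a..b}\<close> (the endpoints may be omitted, which does not change the supremum).
\<close>

definition curve_length :: "(real \<Rightarrow> 'a::metric_space) \<Rightarrow> real \<Rightarrow> real \<Rightarrow> ennreal" where
  "curve_length \<gamma> a b =
     (SUP ts\<in>{ts. sorted ts \<and> set ts \<subseteq> {a..b}}.
        \<Sum>i<length ts - 1. ennreal (dist (\<gamma> (ts ! i)) (\<gamma> (ts ! Suc i))))"

text \<open>
  Nonconstant compact rectifiable curves \<open>\<gamma> : [0,l] \<rightarrow> A\<close> parameterized by arc length. The last
  clause makes \<open>\<gamma>\<close> rectifiable of length \<open>l\<close>, so that \<open>0 < l\<close> says that \<open>\<gamma>\<close> is nonconstant.
\<close>

definition arc_length_curve :: "'a::metric_space set \<Rightarrow> (real \<Rightarrow> 'a) \<Rightarrow> real \<Rightarrow> bool" where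
  "arc_length_curve A \<gamma> l \<longleftrightarrow>
     0 < l \<and> continuous_on {0..l} \<gamma> \<and> \<gamma> ` {0..l} \<subseteq> A \<and>
     (\<forall>t\<in>{0..l}. curve_length \<gamma> 0 t = ennreal t)"

definition upper_gradient_on ::
  "'a::metric_space set \<Rightarrow> ('a \<Rightarrow> ennreal) \<Rightarrow> ('a \<Rightarrow> ereal) \<Rightarrow> bool" where
  "upper_gradient_on A g u \<longleftrightarrow>
     g \<in> borel_measurable (restrict_space borel A) \<and>
     (\<forall>\<gamma> l. arc_length_curve A \<gamma> l \<longrightarrow>
        (if \<bar>u (\<gamma> 0)\<bar> = \<infinity> \<or> \<bar>u (\<gamma> l)\<bar> = \<infinity> then \<infinity> else e2ennreal \<bar>u (\<gamma> 0) - u (\<gamma> l)\<bar>)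
          \<le> (\<integral>\<^sup>+ t\<in>{0..l}. g (\<gamma> t) \<partial>lborel))"

definition Lp_on :: "'a measure \<Rightarrow> real \<Rightarrow> 'a set \<Rightarrow> ('a \<Rightarrow> ereal) \<Rightarrow> bool" where
  "Lp_on M p A u \<longleftrightarrow>
     u \<in> borel_measurable (restrict_space M A) \<and>
     (\<integral>\<^sup>+ x\<in>A. ennreal_powr (e2ennreal \<bar>u x\<bar>) p \<partial>M) < \<infinity>"

definition Lp_loc :: "'a::metric_space measure \<Rightarrow> real \<Rightarrow> ('a \<Rightarrow> ereal) \<Rightarrow> bool" where
  "Lp_loc M p u \<longleftrightarrow> (\<forall>x. \<exists>y r. 0 < r \<and> x \<in> ball y r \<and> Lp_on M p (ball y r) u)"

text \<open>
  Mean value of an integrable extended real-valued function. Such a function is finite almost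
  everywhere, so the values that \<^const>\<open>real_of_ereal\<close> assigns to \<open>\<plusminus>\<infinity>\<close> are irrelevant.
\<close>

definition mean_on :: "'a measure \<Rightarrow> 'a set \<Rightarrow> ('a \<Rightarrow> ereal) \<Rightarrow> real" where
  "mean_on M A u = (LINT x:A|M. real_of_ereal (u x)) / measure M A"

definition doubling_within :: "'a::metric_space measure \<Rightarrow> 'a set \<Rightarrow> bool" where
  "doubling_within M \<Omega> \<longleftrightarrow>
     (\<exists>C>0. \<forall>x r. 0 < r \<and> ball x r \<subseteq> \<Omega> \<longrightarrow>
        emeasure M (ball x (2 * r)) \<le> ennreal C * emeasure M (ball x r))"

text \<open>The dilated balls need not be contained in \<open>\<Omega>\<close>, neither here nor above.\<close>

definition poincare_within :: "'a::metric_space measure \<Rightarrow> real \<Rightarrow> 'a set \<Rightarrow> bool" where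
  "poincare_within M p \<Omega> \<longleftrightarrow>
     (\<exists>C>0. \<exists>L\<ge>1. \<forall>x r. 0 < r \<and> ball x r \<subseteq> \<Omega> \<longrightarrow>
        (\<forall>u g. Lp_on M 1 (ball x (L * r)) u \<and> upper_gradient_on (ball x (L * r)) g u \<longrightarrow>
           (\<integral>\<^sup>+ y\<in>ball x r. e2ennreal \<bar>u y - ereal (mean_on M (ball x r) u)\<bar> \<partial>M)
               / emeasure M (ball x r)
             \<le> ennreal (C * r) *
               ennreal_powr
                 ((\<integral>\<^sup>+ y\<in>ball x (L * r). ennreal_powr (g y) p \<partial>M) / emeasure M (ball x (L * r)))
                 (1 / p)))"

definition locally_doubling :: "'a::metric_space measure \<Rightarrow> bool" where
  "locally_doubling M \<longleftrightarrow> (\<forall>x. \<exists>r>0. doubling_within M (ball x r))"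

definition local_poincare :: "'a::metric_space measure \<Rightarrow> real \<Rightarrow> bool" where
  "local_poincare M p \<longleftrightarrow> (\<forall>x. \<exists>r>0. poincare_within M p (ball x r))"

text \<open>
  A positive complete Borel measure: complete, and all Borel sets are measurable. The sigma-algebra
  may be larger than the completion of the Borel sets.
\<close>

definition metric_measure_space :: "'a::metric_space measure \<Rightarrow> bool" where
  "metric_measure_space M \<longleftrightarrow>
     (\<exists>x y::'a. x \<noteq> y) \<and> space M = UNIV \<and> sets borel \<subseteq> sets M \<and> complete_measure M \<and>
     (\<forall>x r. 0 < r \<longrightarrow> 0 < emeasure M (ball x r) \<and> emeasure M (ball x r) < \<infinity>)"

text \<open>
  Isolated points satisfy the local hypotheses trivially: inside \<open>{x}\<close> all balls are singletons, and
  no curve meets \<open>x\<close>. On a two-point space with counting measure, \<open>0\<close> is therefore an upper gradient of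
  \<open>u = \<infinity>\<close>, which is not locally p-integrable. For this reason the theorem assumes that \<open>u\<close> is finite
  at isolated points (if there are any), which is necessary for its conclusion.
\<close>

end

theory Submission
  imports Defs
begin

text \<open>
  The Poincare inequality cannot be applied to \<open>u\<close>, whose measurability is in question, but it can be
  applied to distance-like functions that are continuous by construction, and these produce curves
  along which the integral of \<open>g\<close> is controlled. The upper gradient inequality on these curves is
  then a pointwise estimate for \<open>u\<close>.

  In detail, an isolated point is a ball by itself. About any other point, fix a small ball with
  compact closure in which doubling and the Poincare inequality
  hold. By the Vitali--Caratheodory theorem (\<open>Vitali_Caratheodory\<close>), \<open>max 1 g\<close> is dominated by the
  supremum of an increasing sequence of continuous functions \<open>w n \<ge> 1\<close> with \<open>(SUP n. w n)\<^sup>p\<close>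
  integrable; let \<open>F\<close> be this \<open>p\<close>-th power. Given \<open>x\<close>, let \<open>v n y\<close> be the infimum of the sums
  \<open>\<Sum>i. w n (z i) * dist (z i) (z (i + 1))\<close> over chains from \<open>x\<close> to \<open>y\<close> with steps shorter than
  \<open>1 / (n + 1)\<close>, cut off at a large constant (\<open>chain_dist\<close>). Chains, unlike curves, join any two
  sufficiently close points, so \<open>v n\<close> is continuous, and \<open>w n\<close> is an upper gradient of \<open>v n\<close>.
  Comparing the mean values of \<open>v n\<close> over the balls of radius \<open>\<rho> / 2 ^ j\<close> about \<open>x\<close> and about \<open>y\<close>, the Poincare inequality yields
  (\<open>telescoping_estimate\<close>)
    \<open>v n y = \<bar>v n x - v n y\<bar> \<le> K * (2 / 3) ^ i * (S x powr (1 / p) + S y powr (1 / p))\<close>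
  if \<open>dist x y < \<rho> / 2 ^ (i + 1)\<close>, where \<open>S x\<close> is the sum over \<open>j\<close> of \<open>(3 / 4) ^ j\<close> times the mean
  value of \<open>F\<close> over the ball of radius \<open>L * \<rho> / 2 ^ j\<close> about \<open>x\<close>. The bound does not depend on \<open>n\<close>, so
  for each \<open>n\<close> there is a chain from \<open>x\<close> to \<open>y\<close> whose weighted length is at most twice this bound. By
  compactness these chains have a limit curve from \<open>x\<close> to \<open>y\<close>, along which the integral of every \<open>w n\<close>,
  hence that of \<open>g\<close>, is at most twice the bound as well (\<open>arc_length_curve_of_chains\<close>).
  Altogether (\<open>local_curve_estimate\<close>)
    \<open>\<bar>u x - u y\<bar> \<le> 2 * K * (2 / 3) ^ i * (S x powr (1 / p) + S y powr (1 / p))\<close>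
  whenever \<open>x \<noteq> y\<close> and \<open>S x\<close> and \<open>S y\<close> are finite, and \<open>u\<close> is finite at these points.

  By Tonelli's theorem and doubling, \<open>S\<close> is integrable (\<open>integral_average_le\<close>); the weights
  \<open>(3 / 4) ^ j\<close> make this a strong estimate, where a maximal function would only give a weak one.
  Therefore \<open>u\<close> is continuous on each of the sets \<open>{S \<le> k}\<close>, which exhaust the ball up to a null set,
  so that \<open>u\<close> is measurable there, and \<open>\<bar>u\<bar>\<^sup>p\<close> is bounded by an affine function of \<open>S\<close>. Finally, \<open>X\<close>
  is separable because all balls have positive and finite measure, and local measurability becomes
  global.
\<close>

section \<open>Length of curves and parametrization by arc length\<close>

text \<open>
  An inequality between increments over short intervals adds up to one over a long interval. This
  replaces Riemann sums for the line integrals below.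
\<close>
lemma local_mono_imp_le:
  fixes F :: "real \<Rightarrow> real"
  assumes "a \<le> b" "0 < d"
    and loc: "\<And>s t. a \<le> s \<Longrightarrow> s \<le> t \<Longrightarrow> t \<le> b \<Longrightarrow> t - s < d \<Longrightarrow> F s \<le> F t"
  shows "F a \<le> F b"
proof -
  obtain n :: nat where n: "(b - a) / d < real n"
    using reals_Archimedean2 by blast
  have "0 < real n" using n assms(1,2) by (smt (verit) divide_nonneg_pos)
  define h where "h = (b - a) / real n"
  have h: "0 \<le> h" "h < d" "real n * h = b - a"
    using n assms(1,2) \<open>0 < real n\<close> by (auto simp: h_def field_simps)
  have "F a \<le> F (a + real k * h)" if "k \<le> n" for k
    using that
  proof (induction k)
    case (Suc k)
    have "real (Suc k) * h \<le> real n * h" using Suc.prems h by (intro mult_right_mono) auto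
    then have "F (a + real k * h) \<le> F (a + real (Suc k) * h)"
      using h by (intro loc) (auto simp: algebra_simps)
    with Suc show ?case by simp
  qed simp
  from this[of n] show ?thesis using h by simp
qed

text \<open>
  The sums in \<open>curve_length\<close> as a recursive function, for induction on the list of points.
\<close>
fun polygon_length :: "(real \<Rightarrow> 'a::metric_space) \<Rightarrow> real list \<Rightarrow> real" where
  "polygon_length \<gamma> (s # t # ts) = dist (\<gamma> s) (\<gamma> t) + polygon_length \<gamma> (t # ts)"
| "polygon_length \<gamma> ts = 0"

lemma polygon_length_nonneg: "0 \<le> polygon_length \<gamma> ts"
  by (induction \<gamma> ts rule: polygon_length.induct) auto

lemma curve_length_eq_SUP_polygon_length:
  "curve_length \<gamma> a b = (SUP ts\<in>{ts. sorted ts \<and> set ts \<subseteq> {a..b}}. ennreal (polygon_length \<gamma> ts))"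
proof -
  have "(\<Sum>i<length ts - 1. ennreal (dist (\<gamma> (ts ! i)) (\<gamma> (ts ! Suc i)))) = ennreal (polygon_length \<gamma> ts)" for ts
  proof (induction \<gamma> ts rule: polygon_length.induct)
    case (1 \<gamma> s t ts)
    then show ?case
      by (simp add: sum.lessThan_Suc_shift polygon_length_nonneg del: sum.lessThan_Suc)
  qed auto
  then show ?thesis unfolding curve_length_def by simp
qed

lemma polygon_length_append2:
  "polygon_length \<gamma> ts + dist (\<gamma> s) (\<gamma> t) \<le> polygon_length \<gamma> (ts @ [s, t])"
  by (induction \<gamma> ts rule: polygon_length.induct) auto

text \<open>
  Append the points \<open>s\<close> and \<open>t\<close> to a partition of \<open>{a..s}\<close>.
\<close>
lemma curve_length_plus_dist_le:
  assumes "a \<le> s" "s \<le> t"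
  shows "curve_length \<gamma> a s + ennreal (dist (\<gamma> s) (\<gamma> t)) \<le> curve_length \<gamma> a t"
proof -
  let ?I = "{ts. sorted ts \<and> set ts \<subseteq> {a..s}}"
  have "[] \<in> ?I" by simp
  then have "?I \<noteq> {}" by blast
  have "curve_length \<gamma> a s + ennreal (dist (\<gamma> s) (\<gamma> t))
      = (SUP ts\<in>?I. ennreal (polygon_length \<gamma> ts) + ennreal (dist (\<gamma> s) (\<gamma> t)))"
    unfolding curve_length_eq_SUP_polygon_length
    by (rule ennreal_SUP_add_left[symmetric]) (use \<open>?I \<noteq> {}\<close> in auto)
  also have "\<dots> \<le> curve_length \<gamma> a t"
  proof (rule SUP_least)
    fix ts assume "ts \<in> ?I"
    then have "ts @ [s, t] \<in> {ts. sorted ts \<and> set ts \<subseteq> {a..t}}"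
      using assms by (fastforce simp: sorted_append)
    then have "ennreal (polygon_length \<gamma> (ts @ [s, t])) \<le> curve_length \<gamma> a t"
      unfolding curve_length_eq_SUP_polygon_length by (rule SUP_upper)
    moreover have "ennreal (polygon_length \<gamma> ts) + ennreal (dist (\<gamma> s) (\<gamma> t)) \<le> ennreal (polygon_length \<gamma> (ts @ [s, t]))"
      using polygon_length_append2[of \<gamma> ts s t]
      by (simp add: polygon_length_nonneg flip: ennreal_plus)
    ultimately show "ennreal (polygon_length \<gamma> ts) + ennreal (dist (\<gamma> s) (\<gamma> t)) \<le> curve_length \<gamma> a t"
      by order
  qed
  finally show ?thesis .
qed

text \<open>
  Moving all partition points beyond \<open>s\<close> back to \<open>s\<close> costs no more than the Lipschitz bound for the
  part of the curve that is cut off. This gives subadditivity of the length without splitting lists.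
\<close>
lemma polygon_length_le_min:
  assumes "sorted ts" "ts \<noteq> []" "set ts \<subseteq> {..t}" "s \<le> t" and lip: "K-lipschitz_on {s..t} \<gamma>"
  shows "polygon_length \<gamma> ts \<le> polygon_length \<gamma> (map (min s) ts) + K * (t - max s (hd ts))"
  using assms(1-3)
proof (induction ts rule: induct_list012)
  case (2 x)
  then show ?case using \<open>s \<le> t\<close> lipschitz_on_nonneg[OF lip] by simp
next
  case (3 x y zs)
  have "x \<le> y" "y \<le> t" using 3 by auto
  have IH: "polygon_length \<gamma> (y # zs) \<le> polygon_length \<gamma> (map (min s) (y # zs)) + K * (t - max s y)"
    using 3 by simp
  have "dist (\<gamma> x) (\<gamma> y) \<le> dist (\<gamma> (min s x)) (\<gamma> (min s y)) + K * (max s y - max s x)"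
  proof -
    consider "y \<le> s" | "x \<le> s" "s \<le> y" | "s \<le> x" using \<open>x \<le> y\<close> by linarith
    then show ?thesis
    proof cases
      case 2
      have "dist (\<gamma> x) (\<gamma> y) \<le> dist (\<gamma> x) (\<gamma> s) + dist (\<gamma> s) (\<gamma> y)" by (rule dist_triangle)
      also have "dist (\<gamma> s) (\<gamma> y) \<le> K * (y - s)"
        using lipschitz_onD[OF lip, of s y] 2 \<open>y \<le> t\<close> by (simp add: dist_real_def)
      finally show ?thesis using 2 by (auto simp: min_def max_def)
    next
      case 3
      then show ?thesis
        using lipschitz_onD[OF lip, of x y] \<open>x \<le> y\<close> \<open>y \<le> t\<close>
        by (simp add: min_def max_def dist_real_def)
    qed (use \<open>x \<le> y\<close> in \<open>auto simp: min_def max_def\<close>)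
  qed
  with IH show ?case by (simp add: algebra_simps)
qed simp

lemma curve_length_le_plus_lipschitz:
  assumes "a \<le> s" "s \<le> t" and lip: "K-lipschitz_on {s..t} \<gamma>"
  shows "curve_length \<gamma> a t \<le> curve_length \<gamma> a s + ennreal (K * (t - s))"
  unfolding curve_length_eq_SUP_polygon_length[of _ _ t]
proof (rule SUP_least)
  fix ts assume ts: "ts \<in> {ts. sorted ts \<and> set ts \<subseteq> {a..t}}"
  show "ennreal (polygon_length \<gamma> ts) \<le> curve_length \<gamma> a s + ennreal (K * (t - s))"
  proof (cases "ts = []")
    case False
    have "polygon_length \<gamma> ts \<le> polygon_length \<gamma> (map (min s) ts) + K * (t - max s (hd ts))"
      using ts False assms by (intro polygon_length_le_min) auto
    also have "\<dots> \<le> polygon_length \<gamma> (map (min s) ts) + K * (t - s)"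
      using lipschitz_on_nonneg[OF lip] by (intro add_left_mono mult_left_mono) auto
    finally have "ennreal (polygon_length \<gamma> ts) \<le> ennreal (polygon_length \<gamma> (map (min s) ts)) + ennreal (K * (t - s))"
      using assms(2) lipschitz_on_nonneg[OF lip]
      by (simp add: polygon_length_nonneg ennreal_leI flip: ennreal_plus)
    moreover have "ennreal (polygon_length \<gamma> (map (min s) ts)) \<le> curve_length \<gamma> a s"
      unfolding curve_length_eq_SUP_polygon_length
    proof (rule SUP_upper)
      have "sorted (map (min s) ts)"
        unfolding sorted_map by (rule sorted_wrt_mono_rel[of ts "(\<le>)"]) (use ts in auto)
      then show "map (min s) ts \<in> {ts. sorted ts \<and> set ts \<subseteq> {a..s}}"
        using ts assms(1) by auto
    qed
    ultimately show ?thesis by (meson add_right_mono order_trans)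
  qed simp
qed

lemma curve_length_trivial: "curve_length \<gamma> a a = 0"
proof -
  have "polygon_length \<gamma> ts = 0" if "set ts \<subseteq> {a}" for ts
    using that by (induction \<gamma> ts rule: polygon_length.induct) auto
  then show ?thesis
    unfolding curve_length_eq_SUP_polygon_length by (intro antisym SUP_least) auto
qed

lemma lipschitz_on_IccI:
  fixes \<gamma> :: "real \<Rightarrow> 'a::metric_space"
  assumes "0 \<le> K" "\<And>s t. a \<le> s \<Longrightarrow> s \<le> t \<Longrightarrow> t \<le> b \<Longrightarrow> dist (\<gamma> s) (\<gamma> t) \<le> K * (t - s)"
  shows "K-lipschitz_on {a..b} \<gamma>"
proof (rule lipschitz_onI)
  fix s t assume "s \<in> {a..b}" "t \<in> {a..b}"
  then show "dist (\<gamma> s) (\<gamma> t) \<le> K * dist s t"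
    using assms(2)[of s t] assms(2)[of t s]
    by (cases "s \<le> t") (auto simp: dist_real_def dist_commute)
qed fact

lemma lipschitz_on_IccD:
  fixes \<gamma> :: "real \<Rightarrow> 'a::metric_space"
  assumes "K-lipschitz_on {a..b} \<gamma>" "a \<le> s" "s \<le> t" "t \<le> b"
  shows "dist (\<gamma> s) (\<gamma> t) \<le> K * (t - s)"
  using lipschitz_onD[OF assms(1), of s t] assms by (simp add: dist_real_def)

lemma arc_length_curve_lipschitz:
  assumes "arc_length_curve A \<gamma> l"
  shows "1-lipschitz_on {0..l} \<gamma>"
proof (rule lipschitz_on_IccI)
  fix s t assume st: "0 \<le> s" "s \<le> t" "t \<le> l"
  then have "ennreal s + ennreal (dist (\<gamma> s) (\<gamma> t)) \<le> ennreal t"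
    using curve_length_plus_dist_le[of 0 s t \<gamma>] assms by (auto simp: arc_length_curve_def)
  then show "dist (\<gamma> s) (\<gamma> t) \<le> 1 * (t - s)" using st by (simp flip: ennreal_plus)
qed simp

text \<open>
  The length \<open>V t\<close> of the curve up to time \<open>t\<close> is continuous, hence onto \<open>{0..V A}\<close>, and the curve is
  constant where \<open>V\<close> is; so it factors through \<open>V\<close>. The last claim relates the new parameter to the old
  one locally and is what controls line integrals of the reparametrized curve.
\<close>
lemma arc_length_reparametrization:
  fixes \<gamma> :: "real \<Rightarrow> 'a::metric_space"
  assumes "0 \<le> A" "\<gamma> 0 \<noteq> \<gamma> A" and lip: "1-lipschitz_on {0..A} \<gamma>"
  obtains \<eta> V where "arc_length_curve (\<gamma> ` {0..A}) \<eta> (V A)" "V 0 = 0"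
    "\<And>t. 0 \<le> t \<Longrightarrow> t \<le> A \<Longrightarrow> \<eta> (V t) = \<gamma> t"
    "\<And>s t. 0 \<le> s \<Longrightarrow> s \<le> t \<Longrightarrow> t \<le> A \<Longrightarrow> V s \<le> V t"
    "\<And>s t K. 0 \<le> s \<Longrightarrow> s \<le> t \<Longrightarrow> t \<le> A \<Longrightarrow> K-lipschitz_on {s..t} \<gamma> \<Longrightarrow> V t - V s \<le> K * (t - s)"
proof -
  define V where "V t = enn2real (curve_length \<gamma> 0 t)" for t
  have fin: "curve_length \<gamma> 0 t = ennreal (V t)" if "0 \<le> t" "t \<le> A" for t
  proof -
    have "curve_length \<gamma> 0 t \<le> curve_length \<gamma> 0 0 + ennreal (1 * (t - 0))"
      using that by (intro curve_length_le_plus_lipschitz) (auto intro: lipschitz_on_subset[OF lip])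
    then have "curve_length \<gamma> 0 t < top" by (simp add: curve_length_trivial le_less_trans)
    then show ?thesis by (simp add: V_def)
  qed
  have V0: "V 0 = 0" by (simp add: V_def curve_length_trivial)
  have Vnn: "0 \<le> V t" for t by (simp add: V_def)
  have Vdist: "dist (\<gamma> s) (\<gamma> t) \<le> V t - V s" if "0 \<le> s" "s \<le> t" "t \<le> A" for s t
  proof -
    have "ennreal (V s) + ennreal (dist (\<gamma> s) (\<gamma> t)) \<le> ennreal (V t)"
      using curve_length_plus_dist_le[of 0 s t \<gamma>] that by (simp add: fin)
    then show ?thesis by (simp add: Vnn flip: ennreal_plus)
  qed
  have Vmono: "V s \<le> V t" if "0 \<le> s" "s \<le> t" "t \<le> A" for s t
    using Vdist[OF that] zero_le_dist[of "\<gamma> s" "\<gamma> t"] by linarith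
  have VK: "V t - V s \<le> K * (t - s)"
    if "0 \<le> s" "s \<le> t" "t \<le> A" "K-lipschitz_on {s..t} \<gamma>" for s t K
  proof -
    have "ennreal (V t) \<le> ennreal (V s) + ennreal (K * (t - s))"
      using curve_length_le_plus_lipschitz[of 0 s t K \<gamma>] that by (simp add: fin)
    then show ?thesis
      using that lipschitz_on_nonneg[OF that(4)] by (simp add: Vnn flip: ennreal_plus)
  qed
  have Vcont: "continuous_on {0..A} V"
  proof (rule lipschitz_on_continuous_on, rule lipschitz_on_IccI)
    fix s t assume st: "0 \<le> s" "s \<le> t" "t \<le> A"
    then have "1-lipschitz_on {s..t} \<gamma>" by (intro lipschitz_on_subset[OF lip]) auto
    with st show "dist (V s) (V t) \<le> 1 * (t - s)"
      using VK[of s t 1] Vmono[of s t] by (simp add: dist_real_def)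
  qed simp
  have surj: "\<exists>t. t \<in> {0..A} \<and> V t = s" if "s \<in> {0..V A}" for s
    using IVT'[of V 0 s A, OF _ _ \<open>0 \<le> A\<close> Vcont] that V0 by (metis atLeastAtMost_iff)
  define \<sigma> where "\<sigma> s = (SOME t. t \<in> {0..A} \<and> V t = s)" for s
  have \<sigma>: "\<sigma> s \<in> {0..A}" "V (\<sigma> s) = s" if "s \<in> {0..V A}" for s
    using someI_ex[OF surj[OF that]] unfolding \<sigma>_def by blast+
  define \<eta> where "\<eta> s = \<gamma> (\<sigma> s)" for s
  have Vin: "V t \<in> {0..V A}" if "0 \<le> t" "t \<le> A" for t
    using Vnn Vmono[of t A] that by auto
  have \<eta>V: "\<eta> (V t) = \<gamma> t" if "0 \<le> t" "t \<le> A" for t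
  proof -
    define t' where "t' = \<sigma> (V t)"
    have t': "0 \<le> t'" "t' \<le> A" "V t' = V t"
      using \<sigma>[OF Vin[OF that]] by (auto simp only: t'_def atLeastAtMost_iff)
    have "dist (\<gamma> t) (\<gamma> t') \<le> 0"
    proof (cases "t \<le> t'")
      case True
      then show ?thesis using Vdist[OF that(1) True t'(2)] t'(3) by linarith
    next
      case False
      then show ?thesis using Vdist[OF t'(1) _ that(2)] t'(3) by (metis dist_commute diff_self linear)
    qed
    then show ?thesis by (simp add: \<eta>_def t'_def)
  qed
  have \<eta>lip: "1-lipschitz_on {0..V A} \<eta>"
  proof (rule lipschitz_on_IccI)
    fix s t assume that: "0 \<le> s" "s \<le> t" "t \<le> V A"
    then have st: "s \<in> {0..V A}" "t \<in> {0..V A}" by auto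
    show "dist (\<eta> s) (\<eta> t) \<le> 1 * (t - s)"
    proof (cases "\<sigma> s \<le> \<sigma> t")
      case True
      then show ?thesis using Vdist[of "\<sigma> s" "\<sigma> t"] \<sigma>[OF st(1)] \<sigma>[OF st(2)] by (simp add: \<eta>_def)
    next
      case False
      then show ?thesis using Vdist[of "\<sigma> t" "\<sigma> s"] Vmono[of "\<sigma> t" "\<sigma> s"] \<sigma>[OF st(1)] \<sigma>[OF st(2)] that
        by (simp add: \<eta>_def dist_commute)
    qed
  qed simp
  have "arc_length_curve (\<gamma> ` {0..A}) \<eta> (V A)"
    unfolding arc_length_curve_def
  proof (intro conjI ballI)
    show "0 < V A"
      using Vdist[of 0 A] assms V0 by (smt (verit) zero_less_dist_iff)
    show "continuous_on {0..V A} \<eta>"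
      using \<eta>lip by (rule lipschitz_on_continuous_on)
    show "\<eta> ` {0..V A} \<subseteq> \<gamma> ` {0..A}" using \<sigma> by (auto simp: \<eta>_def)
    fix s assume s: "s \<in> {0..V A}"
    show "curve_length \<eta> 0 s = ennreal s"
    proof (rule antisym)
      show "curve_length \<eta> 0 s \<le> ennreal s"
        using curve_length_le_plus_lipschitz[of 0 0 s 1 \<eta>] s lipschitz_on_subset[OF \<eta>lip, of "{0..s}"]
        by (simp add: curve_length_trivial)
      define t where "t = \<sigma> s"
      have t: "t \<in> {0..A}" "V t = s" using \<sigma>[OF s] by (auto simp: t_def)
      have "ennreal s = curve_length \<gamma> 0 t" using t fin by auto
      also have "\<dots> \<le> curve_length \<eta> 0 s"
        unfolding curve_length_eq_SUP_polygon_length[of \<gamma>]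
      proof (rule SUP_least)
        fix ts assume "ts \<in> {ts. sorted ts \<and> set ts \<subseteq> {0..t}}"
        then have ts: "sorted ts" "set ts \<subseteq> {0..t}" by auto
        have "polygon_length \<gamma> ts = polygon_length \<eta> (map V ts)"
          using ts(2) t(1) by (induction ts rule: induct_list012) (auto simp: \<eta>V)
        moreover have "sorted (map V ts)"
          unfolding sorted_map
          by (rule sorted_wrt_mono_rel[of ts "(\<le>)"]) (use ts t(1) in \<open>auto intro!: Vmono\<close>)
        moreover have "set (map V ts) \<subseteq> {0..s}"
          using ts(2) t Vnn by (auto intro!: Vmono)
        ultimately show "ennreal (polygon_length \<gamma> ts) \<le> curve_length \<eta> 0 s"
          unfolding curve_length_eq_SUP_polygon_length
          by (intro SUP_upper2[of "map V ts"]) auto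
      qed
      finally show "ennreal s \<le> curve_length \<eta> 0 s" .
    qed
  qed
  then show thesis
    by (rule that[of \<eta> V]) (fact V0 \<eta>V Vmono VK)+
qed

section \<open>Line integrals of continuous functions\<close>

lemma nn_integral_continuous_Icc:
  fixes h :: "real \<Rightarrow> real"
  assumes "continuous_on {a..b} h" "\<And>t. t \<in> {a..b} \<Longrightarrow> 0 \<le> h t"
  shows "(\<integral>\<^sup>+ t\<in>{a..b}. ennreal (h t) \<partial>lborel) = ennreal (integral {a..b} h)"
proof -
  have int: "set_integrable lborel {a..b} h"
    using assms(1) by (rule borel_integrable_atLeastAtMost')
  have "(\<integral>\<^sup>+ t\<in>{a..b}. ennreal (h t) \<partial>lborel) = (\<integral>\<^sup>+ t. ennreal (indicator {a..b} t *\<^sub>R h t) \<partial>lborel)"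
    by (intro nn_integral_cong) (auto simp: indicator_def)
  also have "\<dots> = ennreal (LINT t:{a..b}|lborel. h t)"
    unfolding set_lebesgue_integral_def
    using int assms(2) by (intro nn_integral_eq_integral) (auto simp: set_integrable_def indicator_def)
  finally show ?thesis using set_borel_integral_eq_integral(2)[OF int] by simp
qed

lemma integral_Icc_bounds:
  fixes h :: "real \<Rightarrow> real"
  assumes "continuous_on {s..t} h" "s \<le> t"
  shows "(\<And>x. x \<in> {s..t} \<Longrightarrow> K \<le> h x) \<Longrightarrow> K * (t - s) \<le> integral {s..t} h"
    and "(\<And>x. x \<in> {s..t} \<Longrightarrow> h x \<le> K) \<Longrightarrow> integral {s..t} h \<le> K * (t - s)"
proof -
  have int: "h integrable_on {s..t}" using assms(1) by (rule integrable_continuous_interval)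
  have c: "integral {s..t} (\<lambda>_. K) = K * (t - s)" using \<open>s \<le> t\<close> by simp
  show "K * (t - s) \<le> integral {s..t} h" if "\<And>x. x \<in> {s..t} \<Longrightarrow> K \<le> h x"
    using integral_le[OF integrable_const_ivl int that] unfolding c .
  show "integral {s..t} h \<le> K * (t - s)" if "\<And>x. x \<in> {s..t} \<Longrightarrow> h x \<le> K"
    using integral_le[OF int integrable_const_ivl that] unfolding c .
qed

text \<open>
  A function with local Lipschitz constants bounded by \<open>w\<close> has \<open>w\<close> as an upper gradient. The local
  inequality compares \<open>v\<close> at the ends of a short piece of the curve with the value of \<open>w\<close> at one of
  these ends, and uniform continuity of \<open>w\<close> along the curve turns this value into the integral.
\<close>
lemma dist_le_line_integral:
  fixes \<gamma> :: "real \<Rightarrow> 'a::metric_space" and v w :: "'a \<Rightarrow> real"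
  assumes "arc_length_curve A \<gamma> l" "continuous_on A w" "0 < \<delta>"
    and nonneg: "\<And>a. a \<in> A \<Longrightarrow> 0 \<le> w a"
    and loc: "\<And>a b. a \<in> A \<Longrightarrow> b \<in> A \<Longrightarrow> dist a b < \<delta> \<Longrightarrow> \<bar>v a - v b\<bar> \<le> max (w a) (w b) * dist a b"
  shows "\<bar>v (\<gamma> 0) - v (\<gamma> l)\<bar> \<le> integral {0..l} (\<lambda>t. w (\<gamma> t))"
proof (rule field_le_epsilon)
  fix e :: real assume "0 < e"
  have l: "0 < l" "continuous_on {0..l} \<gamma>" "\<gamma> ` {0..l} \<subseteq> A"
    using assms(1) by (auto simp: arc_length_curve_def)
  define h where "h t = w (\<gamma> t)" for t
  have h: "continuous_on {0..l} h"
    unfolding h_def by (rule continuous_on_compose2[OF assms(2) l(2,3)])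
  define e' where "e' = e / l"
  have "0 < e'" using \<open>0 < e\<close> l by (simp add: e'_def)
  have "uniformly_continuous_on {0..l} h" using h by (simp add: compact_uniformly_continuous)
  then obtain d where d: "0 < d" "\<And>s t. s \<in> {0..l} \<Longrightarrow> t \<in> {0..l} \<Longrightarrow> dist t s < d \<Longrightarrow> dist (h t) (h s) < e'"
    unfolding uniformly_continuous_on_def using \<open>0 < e'\<close> by meson
  have loc': "\<bar>v (\<gamma> s) - v (\<gamma> t)\<bar> \<le> integral {0..t} h - integral {0..s} h + e' * (t - s)"
    if "0 \<le> s" "s \<le> t" "t \<le> l" "t - s < min d \<delta>" for s t
  proof -
    have D: "dist (\<gamma> s) (\<gamma> t) \<le> t - s"
      using lipschitz_on_IccD[OF arc_length_curve_lipschitz[OF assms(1)]] that by simp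
    have "\<bar>v (\<gamma> s) - v (\<gamma> t)\<bar> \<le> max (h s) (h t) * dist (\<gamma> s) (\<gamma> t)"
      unfolding h_def using that l D by (intro loc) (auto simp: image_subset_iff)
    also have "\<dots> \<le> max (h s) (h t) * (t - s)"
      using D that l(3) by (intro mult_left_mono) (auto simp: h_def le_max_iff_disj intro!: nonneg)
    also have "\<dots> = (max (h s) (h t) - e') * (t - s) + e' * (t - s)" by (simp add: algebra_simps)
    also have "(max (h s) (h t) - e') * (t - s) \<le> integral {s..t} h"
    proof (rule integral_Icc_bounds)
      show "continuous_on {s..t} h" using h that by (auto intro: continuous_on_subset)
      fix x assume "x \<in> {s..t}"
      then have "dist (h x) (h s) < e'" "dist (h x) (h t) < e'"
        using that by (intro d(2); simp add: dist_real_def)+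
      then show "max (h s) (h t) - e' \<le> h x" by (auto simp: dist_real_def max_def)
    qed fact
    also have "integral {s..t} h = integral {0..t} h - integral {0..s} h"
    proof -
      have "h integrable_on {0..t}"
        using that by (intro integrable_continuous_interval continuous_on_subset[OF h]) auto
      then show ?thesis
        using Henstock_Kurzweil_Integration.integral_combine[of 0 s t h] that by simp
    qed
    finally show ?thesis by simp
  qed
  have "0 < min d \<delta>" using d assms by simp
  have 1: "integral {0..0} h + e' * 0 - v (\<gamma> 0) \<le> integral {0..l} h + e' * l - v (\<gamma> l)"
  proof (rule local_mono_imp_le[where F = "\<lambda>t. integral {0..t} h + e' * t - v (\<gamma> t)", OF _ \<open>0 < min d \<delta>\<close>])
    fix s t assume st: "0 \<le> s" "s \<le> t" "t \<le> l" "t - s < min d \<delta>"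
    then show "integral {0..s} h + e' * s - v (\<gamma> s) \<le> integral {0..t} h + e' * t - v (\<gamma> t)"
      using loc'[OF st] by (simp add: algebra_simps)
  qed (use l in simp)
  have 2: "integral {0..0} h + e' * 0 + v (\<gamma> 0) \<le> integral {0..l} h + e' * l + v (\<gamma> l)"
  proof (rule local_mono_imp_le[where F = "\<lambda>t. integral {0..t} h + e' * t + v (\<gamma> t)", OF _ \<open>0 < min d \<delta>\<close>])
    fix s t assume st: "0 \<le> s" "s \<le> t" "t \<le> l" "t - s < min d \<delta>"
    then show "integral {0..s} h + e' * s + v (\<gamma> s) \<le> integral {0..t} h + e' * t + v (\<gamma> t)"
      using loc'[OF st] by (simp add: algebra_simps)
  qed (use l in simp)
  have "e' * l = e" using l by (simp add: e'_def)
  with 1 2 show "\<bar>v (\<gamma> 0) - v (\<gamma> l)\<bar> \<le> integral {0..l} (\<lambda>t. w (\<gamma> t)) + e"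
    by (auto simp: abs_le_iff h_def[abs_def])
qed

section \<open>From chains to curves\<close>

text \<open>
  \<open>chain Z \<delta> w x y c\<close>: there is a chain in \<open>Z\<close> from \<open>x\<close> to \<open>y\<close> with steps shorter than \<open>\<delta>\<close> whose length,
  weighted by the values of \<open>w\<close> at the starting points of the steps, is \<open>c\<close>.
\<close>
inductive chain :: "'a::metric_space set \<Rightarrow> real \<Rightarrow> ('a \<Rightarrow> real) \<Rightarrow> 'a \<Rightarrow> 'a \<Rightarrow> real \<Rightarrow> bool"
  for Z \<delta> w x where
  start: "x \<in> Z \<Longrightarrow> chain Z \<delta> w x x 0"
| extend: "chain Z \<delta> w x y c \<Longrightarrow> z \<in> Z \<Longrightarrow> dist y z < \<delta> \<Longrightarrow> chain Z \<delta> w x z (c + w y * dist y z)"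

lemma chain_cost_nonneg: "chain Z \<delta> w x y c \<Longrightarrow> (\<And>z. 1 \<le> w z) \<Longrightarrow> 0 \<le> c"
  by (induction rule: chain.induct) (simp_all, smt (verit) mult_nonneg_nonneg zero_le_dist)

text \<open>
  The curve rests at each point of the chain for as long as the next step costs. The main inequality
  says that up to one step the speed is at most \<open>1 / \<kappa>\<close> while \<open>w \<ge> \<kappa>\<close>: the step started before time
  \<open>s\<close> is the only one that is not paid for during \<open>{s..t}\<close>, and it is shorter than \<open>\<delta>\<close>.
\<close>
lemma step_curve_of_chain:
  assumes "chain Z \<delta> w x y c" "0 < \<delta>" and w: "\<And>z. 1 \<le> w z"
  shows "\<exists>\<gamma>. range \<gamma> \<subseteq> Z \<and> \<gamma> 0 = x \<and> (\<forall>\<tau>\<ge>c. \<gamma> \<tau> = y) \<and>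
    (\<forall>s t \<kappa>. s \<le> t \<longrightarrow> 0 \<le> \<kappa> \<longrightarrow> (\<forall>\<tau>\<in>{s..t}. \<kappa> \<le> w (\<gamma> \<tau>)) \<longrightarrow>
       \<kappa> * dist (\<gamma> s) (\<gamma> t) \<le> t - s + \<kappa> * \<delta>)"
  using assms(1)
proof (induction rule: chain.induct)
  case start
  then show ?case using \<open>0 < \<delta>\<close> by (intro exI[of _ "\<lambda>_. x"]) auto
next
  case (extend y c z)
  from extend.IH obtain \<gamma> where \<gamma>: "range \<gamma> \<subseteq> Z" "\<gamma> 0 = x" "\<And>\<tau>. c \<le> \<tau> \<Longrightarrow> \<gamma> \<tau> = y"
    and P: "\<And>s t \<kappa>. s \<le> t \<Longrightarrow> 0 \<le> \<kappa> \<Longrightarrow> (\<forall>\<tau>\<in>{s..t}. \<kappa> \<le> w (\<gamma> \<tau>)) \<Longrightarrow>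
       \<kappa> * dist (\<gamma> s) (\<gamma> t) \<le> t - s + \<kappa> * \<delta>" by blast
  have "0 \<le> c" using chain_cost_nonneg extend.hyps(1) w by blast
  define c' where "c' = c + w y * dist y z"
  have c': "c \<le> c'" "c' = c \<Longrightarrow> y = z" using w[of y] by (auto simp: c'_def)
  define \<gamma>' where "\<gamma>' \<tau> = (if \<tau> < c' then \<gamma> \<tau> else z)" for \<tau>
  have P': "\<kappa> * dist (\<gamma>' s) (\<gamma>' t) \<le> t - s + \<kappa> * \<delta>"
    if st: "s \<le> t" "0 \<le> \<kappa>" and \<kappa>: "\<And>\<tau>. \<tau> \<in> {s..t} \<Longrightarrow> \<kappa> \<le> w (\<gamma>' \<tau>)" for s t \<kappa>
  proof -
    consider "t < c'" | "c' \<le> s" | "s < c'" "c \<le> s" "c' \<le> t" | "s < c" "c' \<le> t" by linarith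
    then show ?thesis
    proof cases
      case 1
      then have *: "\<gamma>' \<tau> = \<gamma> \<tau>" if "\<tau> \<in> {s..t}" for \<tau> using that by (auto simp: \<gamma>'_def)
      show ?thesis using P[OF st] \<kappa> * st by auto
    next
      case 2
      then show ?thesis using st \<open>0 < \<delta>\<close> by (simp add: \<gamma>'_def)
    next
      case 3
      then have "\<kappa> * dist (\<gamma>' s) (\<gamma>' t) \<le> \<kappa> * \<delta>"
        using \<gamma>(3) st extend.hyps by (intro mult_left_mono) (auto simp: \<gamma>'_def)
      then show ?thesis using st by simp
    next
      case 4
      have "\<gamma> \<tau> = \<gamma>' \<tau>" if "\<tau> \<in> {s..c}" for \<tau>
        using that c' \<gamma>(3)[of c] by (cases "c = c'") (auto simp: \<gamma>'_def)
      then have "\<kappa> * dist (\<gamma> s) (\<gamma> c) \<le> c - s + \<kappa> * \<delta>"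
        using P[of s c \<kappa>] \<kappa> 4 st c' by auto
      moreover have "\<kappa> * dist y z \<le> c' - c"
      proof (cases "c = c'")
        case False
        then have "\<gamma>' c = y" using c' \<gamma>(3)[of c] by (simp add: \<gamma>'_def)
        then have "\<kappa> \<le> w y" using \<kappa>[of c] 4 c' by auto
        then show ?thesis by (simp add: c'_def mult_right_mono)
      qed (use c' in simp)
      moreover have "\<kappa> * dist (\<gamma> s) z \<le> \<kappa> * (dist (\<gamma> s) y + dist y z)"
        using st dist_triangle by (intro mult_left_mono)
      ultimately show ?thesis using 4 c' \<gamma>(3)[of c] by (auto simp: \<gamma>'_def algebra_simps)
    qed
  qed
  show ?case
  proof (intro exI[of _ \<gamma>'] conjI allI impI)
    show "range \<gamma>' \<subseteq> Z" using \<gamma>(1) extend.hyps by (auto simp: \<gamma>'_def)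
    show "\<gamma>' 0 = x"
      using \<gamma>(2) \<gamma>(3)[of 0] c' \<open>0 \<le> c\<close> by (cases "c' = 0") (auto simp: \<gamma>'_def)
    show "\<gamma>' \<tau> = z" if "c + w y * dist y z \<le> \<tau>" for \<tau> using that by (simp add: \<gamma>'_def c'_def)
  qed (use P' in blast)
qed

text \<open>
  Tychonoff's theorem: a sequence of arbitrary functions into a compact set has a pointwise cluster
  point, which is approximated infinitely often at finitely many arguments simultaneously. The step
  curves are discontinuous, so that the Arzela--Ascoli theorem does not apply to them, but the estimates
  for the limit curve involve only two points at a time, and a cluster point in this sense suffices.
\<close>
lemma compact_Pi_cluster_point:
  fixes \<Gamma> :: "nat \<Rightarrow> 'b \<Rightarrow> 'a::metric_space"
  assumes "compact Z" "\<And>n. range (\<Gamma> n) \<subseteq> Z"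
  obtains \<gamma> where "range \<gamma> \<subseteq> Z"
    "\<And>T e N. finite T \<Longrightarrow> 0 < e \<Longrightarrow> \<exists>n\<ge>N. \<forall>t\<in>T. dist (\<Gamma> n t) (\<gamma> t) < e"
proof -
  let ?U = "PiE UNIV (\<lambda>_::'b. Z)"
  have "compactin (product_topology (\<lambda>_. euclidean) UNIV) ?U"
    using assms(1) by (simp add: compactin_PiE)
  then have "compact ?U" by (simp add: euclidean_product_topology)
  moreover have "filtermap \<Gamma> sequentially \<noteq> bot" by (simp add: filtermap_bot_iff)
  moreover have "eventually (\<lambda>f. f \<in> ?U) (filtermap \<Gamma> sequentially)"
    using assms(2) by (auto simp: eventually_filtermap PiE_iff image_subset_iff)
  ultimately obtain \<gamma> where \<gamma>: "\<gamma> \<in> ?U" "inf (nhds \<gamma>) (filtermap \<Gamma> sequentially) \<noteq> bot"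
    unfolding compact_filter by blast
  show thesis
  proof
    show "range \<gamma> \<subseteq> Z" using \<gamma>(1) by auto
    fix T :: "'b set" and e :: real and N :: nat
    assume T: "finite T" "0 < e"
    show "\<exists>n\<ge>N. \<forall>t\<in>T. dist (\<Gamma> n t) (\<gamma> t) < e"
    proof (rule ccontr)
      assume *: "\<not> ?thesis"
      let ?W = "\<Inter>t\<in>T. (\<lambda>f. f t) -` ball (\<gamma> t) e"
      have "open ?W"
        using T by (intro open_INT ballI open_vimage) (auto intro: continuous_on_product_coordinates)
      then have "eventually (\<lambda>f. f \<in> ?W) (nhds \<gamma>)"
        using T by (intro eventually_nhds_in_open) auto
      moreover have "eventually (\<lambda>f. f \<notin> ?W) (filtermap \<Gamma> sequentially)"
        unfolding eventually_filtermap eventually_sequentially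
        using * by (intro exI[of _ N]) (auto simp: dist_commute)
      ultimately have "eventually (\<lambda>_. False) (inf (nhds \<gamma>) (filtermap \<Gamma> sequentially))"
        unfolding eventually_inf by blast
      with \<gamma>(2) show False by (simp add: trivial_limit_def)
    qed
  qed
qed

text \<open>
  Since \<open>w n \<ge> 1\<close>, the step curves are nearly 1-Lipschitz. Hence on a short time interval all points
  of the \<open>n\<close>-th step curve are close to \<open>\<gamma> s\<close>, and \<open>w n \<ge> w m \<ge> w m (\<gamma> s) - e\<close> there for \<open>n \<ge> m\<close> by uniform
  continuity of \<open>w m\<close>. So the speed of the limit curve at \<open>s\<close> is at most \<open>1 / w m (\<gamma> s)\<close>, for every \<open>m\<close>;
  its travelling time \<open>A\<close> then bounds all line integrals.
\<close>
lemma limit_curve_of_chains: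
  fixes w :: "nat \<Rightarrow> 'a::metric_space \<Rightarrow> real"
  assumes "compact Z" and cont: "\<And>n. continuous_on Z (w n)"
    and ge1: "\<And>n z. 1 \<le> w n z" and inc: "\<And>z. incseq (\<lambda>n. w n z)"
    and chains: "\<And>n. \<exists>c\<le>A. chain Z (1 / real (Suc n)) (w n) x y c"
  obtains \<gamma> where "range \<gamma> \<subseteq> Z" "\<gamma> 0 = x" "\<gamma> A = y"
    "\<And>s t. s \<le> t \<Longrightarrow> dist (\<gamma> s) (\<gamma> t) \<le> t - s"
    "\<And>m e. 0 < e \<Longrightarrow> \<exists>d>0. \<forall>s t. s \<le> t \<and> t - s < d \<longrightarrow> w m (\<gamma> s) * dist (\<gamma> s) (\<gamma> t) \<le> (1 + e) * (t - s)"
proof -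
  have "\<exists>\<gamma>. range \<gamma> \<subseteq> Z \<and> \<gamma> 0 = x \<and> \<gamma> A = y \<and>
    (\<forall>s t \<kappa>. s \<le> t \<longrightarrow> 0 \<le> \<kappa> \<longrightarrow> (\<forall>\<tau>\<in>{s..t}. \<kappa> \<le> w n (\<gamma> \<tau>)) \<longrightarrow>
       \<kappa> * dist (\<gamma> s) (\<gamma> t) \<le> t - s + \<kappa> * (1 / real (Suc n)))" for n
  proof -
    obtain c where c: "c \<le> A" "chain Z (1 / real (Suc n)) (w n) x y c" using chains by blast
    have "0 < 1 / real (Suc n)" by simp
    from step_curve_of_chain[OF c(2) this ge1] obtain \<gamma> where "range \<gamma> \<subseteq> Z" "\<gamma> 0 = x"
      "\<forall>\<tau>\<ge>c. \<gamma> \<tau> = y" and "\<forall>s t \<kappa>. s \<le> t \<longrightarrow> 0 \<le> \<kappa> \<longrightarrow> (\<forall>\<tau>\<in>{s..t}. \<kappa> \<le> w n (\<gamma> \<tau>)) \<longrightarrow>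
       \<kappa> * dist (\<gamma> s) (\<gamma> t) \<le> t - s + \<kappa> * (1 / real (Suc n))" by (elim exE conjE) (rule that)
    with c(1) show ?thesis by (intro exI[of _ \<gamma>] conjI) simp_all
  qed
  then obtain \<Gamma> where \<Gamma>: "\<And>n. range (\<Gamma> n) \<subseteq> Z" "\<And>n. \<Gamma> n 0 = x" "\<And>n. \<Gamma> n A = y"
    and P: "\<And>n s t \<kappa>. s \<le> t \<Longrightarrow> 0 \<le> \<kappa> \<Longrightarrow> (\<And>\<tau>. \<tau> \<in> {s..t} \<Longrightarrow> \<kappa> \<le> w n (\<Gamma> n \<tau>)) \<Longrightarrow>
       \<kappa> * dist (\<Gamma> n s) (\<Gamma> n t) \<le> t - s + \<kappa> * (1 / real (Suc n))"
    by metis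
  obtain \<gamma> where \<gamma>: "range \<gamma> \<subseteq> Z"
    and lim: "\<And>T e N. finite T \<Longrightarrow> 0 < e \<Longrightarrow> \<exists>n\<ge>N. \<forall>t\<in>T. dist (\<Gamma> n t) (\<gamma> t) < e"
    by (rule compact_Pi_cluster_point[OF assms(1) \<Gamma>(1)]) (rule that)
  have near: "\<exists>n\<ge>N. dist (\<Gamma> n s) (\<gamma> s) < e \<and> dist (\<Gamma> n t) (\<gamma> t) < e \<and> 1 / real (Suc n) < e"
    if e: "0 < e" for e N s t
  proof -
    obtain N' where N': "1 / real (Suc N') < e"
      using reals_Archimedean[OF e] by (auto simp: inverse_eq_divide)
    obtain n where n: "max N N' \<le> n" "\<forall>r\<in>{s, t}. dist (\<Gamma> n r) (\<gamma> r) < e"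
      using lim[of "{s, t}" e "max N N'"] e by auto
    have "1 / real (Suc n) \<le> 1 / real (Suc N')" using n by (intro divide_left_mono) auto
    then show ?thesis using n N' by auto
  qed
  \<comment> \<open>The error terms in the estimate for the step curves vanish along indices \<open>n\<close> that approximate
    \<open>\<gamma>\<close> at \<open>s\<close> and \<open>t\<close>, provided that the weight is at least \<open>\<kappa>\<close> on \<open>\<Gamma> n\<close> between \<open>s\<close> and \<open>t\<close> for such \<open>n\<close>.\<close>
  have lim_le: "\<kappa> * dist (\<gamma> s) (\<gamma> t) \<le> t - s"
    if st: "s \<le> t" "0 \<le> \<kappa>" "0 < d" and "\<And>n. N \<le> n \<Longrightarrow> dist (\<Gamma> n s) (\<gamma> s) < d \<Longrightarrow> 1 / real (Suc n) < d \<Longrightarrow> (\<And>\<tau>. \<tau> \<in> {s..t} \<Longrightarrow> \<kappa> \<le> w n (\<Gamma> n \<tau>))"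
    for s t \<kappa> d N
  proof (rule field_le_epsilon)
    fix e :: real assume "0 < e"
    define e' where "e' = min d (e / (3 * \<kappa> + 1))"
    have "0 < e'" using \<open>0 < e\<close> st by (auto simp: e'_def)
    then obtain n where n: "N \<le> n" "dist (\<Gamma> n s) (\<gamma> s) < e'" "dist (\<Gamma> n t) (\<gamma> t) < e'" "1 / real (Suc n) < e'"
      using near by blast
    have "dist (\<gamma> s) (\<gamma> t) \<le> dist (\<Gamma> n s) (\<gamma> s) + dist (\<Gamma> n s) (\<Gamma> n t) + dist (\<Gamma> n t) (\<gamma> t)"
      by (smt (verit) dist_commute dist_triangle)
    then have "\<kappa> * dist (\<gamma> s) (\<gamma> t) \<le> \<kappa> * (e' + dist (\<Gamma> n s) (\<Gamma> n t) + e')"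
      using n st by (intro mult_left_mono) auto
    also have "\<dots> = \<kappa> * dist (\<Gamma> n s) (\<Gamma> n t) + 2 * \<kappa> * e'" by (simp add: algebra_simps)
    also have "\<kappa> * dist (\<Gamma> n s) (\<Gamma> n t) \<le> t - s + \<kappa> * (1 / real (Suc n))"
      using st n that(4)[of n] by (intro P) (auto simp: e'_def)
    also have "\<kappa> * (1 / real (Suc n)) \<le> \<kappa> * e'" using n st by (intro mult_left_mono) auto
    also have "t - s + \<kappa> * e' + 2 * \<kappa> * e' \<le> t - s + (3 * \<kappa> + 1) * e'"
      using \<open>0 < e'\<close> by (simp add: algebra_simps)
    also have "(3 * \<kappa> + 1) * e' \<le> (3 * \<kappa> + 1) * (e / (3 * \<kappa> + 1))"
      using st by (intro mult_left_mono) (auto simp: e'_def)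
    also have "(3 * \<kappa> + 1) * (e / (3 * \<kappa> + 1)) = e" using st by (simp add: add_nonneg_eq_0_iff)
    finally show "\<kappa> * dist (\<gamma> s) (\<gamma> t) \<le> t - s + e" by simp
  qed
  have lip: "dist (\<gamma> s) (\<gamma> t) \<le> t - s" if "s \<le> t" for s t
    using lim_le[of s t 1 1] that ge1 by simp
  have fixed: "\<gamma> r = z" if "\<And>n. \<Gamma> n r = z" for r z
  proof (rule ccontr)
    assume "\<gamma> r \<noteq> z"
    then have "0 < dist z (\<gamma> r)" by simp
    from near[OF this, of 0 r r] show False using that by auto
  qed
  show thesis
  proof (rule that[OF \<gamma> fixed[OF \<Gamma>(2)] fixed[OF \<Gamma>(3)] lip])
    fix m and e :: real assume "0 < e"
    have "uniformly_continuous_on Z (w m)" using cont assms(1) by (simp add: compact_uniformly_continuous)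
    then obtain d0 where d0: "0 < d0"
      "\<And>a b. a \<in> Z \<Longrightarrow> b \<in> Z \<Longrightarrow> dist b a < d0 \<Longrightarrow> dist (w m b) (w m a) < e"
      unfolding uniformly_continuous_on_def using \<open>0 < e\<close> by meson
    have "w m (\<gamma> s) * dist (\<gamma> s) (\<gamma> t) \<le> (1 + e) * (t - s)" if st: "s \<le> t" "t - s < d0 / 4" for s t
    proof -
      have "max 0 (w m (\<gamma> s) - e) * dist (\<gamma> s) (\<gamma> t) \<le> t - s"
      proof (rule lim_le[OF st(1), where d = "d0 / 4" and N = m])
        fix n \<tau> assume n: "m \<le> n" "dist (\<Gamma> n s) (\<gamma> s) < d0 / 4" "1 / real (Suc n) < d0 / 4"
          and \<tau>: "\<tau> \<in> {s..t}"
        have "1 * dist (\<Gamma> n s) (\<Gamma> n \<tau>) \<le> \<tau> - s + 1 * (1 / real (Suc n))"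
          using \<tau> ge1 by (intro P) auto
        then have "dist (\<Gamma> n \<tau>) (\<gamma> s) < d0"
          using n \<tau> st dist_triangle[of "\<Gamma> n \<tau>" "\<gamma> s" "\<Gamma> n s"] by (auto simp: dist_commute)
        then have "dist (w m (\<Gamma> n \<tau>)) (w m (\<gamma> s)) < e"
          using \<Gamma>(1) \<gamma> by (intro d0) auto
        then have "w m (\<gamma> s) - e \<le> w m (\<Gamma> n \<tau>)" by (simp add: dist_real_def)
        then show "max 0 (w m (\<gamma> s) - e) \<le> w n (\<Gamma> n \<tau>)"
          using incseqD[OF inc n(1), of "\<Gamma> n \<tau>"] ge1[of n "\<Gamma> n \<tau>"] by linarith
      qed (use d0 in auto)
      moreover have "(w m (\<gamma> s) - e) * dist (\<gamma> s) (\<gamma> t) \<le> max 0 (w m (\<gamma> s) - e) * dist (\<gamma> s) (\<gamma> t)"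
        by (intro mult_right_mono) auto
      moreover have "e * dist (\<gamma> s) (\<gamma> t) \<le> e * (t - s)"
        using lip[OF st(1)] \<open>0 < e\<close> by (intro mult_left_mono) auto
      ultimately show ?thesis by (simp add: algebra_simps)
    qed
    then show "\<exists>d>0. \<forall>s t. s \<le> t \<and> t - s < d \<longrightarrow> w m (\<gamma> s) * dist (\<gamma> s) (\<gamma> t) \<le> (1 + e) * (t - s)"
      using d0(1) by (intro exI[of _ "d0 / 4"]) auto
  qed
qed

text \<open>
  Reparametrized by arc length, the limit curve spends arc length at most \<open>(t - s) / w m\<close> during a short
  time interval \<open>{s..t}\<close>, so that the integral of \<open>w m\<close> over the corresponding piece is at most \<open>t - s\<close> up
  to a small relative error. These inequalities add up, and monotone convergence gives the supremum.
\<close>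
theorem arc_length_curve_of_chains:
  fixes w :: "nat \<Rightarrow> 'a::metric_space \<Rightarrow> real"
  assumes "compact Z" and cont: "\<And>n. continuous_on Z (w n)"
    and ge1: "\<And>n z. 1 \<le> w n z" and inc: "\<And>z. incseq (\<lambda>n. w n z)"
    and chains: "\<And>n. \<exists>c\<le>A. chain Z (1 / real (Suc n)) (w n) x y c"
    and "x \<noteq> y"
  obtains \<eta> l where "arc_length_curve Z \<eta> l" "\<eta> 0 = x" "\<eta> l = y"
    "(\<integral>\<^sup>+ t\<in>{0..l}. (SUP n. ennreal (w n (\<eta> t))) \<partial>lborel) \<le> ennreal A"
proof -
  obtain \<gamma> where \<gamma>: "range \<gamma> \<subseteq> Z" "\<gamma> 0 = x" "\<gamma> A = y"
    and lip: "\<And>s t. s \<le> t \<Longrightarrow> dist (\<gamma> s) (\<gamma> t) \<le> t - s"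
    and loc: "\<And>m e. 0 < e \<Longrightarrow> \<exists>d>0. \<forall>s t. s \<le> t \<and> t - s < d \<longrightarrow> w m (\<gamma> s) * dist (\<gamma> s) (\<gamma> t) \<le> (1 + e) * (t - s)"
    by (rule limit_curve_of_chains[OF assms(1-5)]) (rule that)
  have "0 \<le> A" using chains[of 0] chain_cost_nonneg[OF _ ge1] by fastforce
  have ends: "\<gamma> 0 \<noteq> \<gamma> A" using \<open>x \<noteq> y\<close> \<gamma> by simp
  have lip': "1-lipschitz_on {0..A} \<gamma>" using lip by (intro lipschitz_on_IccI) auto
  obtain \<eta> V where \<eta>: "arc_length_curve (\<gamma> ` {0..A}) \<eta> (V A)" and V0: "V 0 = 0"
    and \<eta>V: "\<And>t. 0 \<le> t \<Longrightarrow> t \<le> A \<Longrightarrow> \<eta> (V t) = \<gamma> t"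
    and Vmono: "\<And>s t. 0 \<le> s \<Longrightarrow> s \<le> t \<Longrightarrow> t \<le> A \<Longrightarrow> V s \<le> V t"
    and VK: "\<And>s t K. 0 \<le> s \<Longrightarrow> s \<le> t \<Longrightarrow> t \<le> A \<Longrightarrow> K-lipschitz_on {s..t} \<gamma> \<Longrightarrow> V t - V s \<le> K * (t - s)"
    by (rule arc_length_reparametrization[OF \<open>0 \<le> A\<close> ends lip']) (rule that)
  have \<eta>Z: "arc_length_curve Z \<eta> (V A)" using \<eta> \<gamma>(1) by (fastforce simp: arc_length_curve_def)
  have l: "0 < V A" "continuous_on {0..V A} \<eta>" "\<eta> ` {0..V A} \<subseteq> Z"
    using \<eta>Z by (auto simp: arc_length_curve_def)
  have hcont: "continuous_on {0..V A} (\<lambda>t. w m (\<eta> t))" for m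
    by (rule continuous_on_compose2[OF cont l(2,3)])
  have int_le: "integral {0..V A} (\<lambda>t. w m (\<eta> t)) \<le> A" for m
  proof (rule field_le_epsilon)
    fix e0 :: real assume "0 < e0"
    define e where "e = e0 / (3 * A + 1)"
    have "0 < e" using \<open>0 < e0\<close> \<open>0 \<le> A\<close> by (simp add: e_def)
    define h where "h t = w m (\<eta> t)" for t
    have h: "continuous_on {0..V A} h" using hcont[of m] by (simp add: h_def[abs_def])
    then have "uniformly_continuous_on {0..V A} h" by (simp add: compact_uniformly_continuous)
    then obtain d1 where d1: "0 < d1" "\<And>s t. s \<in> {0..V A} \<Longrightarrow> t \<in> {0..V A} \<Longrightarrow> dist t s < d1 \<Longrightarrow> dist (h t) (h s) < e"
      unfolding uniformly_continuous_on_def using \<open>0 < e\<close> by meson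
    obtain d2 where d2: "0 < d2" "\<And>s t. s \<le> t \<Longrightarrow> t - s < d2 \<Longrightarrow> w m (\<gamma> s) * dist (\<gamma> s) (\<gamma> t) \<le> (1 + e) * (t - s)"
      using loc[OF \<open>0 < e\<close>, of m] by blast
    \<comment> \<open>One \<open>e\<close> comes from the speed of \<open>\<gamma>\<close>, one from the variation of \<open>h\<close> when this speed is compared with
      \<open>1 / h (V s)\<close>, and one from the variation of \<open>h\<close> under the integral.\<close>
    define \<Phi> where "\<Phi> t = (1 + 3 * e) * t - integral {0..V t} h" for t
    have "\<Phi> 0 \<le> \<Phi> A"
    proof (rule local_mono_imp_le[of 0 A "min d1 d2"])
      fix s t assume st: "0 \<le> s" "s \<le> t" "t \<le> A" "t - s < min d1 d2"
      have Vlip: "V b - V a \<le> b - a" if "0 \<le> a" "a \<le> b" "b \<le> A" for a b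
        using VK[OF that, of 1] that lipschitz_on_subset[OF lip', of "{a..b}"] by simp
      have Vr: "V a \<in> {0..V A}" if "0 \<le> a" "a \<le> A" for a
        using Vmono[of 0 a] Vmono[of a A] that V0 by auto
      have near: "\<bar>h r - h (V s)\<bar> < e" if "r \<in> {V s..V t}" for r
        using d1(2)[of "V s" r] that Vlip[of s t] Vr[of s] Vr[of t] st by (auto simp: dist_real_def)
      have hs: "h (V s) = w m (\<gamma> s)" using st by (simp add: h_def \<eta>V)
      have "1 \<le> h (V s)" using ge1 by (simp add: h_def)
      have "V t - V s \<le> ((1 + 2 * e) / h (V s)) * (t - s)"
      proof (rule VK, goal_cases _ _ _ L)
        case L
        show ?case
        proof (rule lipschitz_on_IccI)
          fix a b assume ab: "s \<le> a" "a \<le> b" "b \<le> t"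
          have "h (V a) * dist (\<gamma> a) (\<gamma> b) \<le> (1 + e) * (b - a)"
            using d2(2)[of a b] ab st by (simp add: h_def \<eta>V)
          moreover have "(h (V s) - e) * dist (\<gamma> a) (\<gamma> b) \<le> h (V a) * dist (\<gamma> a) (\<gamma> b)"
            using near[of "V a"] ab st Vmono[of s a] Vmono[of a t] by (intro mult_right_mono) auto
          moreover have "e * dist (\<gamma> a) (\<gamma> b) \<le> e * (b - a)"
            using lip[of a b] ab \<open>0 < e\<close> by (intro mult_left_mono) auto
          ultimately have "h (V s) * dist (\<gamma> a) (\<gamma> b) \<le> (1 + 2 * e) * (b - a)" by (simp add: algebra_simps)
          then show "dist (\<gamma> a) (\<gamma> b) \<le> (1 + 2 * e) / h (V s) * (b - a)"
            using \<open>1 \<le> h (V s)\<close> by (simp add: field_simps)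
        qed (use \<open>0 < e\<close> \<open>1 \<le> h (V s)\<close> in auto)
      qed (use st in auto)
      then have 1: "h (V s) * (V t - V s) \<le> (1 + 2 * e) * (t - s)"
        using \<open>1 \<le> h (V s)\<close> by (simp add: field_simps)
      have "integral {V s..V t} h \<le> (h (V s) + e) * (V t - V s)"
        using near Vr[of s] Vr[of t] st Vmono[of s t]
        by (intro integral_Icc_bounds(2) continuous_on_subset[OF h]) (auto simp: abs_less_iff less_imp_le, smt (verit) atLeastAtMost_iff)
      also have "\<dots> = h (V s) * (V t - V s) + e * (V t - V s)" by (simp add: algebra_simps)
      also have "e * (V t - V s) \<le> e * (t - s)" using Vlip[of s t] st \<open>0 < e\<close> by (intro mult_left_mono) auto
      finally have "integral {V s..V t} h \<le> (1 + 3 * e) * (t - s)" using 1 by (simp add: algebra_simps)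
      moreover have "integral {0..V s} h + integral {V s..V t} h = integral {0..V t} h"
        using Vr[of s] Vr[of t] st Vmono[of s t]
        by (intro Henstock_Kurzweil_Integration.integral_combine integrable_continuous_interval continuous_on_subset[OF h]) auto
      ultimately show "\<Phi> s \<le> \<Phi> t" by (simp add: \<Phi>_def algebra_simps)
    qed (use \<open>0 \<le> A\<close> d1 d2 in auto)
    then have "integral {0..V A} h \<le> A + 3 * A * e" by (simp add: \<Phi>_def V0 algebra_simps)
    also have "\<dots> \<le> A + (3 * A + 1) * e" using \<open>0 < e\<close> by (simp add: algebra_simps)
    also have "\<dots> = A + e0" using \<open>0 \<le> A\<close> by (simp add: e_def)
    finally show "integral {0..V A} (\<lambda>t. w m (\<eta> t)) \<le> A + e0" by (simp add: h_def[abs_def])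
  qed
  have "(\<integral>\<^sup>+ t\<in>{0..V A}. (SUP n. ennreal (w n (\<eta> t))) \<partial>lborel)
     = (\<integral>\<^sup>+ t. (SUP n. ennreal (w n (\<eta> t)) * indicator {0..V A} t) \<partial>lborel)"
    by (intro nn_integral_cong) (auto simp: indicator_def)
  also have "\<dots> = (SUP n. \<integral>\<^sup>+ t\<in>{0..V A}. ennreal (w n (\<eta> t)) \<partial>lborel)"
  proof (rule nn_integral_monotone_convergence_SUP)
    show "incseq (\<lambda>n t. ennreal (w n (\<eta> t)) * indicator {0..V A} t)"
      using inc by (auto simp: incseq_def le_fun_def indicator_def intro!: ennreal_leI)
    fix n
    have "(\<lambda>t. indicator {0..V A} t *\<^sub>R w n (\<eta> t)) \<in> borel_measurable borel"
      using hcont by (rule borel_measurable_continuous_on_indicator[rotated]) auto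
    then have "(\<lambda>t. ennreal (indicator {0..V A} t *\<^sub>R w n (\<eta> t))) \<in> borel_measurable lborel" by simp
    moreover have "(\<lambda>t. ennreal (indicator {0..V A} t *\<^sub>R w n (\<eta> t))) = (\<lambda>t. ennreal (w n (\<eta> t)) * indicator {0..V A} t)"
      by (auto simp: indicator_def)
    ultimately show "(\<lambda>t. ennreal (w n (\<eta> t)) * indicator {0..V A} t) \<in> borel_measurable lborel" by simp
  qed
  also have "\<dots> \<le> ennreal A"
  proof (rule SUP_least)
    fix n
    have "0 \<le> w n z" for z using ge1[of n z] by linarith
    then show "(\<integral>\<^sup>+ t\<in>{0..V A}. ennreal (w n (\<eta> t)) \<partial>lborel) \<le> ennreal A"
      using int_le[of n] by (subst nn_integral_continuous_Icc[OF hcont]) (auto intro: ennreal_leI)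
  qed
  finally have fin: "(\<integral>\<^sup>+ t\<in>{0..V A}. (SUP n. ennreal (w n (\<eta> t))) \<partial>lborel) \<le> ennreal A" .
  show thesis
  proof (rule that[OF \<eta>Z _ _ fin])
    show "\<eta> 0 = x" using \<eta>V[of 0] V0 \<open>0 \<le> A\<close> \<gamma> by simp
    show "\<eta> (V A) = y" using \<eta>V[of A] \<open>0 \<le> A\<close> \<gamma> by simp
  qed
qed

section \<open>Separability and measurability\<close>

lemma metric_measure_spaceD:
  assumes "metric_measure_space M"
  shows "space M = UNIV" "sets borel \<subseteq> sets M" "complete_measure M"
    and "0 < r \<Longrightarrow> 0 < emeasure M (ball x r)" and "emeasure M (ball x r) < \<infinity>"
proof -
  show "emeasure M (ball x r) < \<infinity>"
    using assms by (cases "0 < r") (auto simp: metric_measure_space_def ball_empty)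
qed (use assms in \<open>auto simp: metric_measure_space_def\<close>)

lemma metric_measure_space_measurable:
  assumes "metric_measure_space M" "f \<in> measurable borel N"
  shows "f \<in> measurable M N"
  using measurable_mono[of N N borel M] metric_measure_spaceD[OF assms(1)] assms(2) by auto

lemma metric_measure_space_open: "metric_measure_space M \<Longrightarrow> open A \<Longrightarrow> A \<in> sets M"
  using metric_measure_spaceD(2) borel_open by blast

text \<open>
  Disjoint balls of positive measure inside a ball of finite measure form a summable, hence countable,
  family.
\<close>
lemma countable_separated_set:
  fixes M :: "'a::metric_space measure" and A :: "'a set"
  assumes M: "metric_measure_space M" and "0 < e"
    and sep: "\<And>a b. a \<in> A \<Longrightarrow> b \<in> A \<Longrightarrow> a \<noteq> b \<Longrightarrow> e \<le> dist a b"
  shows "countable A"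
proof -
  fix c :: 'a
  \<comment> \<open>Balls of radius \<open>e / 2\<close> about the points of \<open>A\<close> are disjoint.\<close>
  define m where "m x = measure M (ball x (e / 2))" for x
  have pos: "0 < m x" for x
    using metric_measure_spaceD(4)[OF M, of "e/2" x] metric_measure_spaceD(5)[OF M, of x "e/2"] \<open>0 < e\<close>
    by (simp add: m_def emeasure_eq_ennreal_measure)
  have "countable (A \<inter> ball c (real k))" for k
  proof -
    let ?A = "A \<inter> ball c (real k)"
    have "sum m F \<le> measure M (ball c (real k + e))" if F: "F \<subseteq> ?A" "finite F" for F
    proof -
      have "sum m F = measure M (\<Union>x\<in>F. ball x (e / 2))"
        unfolding m_def
      proof (rule measure_finite_Union[symmetric])
        show "disjoint_family_on (\<lambda>x. ball x (e / 2)) F"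
        proof (unfold disjoint_family_on_def, intro ballI impI)
          fix a b assume ab: "a \<in> F" "b \<in> F" "a \<noteq> b"
          then have "e \<le> dist a b" using sep F by auto
          then show "ball a (e / 2) \<inter> ball b (e / 2) = {}" by (intro disjoint_ballI) auto
        qed
        show "emeasure M (ball x (e / 2)) \<noteq> \<infinity>" for x
          using metric_measure_spaceD(5)[OF M, of x "e / 2"] by auto
      qed (use F M in \<open>auto intro: metric_measure_space_open\<close>)
      also have "\<dots> \<le> measure M (ball c (real k + e))"
      proof (rule measure_mono_fmeasurable)
        show "(\<Union>x\<in>F. ball x (e / 2)) \<subseteq> ball c (real k + e)"
        proof (clarsimp)
          fix x y assume "x \<in> F" "dist x y * 2 < e"
          then show "dist c y < real k + e"
            using F dist_triangle[of c y x] \<open>0 < e\<close> by auto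
        qed
        show "(\<Union>x\<in>F. ball x (e / 2)) \<in> sets M" using M by (intro metric_measure_space_open) auto
        show "ball c (real k + e) \<in> fmeasurable M"
          using metric_measure_spaceD(5)[OF M] metric_measure_space_open[OF M, of "ball c (real k + e)"]
          by (simp add: fmeasurable_def)
      qed
      finally show ?thesis .
    qed
    then have "m summable_on ?A"
      using pos by (intro nonneg_bdd_above_summable_on bdd_aboveI2) (auto simp: less_imp_le)
    then have "countable {x \<in> ?A. m x \<noteq> 0}" by (rule summable_countable_real)
    moreover have "{x \<in> ?A. m x \<noteq> 0} = ?A" using pos by (auto simp: less_imp_neq[THEN not_sym])
    ultimately show ?thesis by simp
  qed
  then have "countable (\<Union>k. A \<inter> ball c (real k))" by (intro countable_UN) auto
  moreover have "A \<subseteq> (\<Union>k. A \<inter> ball c (real k))"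
    using reals_Archimedean2 by auto
  ultimately show ?thesis by (rule countable_subset[rotated])
qed

lemma maximal_separated_set:
  fixes e :: real
  obtains A :: "'a::metric_space set"
  where "\<And>a b. a \<in> A \<Longrightarrow> b \<in> A \<Longrightarrow> a \<noteq> b \<Longrightarrow> e \<le> dist a b" "\<And>x. \<exists>a\<in>A. dist x a < e \<or> x = a"
proof -
  define S where "S = {A::'a set. \<forall>a\<in>A. \<forall>b\<in>A. a \<noteq> b \<longrightarrow> e \<le> dist a b}"
  have "\<exists>A\<in>S. \<forall>B\<in>S. A \<subseteq> B \<longrightarrow> B = A"
  proof (rule subset_Zorn_nonempty)
    show "S \<noteq> {}" by (auto simp: S_def)
    fix C assume C: "subset.chain S C"
    show "\<Union>C \<in> S"
      unfolding S_def
    proof (intro CollectI ballI impI)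
      fix a b assume "a \<in> \<Union>C" "b \<in> \<Union>C" "a \<noteq> b"
      then obtain A B where AB: "A \<in> C" "a \<in> A" "B \<in> C" "b \<in> B" by auto
      then have "A \<subseteq> B \<or> B \<subseteq> A" "A \<in> S" "B \<in> S" using C by (auto simp: subset_chain_def)
      then show "e \<le> dist a b" using AB \<open>a \<noteq> b\<close> by (auto simp: S_def)
    qed
  qed
  then obtain A where A: "A \<in> S" "\<And>B. B \<in> S \<Longrightarrow> A \<subseteq> B \<Longrightarrow> B = A" by blast
  show thesis
  proof
    show "e \<le> dist a b" if "a \<in> A" "b \<in> A" "a \<noteq> b" for a b using that A(1) by (auto simp: S_def)
    fix x
    show "\<exists>a\<in>A. dist x a < e \<or> x = a"
    proof (rule ccontr)
      assume *: "\<not> ?thesis"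
      then have "insert x A \<in> S" using A(1) by (auto simp: S_def dist_commute)
      then have "insert x A = A" using A(2) by blast
      with * show False by auto
    qed
  qed
qed

lemma metric_measure_space_separable:
  fixes M :: "'a::metric_space measure"
  assumes M: "metric_measure_space M"
  obtains D :: "'a set" where "countable D" "\<And>x e. 0 < e \<Longrightarrow> \<exists>q\<in>D. dist x q < e"
proof -
  have "\<exists>A::'a set. countable A \<and> (\<forall>x. \<exists>a\<in>A. dist x a < 1 / real (Suc n))" for n
  proof -
    obtain A :: "'a set" where A: "\<And>a b. a \<in> A \<Longrightarrow> b \<in> A \<Longrightarrow> a \<noteq> b \<Longrightarrow> 1 / real (Suc n) \<le> dist a b"
      "\<And>x. \<exists>a\<in>A. dist x a < 1 / real (Suc n) \<or> x = a"
      using maximal_separated_set[of "1 / real (Suc n)"] by metis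
    have "countable A" by (rule countable_separated_set[OF M _ A(1)]) auto
    moreover have "\<exists>a\<in>A. dist x a < 1 / real (Suc n)" for x using A(2)[of x] by (metis dist_self of_nat_0_less_iff zero_less_Suc zero_less_divide_1_iff)
    ultimately show ?thesis by blast
  qed
  then obtain A :: "nat \<Rightarrow> 'a set" where A: "\<And>n. countable (A n)" "\<And>n x. \<exists>a\<in>A n. dist x a < 1 / real (Suc n)"
    by metis
  show thesis
  proof
    show "countable (\<Union>n. A n)" using A by simp
    fix x :: 'a and e :: real assume "0 < e"
    then obtain n where "1 / real (Suc n) < e" using reals_Archimedean by (auto simp: inverse_eq_divide)
    then show "\<exists>q\<in>\<Union>n. A n. dist x q < e" using A(2)[where n=n and x=x] by force
  qed
qed

lemma sigma_finite_metric_measure_space: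
  fixes M :: "'a::metric_space measure"
  assumes M: "metric_measure_space M"
  shows "sigma_finite_measure M"
proof
  fix c :: 'a
  let ?A = "(\<lambda>k. ball c (real k)) ` (UNIV::nat set)"
  have "\<Union> ?A = space M"
    using reals_Archimedean2 metric_measure_spaceD(1)[OF M] by auto
  moreover have "?A \<subseteq> sets M" "\<forall>a\<in>?A. emeasure M a \<noteq> \<infinity>"
    using metric_measure_spaceD(5)[OF M] by (auto intro: metric_measure_space_open[OF M] simp: less_top[symmetric] order_less_imp_not_eq)
  ultimately show "\<exists>A. countable A \<and> A \<subseteq> sets M \<and> \<Union> A = space M \<and> (\<forall>a\<in>A. emeasure M a \<noteq> \<infinity>)"
    by (intro exI[of _ ?A]) auto
qed

text \<open>
  By separability, the set is a countable union of products of balls. This is what makes Tonelli's theorem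
  applicable to functions of the distance.
\<close>
lemma dist_less_measurable_pair:
  fixes M :: "'a::metric_space measure"
  assumes M: "metric_measure_space M"
  shows "{z. dist (fst z) (snd z) < r} \<in> sets (M \<Otimes>\<^sub>M M)"
proof -
  obtain D :: "'a set" where D: "countable D" "\<And>x e. 0 < e \<Longrightarrow> \<exists>q\<in>D. dist x q < e"
    using metric_measure_space_separable[OF M] by blast
  have eq: "{z. dist (fst z) (snd z) < r} = (\<Union>q\<in>D. \<Union>s\<in>\<rat>. ball q s \<times> ball q (r - s))"
  proof (intro set_eqI iffI)
    fix z :: "'a \<times> 'a" assume "z \<in> {z. dist (fst z) (snd z) < r}"
    then have lt: "0 < (r - dist (fst z) (snd z)) / 2" by simp
    from D(2)[OF this] obtain q where q: "q \<in> D" "dist (fst z) q < (r - dist (fst z) (snd z)) / 2" by blast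
    obtain s where s: "s \<in> \<rat>" "dist (fst z) q < s" "s < (r - dist (fst z) (snd z)) / 2"
      using Rats_dense_in_real[OF q(2)] by blast
    have "dist q (snd z) < r - s"
      using s dist_triangle[of q "snd z" "fst z"] by (simp add: dist_commute field_simps)
    with q s show "z \<in> (\<Union>q\<in>D. \<Union>s\<in>\<rat>. ball q s \<times> ball q (r - s))"
      by (cases z) (auto simp: dist_commute)
  next
    fix z assume "z \<in> (\<Union>q\<in>D. \<Union>s\<in>\<rat>. ball q s \<times> ball q (r - s))"
    then obtain q s where "dist q (fst z) < s" "dist q (snd z) < r - s" by auto
    then show "z \<in> {z. dist (fst z) (snd z) < r}"
      using dist_triangle2[of "fst z" "snd z" q] by (simp add: dist_commute)
  qed
  have "ball q s \<times> ball q t \<in> sets (M \<Otimes>\<^sub>M M)" for q s t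
    by (intro pair_measureI metric_measure_space_open[OF M]) auto
  then show ?thesis
    unfolding eq by (intro sets.countable_UN'' D(1) countable_rat) auto
qed

section \<open>Regularity of measures and the Vitali--Caratheodory theorem\<close>

text \<open>
  The sets that are approximated from both sides form a sigma-algebra; closed sets belong to it, as they
  are intersections of decreasing sequences of open neighbourhoods.
\<close>
lemma outer_inner_regular:
  assumes N: "finite_measure N" "sets N = sets (borel :: 'a::metric_space measure)"
    and "A \<in> sets borel"
  shows "\<forall>e>0. \<exists>U F. open U \<and> closed F \<and> F \<subseteq> A \<and> A \<subseteq> U \<and> emeasure N (U - F) < ennreal e"
proof -
  interpret finite_measure N by fact
  have "A \<in> sigma_sets UNIV (Collect closed)"
    using assms(3) by (simp add: borel_eq_closed)
  then show ?thesis
  proof induction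
    case (Basic A)
    then have "closed A" by simp
    show ?case
    proof (cases "A = {}")
      case True
      then show ?thesis by (auto intro!: exI[of _ "{}"])
    next
      case False
      define U where "U n = {x. infdist x A < 1 / real (Suc n)}" for n
      have U: "open (U n)" for n
        unfolding U_def by (intro open_Collect_less continuous_intros)
      have AU: "A \<subseteq> U n" for n by (auto simp: U_def)
      have "decseq (\<lambda>n. U n - A)"
      proof (rule decseq_SucI, rule Diff_mono)
        fix n
        have "1 / real (Suc (Suc n)) \<le> 1 / real (Suc n)" by (intro divide_left_mono) auto
        then show "U (Suc n) \<subseteq> U n" by (auto simp: U_def)
      qed simp
      then have "(\<lambda>n. emeasure N (U n - A)) \<longlonglongrightarrow> emeasure N (\<Inter>n. U n - A)"
        using U \<open>closed A\<close> by (intro Lim_emeasure_decseq) (auto simp: N(2) emeasure_finite)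
      moreover have empty: "(\<Inter>n. U n - A) = {}"
      proof (rule ccontr)
        assume "(\<Inter>n. U n - A) \<noteq> {}"
        then obtain x where x: "\<And>n. x \<in> U n" "x \<notin> A" by auto
        then have "0 < infdist x A" using \<open>closed A\<close> False by (intro infdist_pos_not_in_closed) auto
        then obtain n where "1 / real (Suc n) < infdist x A"
          using reals_Archimedean by (auto simp: inverse_eq_divide)
        with x(1)[of n] show False by (simp add: U_def)
      qed
      ultimately have lim: "(\<lambda>n. emeasure N (U n - A)) \<longlonglongrightarrow> 0"
        by (simp only: emeasure_empty)
      show ?thesis
      proof (intro allI impI)
        fix e :: real assume "0 < e"
        then have "eventually (\<lambda>n. emeasure N (U n - A) < ennreal e) sequentially"
          by (intro order_tendstoD(2)[OF lim]) simp
        then obtain n where "emeasure N (U n - A) < ennreal e"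
          by (auto simp: eventually_sequentially)
        with U AU \<open>closed A\<close> show "\<exists>U F. open U \<and> closed F \<and> F \<subseteq> A \<and> A \<subseteq> U \<and> emeasure N (U - F) < ennreal e"
          by blast
      qed
    qed
  next
    case Empty
    then show ?case by (auto intro!: exI[of _ "{}"])
  next
    case (Compl A)
    show ?case
    proof (intro allI impI)
      fix e :: real assume "0 < e"
      then obtain U F where UF: "open U" "closed F" "F \<subseteq> A" "A \<subseteq> U" "emeasure N (U - F) < ennreal e"
        using Compl.IH[rule_format, OF \<open>0 < e\<close>] by blast
      show "\<exists>U F. open U \<and> closed F \<and> F \<subseteq> UNIV - A \<and> UNIV - A \<subseteq> U \<and> emeasure N (U - F) < ennreal e"
      proof (intro exI conjI)
        have "- F - (- U) = U - F" by auto
        then show "emeasure N (- F - (- U)) < ennreal e" using UF by simp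
      qed (use UF in auto)
    qed
  next
    case (Union A)
    show ?case
    proof (intro allI impI)
      fix e :: real assume "0 < e"
      define \<epsilon> where "\<epsilon> i = (e / 2) * (1 / 2) ^ Suc i" for i
      have \<epsilon>: "0 < \<epsilon> i" for i using \<open>0 < e\<close> by (simp add: \<epsilon>_def)
      have "\<epsilon> sums ((e / 2) * 1)"
        unfolding \<epsilon>_def by (intro sums_mult power_half_series)
      then have sum\<epsilon>: "(\<Sum>i. ennreal (\<epsilon> i)) = ennreal (e / 2)"
        using \<epsilon> by (intro suminf_ennreal_eq) (auto simp: less_imp_le)
      have "\<forall>i. \<exists>U F. open U \<and> closed F \<and> F \<subseteq> A i \<and> A i \<subseteq> U \<and> emeasure N (U - F) < ennreal (\<epsilon> i)"
        using Union.IH \<epsilon> by blast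
      then obtain U F where UF: "\<And>i. open (U i)" "\<And>i. closed (F i)" "\<And>i. F i \<subseteq> A i" "\<And>i. A i \<subseteq> U i"
        "\<And>i. emeasure N (U i - F i) < ennreal (\<epsilon> i)" by metis
      \<comment> \<open>An infinite union of closed sets need not be closed, so finitely many must suffice.\<close>
      define V where "V n = (\<Union>i. U i) - (\<Union>i\<le>n. F i)" for n :: nat
      have Vs: "V n \<in> sets N" for n
        unfolding V_def N(2) using UF by (intro sets.Diff borel_open borel_closed) auto
      have "decseq V" unfolding V_def decseq_def by (auto intro: order_trans)
      then have lim: "(\<lambda>n. emeasure N (V n)) \<longlonglongrightarrow> emeasure N (\<Inter>n. V n)"
        using Vs by (intro Lim_emeasure_decseq) (auto simp: emeasure_finite)
      have "(\<Inter>n. V n) \<subseteq> (\<Union>i. U i - F i)"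
      proof
        fix x assume x: "x \<in> (\<Inter>n. V n)"
        then have "x \<in> V 0" by blast
        then obtain i where i: "x \<in> U i" by (auto simp: V_def)
        have "x \<in> V i" using x by blast
        with i show "x \<in> (\<Union>i. U i - F i)" by (auto simp: V_def)
      qed
      then have "emeasure N (\<Inter>n. V n) \<le> emeasure N (\<Union>i. U i - F i)"
        using UF by (intro emeasure_mono) (auto simp: N(2))
      also have "\<dots> \<le> (\<Sum>i. emeasure N (U i - F i))"
        using UF by (intro emeasure_subadditive_countably) (auto simp: N(2))
      also have "\<dots> \<le> (\<Sum>i. ennreal (\<epsilon> i))"
        using UF(5) by (intro suminf_le) (auto simp: less_imp_le)
      also have "\<dots> < ennreal e" using \<open>0 < e\<close> by (simp add: sum\<epsilon> ennreal_lessI)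
      finally have "eventually (\<lambda>n. emeasure N (V n) < ennreal e) sequentially"
        by (rule order_tendstoD(2)[OF lim])
      then obtain n where "emeasure N (V n) < ennreal e" by (auto simp: eventually_sequentially)
      moreover have "open (\<Union>i. U i)" "closed (\<Union>i\<le>n. F i)" using UF by auto
      moreover have "(\<Union>i\<le>n. F i) \<subseteq> \<Union> (range A)" "\<Union> (range A) \<subseteq> (\<Union>i. U i)" using UF(3,4) by blast+
      ultimately show "\<exists>U F. open U \<and> closed F \<and> F \<subseteq> \<Union> (range A) \<and> \<Union> (range A) \<subseteq> U \<and> emeasure N (U - F) < ennreal e"
        unfolding V_def by blast
    qed
  qed
qed

text \<open>
  The suprema of such sequences are the lower semicontinuous functions with values in \<open>[0,\<infinity>]\<close>. Working
  with the sequences gives directly the continuous weights needed for chains.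
\<close>
definition continuous_incseq :: "(nat \<Rightarrow> 'a::metric_space \<Rightarrow> real) \<Rightarrow> bool" where
  "continuous_incseq \<phi> \<longleftrightarrow>
     (\<forall>n. continuous_on UNIV (\<phi> n)) \<and> (\<forall>n x. 0 \<le> \<phi> n x) \<and> (\<forall>x. incseq (\<lambda>n. \<phi> n x))"

lemma open_indicator_SUP_continuous:
  fixes U :: "'a::metric_space set"
  assumes "open U"
  shows "\<exists>\<phi>. continuous_incseq \<phi> \<and> (\<forall>x. (SUP n. ennreal (\<phi> n x)) = indicator U x)"
proof (cases "U = UNIV")
  case True
  then show ?thesis
    by (intro exI[of _ "\<lambda>_ _. 1"]) (auto simp: continuous_incseq_def)
next
  case False
  define \<phi> where "\<phi> n x = min 1 (real n * infdist x (- U))" for n x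
  have "continuous_incseq \<phi>"
    unfolding continuous_incseq_def
  proof (intro conjI allI)
    show "continuous_on UNIV (\<phi> n)" for n unfolding \<phi>_def by (intro continuous_intros)
    show "0 \<le> \<phi> n x" for n x by (simp add: \<phi>_def infdist_nonneg)
    show "incseq (\<lambda>n. \<phi> n x)" for x
      unfolding \<phi>_def incseq_def by (intro allI impI min.mono mult_right_mono) (auto simp: infdist_nonneg)
  qed
  moreover have "(SUP n. ennreal (\<phi> n x)) = indicator U x" for x
  proof (cases "x \<in> U")
    case True
    then have "0 < infdist x (- U)" using False assms by (intro infdist_pos_not_in_closed) auto
    then obtain n where "1 < real n * infdist x (- U)" using reals_Archimedean3 by blast
    then have "1 \<le> ennreal (\<phi> n x)" by (simp add: \<phi>_def)
    then have "1 \<le> (SUP n. ennreal (\<phi> n x))" by (rule SUP_upper2[rotated]) simp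
    moreover have "(SUP n. ennreal (\<phi> n x)) \<le> 1" by (intro SUP_least) (simp add: \<phi>_def)
    ultimately have "(SUP n. ennreal (\<phi> n x)) = 1" by (rule antisym[rotated])
    then show ?thesis using True by simp
  next
    case False
    then show ?thesis by (simp add: \<phi>_def)
  qed
  ultimately show ?thesis by blast
qed

text \<open>
  Suprema of sequences of lower semicontinuous functions are represented by finite maxima of the
  approximating functions.
\<close>
lemma continuous_on_Max_atMost:
  fixes f :: "nat \<Rightarrow> 'a::topological_space \<Rightarrow> real"
  assumes "\<And>i. continuous_on S (f i)"
  shows "continuous_on S (\<lambda>x. Max ((\<lambda>i. f i x) ` {..n}))"
proof (induction n)
  case (Suc n)
  have "Max ((\<lambda>i. f i x) ` {..Suc n}) = max (f (Suc n) x) (Max ((\<lambda>i. f i x) ` {..n}))" for x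
    by (simp add: atMost_Suc)
  then show ?case using assms Suc by (simp add: continuous_on_max)
qed (use assms in simp)

text \<open>
  The excess of the majorant over \<open>f\<close> is recorded by a separate function \<open>h\<close> because the values of \<open>f\<close> may
  be infinite, so that a difference would be meaningless. For indicator functions, the excess is
  controlled by outer regularity; sums, multiples and increasing limits preserve the property, where in
  the case of a limit the excesses of the approximating functions are summed with a geometric series.
\<close>
theorem Vitali_Caratheodory:
  assumes N: "finite_measure N" "sets N = sets (borel :: 'a::metric_space measure)"
    and "f \<in> borel_measurable (borel :: 'a measure)"
  shows "\<forall>e>0. \<exists>\<phi> h. continuous_incseq \<phi> \<and> h \<in> borel_measurable borel \<and>
     (\<forall>x. f x \<le> (SUP n. ennreal (\<phi> n x)) \<and> (SUP n. ennreal (\<phi> n x)) \<le> f x + h x) \<and>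
     integral\<^sup>N N h \<le> ennreal e"
  using assms(3)
proof (induction rule: borel_measurable_induct)
  case (cong f g)
  then have "f = g" by (auto simp: fun_eq_iff)
  with cong show ?case by blast
next
  case (set A)
  show ?case
  proof (intro allI impI)
    fix e :: real assume "0 < e"
    then obtain U F where UF: "open U" "closed F" "F \<subseteq> A" "A \<subseteq> U" "emeasure N (U - F) < ennreal e"
      using outer_inner_regular[OF N set, rule_format, OF \<open>0 < e\<close>] by blast
    obtain \<phi> where \<phi>: "continuous_incseq \<phi>" "\<And>x. (SUP n. ennreal (\<phi> n x)) = indicator U x"
      using open_indicator_SUP_continuous[OF UF(1)] by blast
    show "\<exists>\<phi> h. continuous_incseq \<phi> \<and> h \<in> borel_measurable borel \<and>
     (\<forall>x. indicator A x \<le> (SUP n. ennreal (\<phi> n x)) \<and> (SUP n. ennreal (\<phi> n x)) \<le> indicator A x + h x) \<and>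
     integral\<^sup>N N h \<le> ennreal e"
    proof (intro exI[of _ \<phi>] exI[of _ "indicator (U - F)"] conjI allI)
      show "integral\<^sup>N N (indicator (U - F)) \<le> ennreal e"
        using UF by (simp add: N(2) borel_closed borel_open)
      show "indicator (U - F) \<in> borel_measurable borel"
        using UF by (intro borel_measurable_indicator sets.Diff borel_open borel_closed)
    qed (use UF \<phi> in \<open>auto simp: indicator_def\<close>)
  qed
next
  case (mult u c)
  show ?case
  proof (intro allI impI)
    fix e :: real assume "0 < e"
    define c' where "c' = enn2real c"
    have c': "0 \<le> c'" "c = ennreal c'" using mult.hyps by (auto simp: c'_def)
    have "0 < e / (c' + 1)" using \<open>0 < e\<close> c' by simp
    then obtain \<phi> h where \<phi>: "continuous_incseq \<phi>" "h \<in> borel_measurable borel"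
      "\<And>x. u x \<le> (SUP n. ennreal (\<phi> n x)) \<and> (SUP n. ennreal (\<phi> n x)) \<le> u x + h x"
      "integral\<^sup>N N h \<le> ennreal (e / (c' + 1))" using mult.IH by blast
    have eq: "(SUP n. ennreal (c' * \<phi> n x)) = c * (SUP n. ennreal (\<phi> n x))" for x
      using c' by (simp add: SUP_mult_left_ennreal ennreal_mult')
    show "\<exists>\<phi> h. continuous_incseq \<phi> \<and> h \<in> borel_measurable borel \<and>
     (\<forall>x. c * u x \<le> (SUP n. ennreal (\<phi> n x)) \<and> (SUP n. ennreal (\<phi> n x)) \<le> c * u x + h x) \<and>
     integral\<^sup>N N h \<le> ennreal e"
    proof (intro exI[of _ "\<lambda>n x. c' * \<phi> n x"] exI[of _ "\<lambda>x. c * h x"] conjI allI)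
      show "continuous_incseq (\<lambda>n x. c' * \<phi> n x)"
        using \<phi>(1) c' by (auto simp: continuous_incseq_def incseq_def intro!: continuous_intros mult_left_mono)
      show "(\<lambda>x. c * h x) \<in> borel_measurable borel" using \<phi>(2) by simp
      fix x
      show "c * u x \<le> (SUP n. ennreal (c' * \<phi> n x))"
        unfolding eq using \<phi>(3)[of x] by (intro mult_left_mono) auto
      show "(SUP n. ennreal (c' * \<phi> n x)) \<le> c * u x + c * h x"
        unfolding eq distrib_left[symmetric] using \<phi>(3)[of x] by (intro mult_left_mono) auto
    next
      have "integral\<^sup>N N (\<lambda>x. c * h x) = c * integral\<^sup>N N h"
        using \<phi>(2) N(2) by (intro nn_integral_cmult) (simp add: measurable_def sets_eq_imp_space_eq[OF N(2)])
      also have "\<dots> \<le> ennreal c' * ennreal (e / (c' + 1))" unfolding c'(2) using \<phi>(4) by (intro mult_left_mono) auto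
      also have "\<dots> = ennreal (c' * (e / (c' + 1)))" using c' by (intro ennreal_mult'[symmetric])
      also have "\<dots> \<le> ennreal e"
        using c' \<open>0 < e\<close> by (intro ennreal_leI) (simp add: field_simps)
      finally show "integral\<^sup>N N (\<lambda>x. c * h x) \<le> ennreal e" .
    qed
  qed
next
  case (add u v)
  show ?case
  proof (intro allI impI)
    fix e :: real assume "0 < e"
    then have "0 < e / 2" by simp
    then obtain \<phi> h where \<phi>: "continuous_incseq \<phi>" "h \<in> borel_measurable borel"
      "\<And>x. u x \<le> (SUP n. ennreal (\<phi> n x)) \<and> (SUP n. ennreal (\<phi> n x)) \<le> u x + h x"
      "integral\<^sup>N N h \<le> ennreal (e / 2)" using add.IH(1) by blast
    from \<open>0 < e / 2\<close> obtain \<psi> k where \<psi>: "continuous_incseq \<psi>" "k \<in> borel_measurable borel"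
      "\<And>x. v x \<le> (SUP n. ennreal (\<psi> n x)) \<and> (SUP n. ennreal (\<psi> n x)) \<le> v x + k x"
      "integral\<^sup>N N k \<le> ennreal (e / 2)" using add.IH(2) by blast
    have eq: "(SUP n. ennreal (\<psi> n x + \<phi> n x)) = (SUP n. ennreal (\<psi> n x)) + (SUP n. ennreal (\<phi> n x))" for x
    proof -
      have "(SUP n. ennreal (\<psi> n x + \<phi> n x)) = (SUP n. ennreal (\<psi> n x) + ennreal (\<phi> n x))"
        using \<phi>(1) \<psi>(1) by (simp add: continuous_incseq_def)
      also have "\<dots> = (SUP n. ennreal (\<psi> n x)) + (SUP n. ennreal (\<phi> n x))"
        using \<phi>(1) \<psi>(1) by (intro ennreal_SUP_add) (auto simp: continuous_incseq_def incseq_def ennreal_leI)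
      finally show ?thesis .
    qed
    show "\<exists>\<phi> h. continuous_incseq \<phi> \<and> h \<in> borel_measurable borel \<and>
     (\<forall>x. v x + u x \<le> (SUP n. ennreal (\<phi> n x)) \<and> (SUP n. ennreal (\<phi> n x)) \<le> v x + u x + h x) \<and>
     integral\<^sup>N N h \<le> ennreal e"
    proof (intro exI[of _ "\<lambda>n x. \<psi> n x + \<phi> n x"] exI[of _ "\<lambda>x. k x + h x"] conjI allI)
      show "continuous_incseq (\<lambda>n x. \<psi> n x + \<phi> n x)"
        using \<phi>(1) \<psi>(1) by (auto simp: continuous_incseq_def incseq_def intro!: continuous_intros add_mono)
      show "(\<lambda>x. k x + h x) \<in> borel_measurable borel" using \<phi>(2) \<psi>(2) by simp
      fix x
      show "v x + u x \<le> (SUP n. ennreal (\<psi> n x + \<phi> n x))"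
        unfolding eq using \<phi>(3)[of x] \<psi>(3)[of x] by (intro add_mono) auto
      have "(SUP n. ennreal (\<psi> n x)) + (SUP n. ennreal (\<phi> n x)) \<le> (v x + k x) + (u x + h x)"
        using \<phi>(3)[of x] \<psi>(3)[of x] by (intro add_mono) auto
      then show "(SUP n. ennreal (\<psi> n x + \<phi> n x)) \<le> v x + u x + (k x + h x)"
        unfolding eq by (simp add: ac_simps)
    next
      have "integral\<^sup>N N (\<lambda>x. k x + h x) = integral\<^sup>N N k + integral\<^sup>N N h"
        using \<phi>(2) \<psi>(2) by (intro nn_integral_add) (auto simp: measurable_def sets_eq_imp_space_eq[OF N(2)] N(2))
      also have "\<dots> \<le> ennreal (e / 2) + ennreal (e / 2)" using \<phi>(4) \<psi>(4) by (intro add_mono)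
      also have "\<dots> = ennreal e" using \<open>0 < e\<close> by (simp flip: ennreal_plus)
      finally show "integral\<^sup>N N (\<lambda>x. k x + h x) \<le> ennreal e" .
    qed
  qed
next
  case (seq U)
  show ?case
  proof (intro allI impI)
    fix e :: real assume "0 < e"
    define \<epsilon> where "\<epsilon> i = e * (1 / 2) ^ Suc i" for i
    have \<epsilon>: "0 < \<epsilon> i" for i using \<open>0 < e\<close> by (simp add: \<epsilon>_def)
    have "\<epsilon> sums (e * 1)" unfolding \<epsilon>_def by (intro sums_mult power_half_series)
    then have sum\<epsilon>: "(\<Sum>i. ennreal (\<epsilon> i)) = ennreal e"
      using \<epsilon> by (intro suminf_ennreal_eq) (auto simp: less_imp_le)
    have "\<forall>i. \<exists>\<phi> h. continuous_incseq \<phi> \<and> h \<in> borel_measurable borel \<and>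
     (\<forall>x. U i x \<le> (SUP n. ennreal (\<phi> n x)) \<and> (SUP n. ennreal (\<phi> n x)) \<le> U i x + h x) \<and>
     integral\<^sup>N N h \<le> ennreal (\<epsilon> i)"
      using seq.IH \<epsilon> by blast
    then obtain \<Phi> h where \<Phi>: "\<And>i. continuous_incseq (\<Phi> i)" and h: "\<And>i. h i \<in> borel_measurable borel"
      and lower: "\<And>i x. U i x \<le> (SUP n. ennreal (\<Phi> i n x))"
      and upper: "\<And>i x. (SUP n. ennreal (\<Phi> i n x)) \<le> U i x + h i x"
      and int: "\<And>i. integral\<^sup>N N (h i) \<le> ennreal (\<epsilon> i)"
      by metis
    have \<Phi>D: "continuous_on UNIV (\<Phi> i n)" "0 \<le> \<Phi> i n x" "incseq (\<lambda>n. \<Phi> i n x)" for i n x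
      using \<Phi> by (auto simp: continuous_incseq_def)
    define \<psi> where "\<psi> n x = Max ((\<lambda>i. \<Phi> i n x) ` {..n})" for n x
    have \<psi>ge: "\<Phi> i n x \<le> \<psi> n x" if "i \<le> n" for i n x
      unfolding \<psi>_def using that by (intro Max_ge) auto
    have \<psi>ex: "\<exists>i\<le>n. \<psi> n x = \<Phi> i n x" for n x
    proof -
      have "\<psi> n x \<in> (\<lambda>i. \<Phi> i n x) ` {..n}" unfolding \<psi>_def by (intro Max_in) auto
      then show ?thesis by auto
    qed
    have up: "(SUP n. ennreal (\<Phi> i n x)) \<le> (SUP n. ennreal (\<psi> n x))" for i x
    proof (rule SUP_least)
      fix n
      have "\<Phi> i n x \<le> \<Phi> i (max i n) x" using \<Phi>D(3) by (rule incseqD) simp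
      also have "\<dots> \<le> \<psi> (max i n) x" by (rule \<psi>ge) simp
      finally show "ennreal (\<Phi> i n x) \<le> (SUP n. ennreal (\<psi> n x))"
        by (intro SUP_upper2[of "max i n"]) (auto intro: ennreal_leI)
    qed
    show "\<exists>\<phi> h. continuous_incseq \<phi> \<and> h \<in> borel_measurable borel \<and>
     (\<forall>x. (SUP i. U i) x \<le> (SUP n. ennreal (\<phi> n x)) \<and> (SUP n. ennreal (\<phi> n x)) \<le> (SUP i. U i) x + h x) \<and>
     integral\<^sup>N N h \<le> ennreal e"
    proof (intro exI[of _ \<psi>] exI[of _ "\<lambda>x. \<Sum>i. h i x"] conjI allI)
      show "continuous_incseq \<psi>"
        unfolding continuous_incseq_def
      proof (intro conjI allI)
        show "continuous_on UNIV (\<psi> n)" for n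
          unfolding \<psi>_def[abs_def] by (rule continuous_on_Max_atMost) (rule \<Phi>D)
        show "0 \<le> \<psi> n x" for n x using \<psi>ge[of 0 n x] \<Phi>D(2)[of 0 n x] by simp
        show "incseq (\<lambda>n. \<psi> n x)" for x
        proof (rule incseq_SucI)
          fix n
          obtain i where i: "i \<le> n" "\<psi> n x = \<Phi> i n x" using \<psi>ex by blast
          have "\<Phi> i n x \<le> \<Phi> i (Suc n) x" using \<Phi>D(3) by (rule incseqD) simp
          also have "\<dots> \<le> \<psi> (Suc n) x" using i by (intro \<psi>ge) simp
          finally show "\<psi> n x \<le> \<psi> (Suc n) x" using i by simp
        qed
      qed
      show "(\<lambda>x. \<Sum>i. h i x) \<in> borel_measurable borel" using h by measurable
      fix x
      show "(SUP i. U i) x \<le> (SUP n. ennreal (\<psi> n x))"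
        using order_trans[OF lower up] by (auto intro!: SUP_least)
      show "(SUP n. ennreal (\<psi> n x)) \<le> (SUP i. U i) x + (\<Sum>i. h i x)"
      proof (rule SUP_least)
        fix n
        obtain i where i: "i \<le> n" "\<psi> n x = \<Phi> i n x" using \<psi>ex by blast
        have "ennreal (\<psi> n x) \<le> (SUP n. ennreal (\<Phi> i n x))" unfolding i(2) by (rule SUP_upper) simp
        also have "\<dots> \<le> U i x + h i x" by (rule upper)
        also have "U i x \<le> (SUP i. U i) x" by (auto intro: SUP_upper)
        also have "h i x \<le> (\<Sum>i. h i x)"
          using sum_le_suminf[of "\<lambda>i. h i x" "{i}"] by simp
        finally show "ennreal (\<psi> n x) \<le> (SUP i. U i) x + (\<Sum>i. h i x)" by (simp add: add_mono)
      qed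
    next
      have "integral\<^sup>N N (\<lambda>x. \<Sum>i. h i x) = (\<Sum>i. integral\<^sup>N N (h i))"
        using h by (intro nn_integral_suminf) (auto simp: measurable_def sets_eq_imp_space_eq[OF N(2)] N(2))
      also have "\<dots> \<le> (\<Sum>i. ennreal (\<epsilon> i))" using int by (intro suminf_le) auto
      finally show "integral\<^sup>N N (\<lambda>x. \<Sum>i. h i x) \<le> ennreal e" by (simp add: sum\<epsilon>)
    qed
  qed
qed

section \<open>Integrating mean values over balls\<close>

lemma average_measurable:
  fixes M :: "'a::metric_space measure"
  assumes M: "metric_measure_space M" and [measurable]: "F \<in> borel_measurable M"
  shows "(\<lambda>x. (\<integral>\<^sup>+ y\<in>ball x r. F y \<partial>M) / emeasure M (ball x r)) \<in> borel_measurable M"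
proof -
  interpret sigma_finite_measure M using M by (rule sigma_finite_metric_measure_space)
  have [measurable]: "{z. dist (fst z) (snd z) < r} \<in> sets (M \<Otimes>\<^sub>M M)"
    by (rule dist_less_measurable_pair[OF M])
  have "(\<lambda>(x, y). F y * indicator (ball x r) y) = (\<lambda>z. F (snd z) * indicator {z. dist (fst z) (snd z) < r} z)"
    by (auto simp: indicator_def fun_eq_iff)
  then have 1: "(\<lambda>(x, y). F y * indicator (ball x r) y) \<in> borel_measurable (M \<Otimes>\<^sub>M M)" by simp
  have "(\<lambda>(x::'a, y). indicator (ball x r) y :: ennreal) = indicator {z. dist (fst z) (snd z) < r}"
    by (auto simp: indicator_def fun_eq_iff)
  then have 2: "(\<lambda>(x::'a, y). indicator (ball x r) y :: ennreal) \<in> borel_measurable (M \<Otimes>\<^sub>M M)" by simp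
  have "emeasure M (ball x r) = (\<integral>\<^sup>+ y. indicator (ball x r) y \<partial>M)" for x
    by (simp add: metric_measure_space_open[OF M])
  then show ?thesis
    using borel_measurable_nn_integral[OF 1] borel_measurable_nn_integral[OF 2] by simp
qed

text \<open>
  By Tonelli's theorem, the left-hand side is the integral of \<open>F y\<close> times that of \<open>1 / \<mu>(B(x,r))\<close> over
  the \<open>x \<in> B\<close> with \<open>dist x y < r\<close>. For these \<open>x\<close>, \<open>B(y,r) \<subseteq> B(x,2r)\<close>, so that the integrand is at most
  \<open>C / \<mu>(B(y,r))\<close>, and the inner integral is at most \<open>C\<close>.
\<close>
lemma integral_average_le:
  fixes M :: "'a::metric_space measure"
  assumes M: "metric_measure_space M" and [measurable]: "F \<in> borel_measurable M" "B \<in> sets M"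
    and "0 < r" and dbl: "\<And>x. x \<in> B \<Longrightarrow> emeasure M (ball x (2 * r)) \<le> ennreal C * emeasure M (ball x r)"
  shows "(\<integral>\<^sup>+ x\<in>B. (\<integral>\<^sup>+ y\<in>ball x r. F y \<partial>M) / emeasure M (ball x r) \<partial>M) \<le> ennreal C * (\<integral>\<^sup>+ y. F y \<partial>M)"
proof -
  interpret sigma_finite_measure M using M by (rule sigma_finite_metric_measure_space)
  interpret pair_sigma_finite M M ..
  note [measurable] = metric_measure_space_open[OF M open_ball]
  define P where "P = {z :: 'a \<times> 'a. dist (fst z) (snd z) < r}"
  have P[measurable]: "P \<in> sets (M \<Otimes>\<^sub>M M)"
    unfolding P_def by (rule dist_less_measurable_pair[OF M])
  have ind: "indicator (ball x r) y = (indicator P (x, y) :: ennreal)" for x y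
    by (auto simp: indicator_def P_def)
  let ?m = "\<lambda>x. emeasure M (ball x r)"
  have m[measurable]: "?m \<in> borel_measurable M"
  proof -
    have "?m x = (\<integral>\<^sup>+ y. indicator P (x, y) \<partial>M)" for x
      unfolding ind[symmetric] by simp
    then show ?thesis by simp
  qed
  have q: "(\<lambda>x. indicator B x / ?m x) \<in> borel_measurable M"
    by (intro borel_measurable_divide_ennreal m) simp
  have mpos: "?m x \<noteq> 0" "?m x \<noteq> \<infinity>" for x
    using metric_measure_spaceD(4)[OF M \<open>0 < r\<close>, of x] metric_measure_spaceD(5)[OF M, of x r] by auto
  have "(\<integral>\<^sup>+ x\<in>B. (\<integral>\<^sup>+ y\<in>ball x r. F y \<partial>M) / ?m x \<partial>M)
      = (\<integral>\<^sup>+ x. (\<integral>\<^sup>+ y. F y * indicator P (x, y) * (indicator B x / ?m x) \<partial>M) \<partial>M)"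
    unfolding ind[symmetric]
    by (intro nn_integral_cong) (subst nn_integral_multc, auto simp: ennreal_times_divide divide_ennreal_def ac_simps)
  also have "\<dots> = (\<integral>\<^sup>+ y. (\<integral>\<^sup>+ x. F y * indicator P (x, y) * (indicator B x / ?m x) \<partial>M) \<partial>M)"
    by (rule Fubini'[symmetric]) measurable
  also have "\<dots> \<le> (\<integral>\<^sup>+ y. ennreal C * F y \<partial>M)"
  proof (rule nn_integral_mono)
    fix y
    have le: "indicator P (x, y) * (indicator B x / ?m x)
        \<le> ennreal C / ?m y * indicator (ball y r) x" for x
    proof (cases "x \<in> B \<and> dist x y < r")
      case True
      have "ball y r \<subseteq> ball x (2 * r)"
      proof
        fix z assume "z \<in> ball y r"
        then show "z \<in> ball x (2 * r)" using True dist_triangle[of x z y] by (simp add: dist_commute)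
      qed
      then have "?m y \<le> emeasure M (ball x (2 * r))" by (intro emeasure_mono) auto
      also have "\<dots> \<le> ennreal C * ?m x" using True by (intro dbl) simp
      finally have "?m y / ?m y \<le> ennreal C * ?m x / ?m y" by (rule divide_right_mono_ennreal)
      moreover have "?m y / ?m y = 1" using mpos[of y] by (intro ennreal_divide_self) (auto simp: less_top)
      moreover have "ennreal C * ?m x / ?m y = ?m x * (ennreal C / ?m y)"
        by (simp add: ennreal_times_divide mult.commute)
      ultimately have "1 \<le> ?m x * (ennreal C / ?m y)" by simp
      then have "1 / ?m x \<le> ?m x * (ennreal C / ?m y) / ?m x" by (rule divide_right_mono_ennreal)
      also have "\<dots> = ennreal C / ?m y"
        using mpos[of x] ennreal_mult_divide_eq[of "?m x" "ennreal C / ?m y"] by (simp add: mult.commute)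
      finally show ?thesis using True by (simp add: indicator_def dist_commute)
    qed (auto simp: indicator_def P_def)
    have "(\<integral>\<^sup>+ x. F y * indicator P (x, y) * (indicator B x / ?m x) \<partial>M)
       = F y * (\<integral>\<^sup>+ x. indicator P (x, y) * (indicator B x / ?m x) \<partial>M)"
      unfolding mult.assoc
    proof (rule nn_integral_cmult, rule borel_measurable_times_ennreal[OF _ q])
      have "(\<lambda>x. (x, y)) \<in> measurable M (M \<Otimes>\<^sub>M M)"
        by (rule measurable_Pair2') (simp add: metric_measure_spaceD(1)[OF M])
      then show "(\<lambda>x. indicator P (x, y)) \<in> borel_measurable M"
        by (rule measurable_compose) simp
    qed
    also have "\<dots> \<le> F y * (\<integral>\<^sup>+ x. ennreal C / ?m y * indicator (ball y r) x \<partial>M)"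
      using le by (intro mult_left_mono nn_integral_mono) auto
    also have "(\<integral>\<^sup>+ x. ennreal C / ?m y * indicator (ball y r) x \<partial>M) = ennreal C / ?m y * ?m y"
      by (rule nn_integral_cmult_indicator) simp
    also have "\<dots> = ennreal C" using mpos[of y] by (simp add: ennreal_divide_times less_top)
    finally show "(\<integral>\<^sup>+ x. F y * indicator P (x, y) * (indicator B x / ?m x) \<partial>M) \<le> ennreal C * F y"
      by (simp add: mult.commute)
  qed
  also have "\<dots> = ennreal C * (\<integral>\<^sup>+ y. F y \<partial>M)" by (rule nn_integral_cmult) simp
  finally show ?thesis .
qed

section \<open>The weighted chain distance\<close>

text \<open>
  The bound \<open>N\<close> makes the function finite where no chain leads, and integrable on balls.
\<close>
definition chain_dist :: "'a::metric_space set \<Rightarrow> real \<Rightarrow> ('a \<Rightarrow> real) \<Rightarrow> real \<Rightarrow> 'a \<Rightarrow> 'a \<Rightarrow> real" where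
  "chain_dist Z \<delta> w N x y = Inf (insert N {c. chain Z \<delta> w x y c})"

lemma chain_dist_basics:
  assumes w: "\<And>z. 1 \<le> w z" and "0 \<le> N"
  shows "0 \<le> chain_dist Z \<delta> w N x y" "chain_dist Z \<delta> w N x y \<le> N"
    and "chain Z \<delta> w x y c \<Longrightarrow> chain_dist Z \<delta> w N x y \<le> c"
    and "chain_dist Z \<delta> w N x y < A \<Longrightarrow> A \<le> N \<Longrightarrow> \<exists>c<A. chain Z \<delta> w x y c"
proof -
  have bdd: "bdd_below (insert N {c. chain Z \<delta> w x y c})"
    by (rule bdd_belowI[of _ 0]) (use chain_cost_nonneg w \<open>0 \<le> N\<close> in blast)
  show "0 \<le> chain_dist Z \<delta> w N x y"
    unfolding chain_dist_def by (rule cInf_greatest) (use chain_cost_nonneg w \<open>0 \<le> N\<close> in blast)+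
  show "chain_dist Z \<delta> w N x y \<le> N"
    unfolding chain_dist_def using bdd by (intro cInf_lower) auto
  show "chain_dist Z \<delta> w N x y \<le> c" if "chain Z \<delta> w x y c"
    unfolding chain_dist_def using bdd that by (intro cInf_lower) auto
  show "\<exists>c<A. chain Z \<delta> w x y c" if lt: "chain_dist Z \<delta> w N x y < A" and le: "A \<le> N"
  proof -
    obtain c where "c \<in> insert N {c. chain Z \<delta> w x y c}" "c < A"
      using cInf_lessD[OF _ lt[unfolded chain_dist_def]] by blast
    with le show ?thesis by auto
  qed
qed

lemma chain_dist_self:
  assumes "\<And>z. 1 \<le> w z" "0 \<le> N" "x \<in> Z"
  shows "chain_dist Z \<delta> w N x x = 0"
  using chain_dist_basics(1)[of w N, OF assms(1,2)] chain_dist_basics(3)[of w N, OF assms(1,2) chain.start[OF assms(3)]]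
  by (rule antisym[rotated])

lemma chain_dist_step:
  assumes w: "\<And>z. 1 \<le> w z" and N: "0 \<le> N" and ab: "a \<in> Z" "b \<in> Z" "dist a b < \<delta>"
  shows "chain_dist Z \<delta> w N x b \<le> chain_dist Z \<delta> w N x a + w a * dist a b"
proof (rule field_le_epsilon)
  fix e :: real assume "0 < e"
  have nn: "0 \<le> w a * dist a b" using w[of a] by (intro mult_nonneg_nonneg) auto
  show "chain_dist Z \<delta> w N x b \<le> chain_dist Z \<delta> w N x a + w a * dist a b + e"
  proof (cases "chain_dist Z \<delta> w N x a + e \<le> N")
    case True
    obtain c where c: "c < chain_dist Z \<delta> w N x a + e" "chain Z \<delta> w x a c"
      using chain_dist_basics(4)[of w N Z \<delta> x a, OF w N _ True] \<open>0 < e\<close> by auto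
    have "chain_dist Z \<delta> w N x b \<le> c + w a * dist a b"
      by (intro chain_dist_basics(3)[of w N, OF w N] chain.extend c ab)
    with c show ?thesis by linarith
  next
    case False
    with chain_dist_basics(2)[of w N Z \<delta> x b, OF w N] nn show ?thesis by linarith
  qed
qed

lemma chain_dist_local:
  assumes w: "\<And>z. 1 \<le> w z" and N: "0 \<le> N" and ab: "a \<in> Z" "b \<in> Z" "dist a b < \<delta>"
  shows "\<bar>chain_dist Z \<delta> w N x a - chain_dist Z \<delta> w N x b\<bar> \<le> max (w a) (w b) * dist a b"
proof -
  have "w a * dist a b \<le> max (w a) (w b) * dist a b" "w b * dist a b \<le> max (w a) (w b) * dist a b"
    by (intro mult_right_mono; simp)+
  with chain_dist_step[of w N, OF w N ab, of x] chain_dist_step[of w N, OF w N ab(2,1), of \<delta> x] ab(3) show ?thesis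
    by (simp add: dist_commute abs_le_iff)
qed

lemma continuous_on_chain_dist:
  assumes w: "\<And>z. 1 \<le> w z" and N: "0 \<le> N" and "0 < \<delta>" and "continuous_on Z w" "compact Z"
  shows "continuous_on Z (chain_dist Z \<delta> w N x)"
proof -
  have "bounded (w ` Z)" using assms by (intro compact_imp_bounded compact_continuous_image)
  then obtain K where K: "\<And>z. z \<in> Z \<Longrightarrow> \<bar>w z\<bar> \<le> K"
    unfolding bounded_iff by auto
  show ?thesis
  proof (rule continuous_onI)
    fix a e assume a: "a \<in> Z" "0 < (e::real)"
    have "1 \<le> K" using K[OF a(1)] w[of a] by linarith
    show "\<exists>d>0. \<forall>b\<in>Z. dist b a < d \<longrightarrow> dist (chain_dist Z \<delta> w N x b) (chain_dist Z \<delta> w N x a) \<le> e"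
    proof (intro exI[of _ "min \<delta> (e / K)"] conjI ballI impI)
      fix b assume b: "b \<in> Z" "dist b a < min \<delta> (e / K)"
      have "\<bar>chain_dist Z \<delta> w N x b - chain_dist Z \<delta> w N x a\<bar> \<le> max (w b) (w a) * dist b a"
        using a b by (intro chain_dist_local[of w N, OF w N]) auto
      also have "\<dots> \<le> K * (e / K)"
        using K[OF a(1)] K[OF b(1)] b \<open>1 \<le> K\<close> by (intro mult_mono) auto
      finally show "dist (chain_dist Z \<delta> w N x b) (chain_dist Z \<delta> w N x a) \<le> e"
        using \<open>1 \<le> K\<close> by (simp add: dist_real_def)
    qed (use \<open>0 < \<delta>\<close> \<open>1 \<le> K\<close> a in auto)
  qed
qed

lemma chain_endpoint: "chain Z \<delta> w x y c \<Longrightarrow> y \<in> Z"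
  by (induction rule: chain.induct) auto

text \<open>
  Outside \<open>Z\<close> the function is constant, as chains stay in \<open>Z\<close>.
\<close>
lemma borel_measurable_chain_dist:
  assumes w: "\<And>z. 1 \<le> w z" and N: "0 \<le> N" and "0 < \<delta>" and "continuous_on Z w" "compact Z"
  shows "chain_dist Z \<delta> w N x \<in> borel_measurable borel"
proof -
  have "chain_dist Z \<delta> w N x y = N" if "y \<notin> Z" for y
  proof -
    have "{c. chain Z \<delta> w x y c} = {}" using that chain_endpoint by blast
    then show ?thesis by (simp add: chain_dist_def)
  qed
  then have "chain_dist Z \<delta> w N x = (\<lambda>y. if y \<in> Z then chain_dist Z \<delta> w N x y else N)" by auto
  moreover have "(\<lambda>y. if y \<in> Z then chain_dist Z \<delta> w N x y else N) \<in> borel_measurable borel"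
    using assms by (intro borel_measurable_continuous_on_if continuous_on_chain_dist) (auto simp: compact_imp_closed)
  ultimately show ?thesis by simp
qed

lemma upper_gradient_on_local:
  fixes v w :: "'a::metric_space \<Rightarrow> real"
  assumes "continuous_on UNIV w" "\<And>z. 0 \<le> w z" "0 < \<delta>"
    and loc: "\<And>a b. a \<in> A \<Longrightarrow> b \<in> A \<Longrightarrow> dist a b < \<delta> \<Longrightarrow> \<bar>v a - v b\<bar> \<le> max (w a) (w b) * dist a b"
  shows "upper_gradient_on A (\<lambda>z. ennreal (w z)) (\<lambda>z. ereal (v z))"
  unfolding upper_gradient_on_def
proof (intro conjI allI impI)
  have "w \<in> borel_measurable borel" using assms(1) by (rule borel_measurable_continuous_onI)
  then show "(\<lambda>z. ennreal (w z)) \<in> borel_measurable (restrict_space borel A)"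
    by (intro measurable_restrict_space1) simp
  fix \<gamma> l assume \<gamma>: "arc_length_curve A \<gamma> l"
  have "continuous_on {0..l} (\<lambda>t. w (\<gamma> t))"
    using \<gamma> by (intro continuous_on_compose2[OF assms(1)]) (auto simp: arc_length_curve_def)
  then have "(\<integral>\<^sup>+ t\<in>{0..l}. ennreal (w (\<gamma> t)) \<partial>lborel) = ennreal (integral {0..l} (\<lambda>t. w (\<gamma> t)))"
    by (rule nn_integral_continuous_Icc) (rule assms(2))
  moreover have "\<bar>v (\<gamma> 0) - v (\<gamma> l)\<bar> \<le> integral {0..l} (\<lambda>t. w (\<gamma> t))"
    using \<gamma> assms continuous_on_subset[OF assms(1)] by (intro dist_le_line_integral) auto
  ultimately show "(if \<bar>ereal (v (\<gamma> 0))\<bar> = \<infinity> \<or> \<bar>ereal (v (\<gamma> l))\<bar> = \<infinity> then \<infinity>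
      else e2ennreal \<bar>ereal (v (\<gamma> 0)) - ereal (v (\<gamma> l))\<bar>)
     \<le> (\<integral>\<^sup>+ t\<in>{0..l}. ennreal (w (\<gamma> t)) \<partial>lborel)"
    by (simp add: ennreal_leI)
qed

section \<open>Telescoping over balls\<close>

lemma mean_on_diff_le:
  fixes v :: "'a::metric_space \<Rightarrow> real"
  assumes M: "metric_measure_space M" and v: "v \<in> borel_measurable borel" "\<And>x. \<bar>v x\<bar> \<le> N"
    and r: "0 < r'" "0 \<le> D" "0 \<le> K"
    and sub: "ball y r' \<subseteq> ball x r"
    and K: "emeasure M (ball x r) \<le> ennreal K * emeasure M (ball y r')"
    and D: "(\<integral>\<^sup>+ z\<in>ball x r. ennreal \<bar>v z - c\<bar> \<partial>M) \<le> ennreal D * emeasure M (ball x r)"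
  shows "\<bar>mean_on M (ball y r') (\<lambda>z. ereal (v z)) - c\<bar> \<le> K * D"
proof -
  let ?B = "ball y r'"
  have B: "?B \<in> sets M" "emeasure M ?B < \<infinity>" "0 < emeasure M ?B"
    using metric_measure_space_open[OF M] metric_measure_spaceD[OF M] r by auto
  then have mB: "emeasure M ?B = ennreal (measure M ?B)" by (simp add: emeasure_eq_ennreal_measure)
  then have mpos: "0 < measure M ?B" using B by simp
  have vM: "v \<in> borel_measurable M" using M v(1) by (rule metric_measure_space_measurable)
  have int: "set_integrable M ?B v" "set_integrable M ?B (\<lambda>_. c)"
    unfolding set_integrable_def
    by (rule integrableI_bounded_set_indicator[where B = N, OF B(1) vM B(2)], simp add: v(2))
      (rule integrableI_bounded_set_indicator[where B = "\<bar>c\<bar>", OF B(1) _ B(2)], simp_all)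
  have eq: "(LINT z:?B|M. v z - c) = (mean_on M ?B (\<lambda>z. ereal (v z)) - c) * measure M ?B"
    using B mpos int by (simp add: set_integral_const mean_on_def field_simps)
  have "ennreal (\<bar>mean_on M ?B (\<lambda>z. ereal (v z)) - c\<bar> * measure M ?B) = ennreal \<bar>LINT z:?B|M. v z - c\<bar>"
    unfolding eq by (simp add: abs_mult)
  also have "\<dots> \<le> (\<integral>\<^sup>+ z. ennreal (norm (indicator ?B z *\<^sub>R (v z - c))) \<partial>M)"
    unfolding set_lebesgue_integral_def real_norm_def[symmetric]
    using set_integral_diff(1)[OF int]
    by (intro integral_norm_bound_ennreal) (simp add: set_integrable_def)
  also have "\<dots> \<le> (\<integral>\<^sup>+ z\<in>ball x r. ennreal \<bar>v z - c\<bar> \<partial>M)"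
    using sub by (intro nn_integral_mono) (auto simp: indicator_def)
  also have "\<dots> \<le> ennreal D * emeasure M (ball x r)" by (rule D)
  also have "\<dots> \<le> ennreal D * (ennreal K * emeasure M ?B)" using K by (intro mult_left_mono) auto
  also have "\<dots> = ennreal (K * D * measure M ?B)"
  proof -
    have "ennreal (K * D * measure M ?B) = ennreal K * ennreal D * ennreal (measure M ?B)"
      using r by (simp only: ennreal_mult mult_nonneg_nonneg measure_nonneg)
    then show ?thesis unfolding mB by (simp only: ac_simps)
  qed
  finally have "\<bar>mean_on M ?B (\<lambda>z. ereal (v z)) - c\<bar> * measure M ?B \<le> K * D * measure M ?B"
    using r by (simp add: ennreal_le_iff)
  then show ?thesis using mpos by simp
qed

lemma geometric_tail_bound:
  fixes a :: "nat \<Rightarrow> real"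
  assumes lim: "a \<longlonglongrightarrow> l" and "0 \<le> D" and step: "\<And>j. \<bar>a (Suc j) - a j\<bar> \<le> D * (2 / 3) ^ j"
  shows "\<bar>l - a i\<bar> \<le> 3 * D * (2 / 3) ^ i"
proof -
  have "\<bar>a (i + k) - a i\<bar> \<le> 3 * D * (2 / 3) ^ i - 3 * D * (2 / 3) ^ (i + k)" for k
  proof (induction k)
    case (Suc k)
    have "\<bar>a (i + Suc k) - a i\<bar> \<le> \<bar>a (Suc (i + k)) - a (i + k)\<bar> + \<bar>a (i + k) - a i\<bar>" by simp
    also have "\<dots> \<le> D * (2 / 3) ^ (i + k) + (3 * D * (2 / 3) ^ i - 3 * D * (2 / 3) ^ (i + k))"
      using step Suc by (intro add_mono)
    finally show ?case by (simp add: algebra_simps)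
  qed simp
  then have "\<bar>a (i + k) - a i\<bar> \<le> 3 * D * (2 / 3) ^ i" for k
    by (rule order_trans) (use \<open>0 \<le> D\<close> in simp)
  moreover have lim': "(\<lambda>k. \<bar>a (i + k) - a i\<bar>) \<longlonglongrightarrow> \<bar>l - a i\<bar>"
    by (intro tendsto_intros LIMSEQ_ignore_initial_segment[of a l i, unfolded add.commute[of _ i]] lim)
  ultimately show ?thesis using LIMSEQ_le_const2[OF lim'] by blast
qed

lemma mean_on_ball_tendsto:
  fixes v :: "'a::metric_space \<Rightarrow> real"
  assumes M: "metric_measure_space M" and v: "v \<in> borel_measurable borel" "\<And>x. \<bar>v x\<bar> \<le> N" "isCont v z"
    and r: "\<And>j. 0 < r j" "r \<longlonglongrightarrow> 0"
  shows "(\<lambda>j. mean_on M (ball z (r j)) (\<lambda>y. ereal (v y))) \<longlonglongrightarrow> v z"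
proof (rule LIMSEQ_I)
  fix e :: real assume "0 < e"
  then have "0 < e / 2" by simp
  then obtain d where d: "0 < d" "\<And>y. dist y z < d \<Longrightarrow> dist (v y) (v z) < e / 2"
    using v(3) unfolding continuous_at_eps_delta by blast
  obtain j0 where j0: "\<And>j. j0 \<le> j \<Longrightarrow> r j < d"
    using order_tendstoD(2)[OF r(2) d(1)] by (auto simp: eventually_sequentially)
  show "\<exists>no. \<forall>j\<ge>no. norm (mean_on M (ball z (r j)) (\<lambda>y. ereal (v y)) - v z) < e"
  proof (intro exI allI impI)
    fix j assume "j0 \<le> j"
    have "\<bar>mean_on M (ball z (r j)) (\<lambda>y. ereal (v y)) - v z\<bar> \<le> 1 * (e / 2)"
    proof (rule mean_on_diff_le[OF M v(1,2) r(1), where r = "r j"])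
      have "(\<integral>\<^sup>+ y\<in>ball z (r j). ennreal \<bar>v y - v z\<bar> \<partial>M) \<le> (\<integral>\<^sup>+ y. ennreal (e / 2) * indicator (ball z (r j)) y \<partial>M)"
      proof (rule nn_integral_mono)
        fix y show "ennreal \<bar>v y - v z\<bar> * indicator (ball z (r j)) y \<le> ennreal (e / 2) * indicator (ball z (r j)) y"
          using d(2)[of y] j0[OF \<open>j0 \<le> j\<close>]
          by (auto simp: indicator_def dist_real_def dist_commute intro!: ennreal_leI)
      qed
      also have "\<dots> = ennreal (e / 2) * emeasure M (ball z (r j))"
        by (rule nn_integral_cmult_indicator) (simp add: metric_measure_space_open[OF M])
      finally show "(\<integral>\<^sup>+ y\<in>ball z (r j). ennreal \<bar>v y - v z\<bar> \<partial>M) \<le> ennreal (e / 2) * emeasure M (ball z (r j))" .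
    qed (use \<open>0 < e\<close> in simp_all)
    then show "norm (mean_on M (ball z (r j)) (\<lambda>y. ereal (v y)) - v z) < e" using \<open>0 < e\<close> by simp
  qed
qed

text \<open>
  The hypothesis on the mean oscillation bounds the difference of the mean values over consecutive balls
  by a geometric sequence with ratio \<open>2 / 3\<close>, and the mean values converge to the value at the centre. The
  two sequences of balls are linked by \<open>B(y, \<rho> / 2 ^ (i + 1)) \<subseteq> B(x, \<rho> / 2 ^ i)\<close>, whose measures are
  comparable by doubling twice.
\<close>
lemma telescoping_estimate:
  fixes v :: "'a::metric_space \<Rightarrow> real" and \<rho> :: real
  assumes M: "metric_measure_space M" and v: "v \<in> borel_measurable borel" "\<And>x. \<bar>v x\<bar> \<le> N" "isCont v x" "isCont v y"
    and "0 < \<rho>" "1 \<le> CD" "0 \<le> E x" "0 \<le> E y"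
    and dbl: "\<And>z r. z \<in> {x, y} \<Longrightarrow> 0 < r \<Longrightarrow> r \<le> \<rho> \<Longrightarrow>
       emeasure M (ball z (2 * r)) \<le> ennreal CD * emeasure M (ball z r)"
    and osc: "\<And>z j. z \<in> {x, y} \<Longrightarrow>
       (\<integral>\<^sup>+ t\<in>ball z (\<rho> / 2 ^ j). ennreal \<bar>v t - mean_on M (ball z (\<rho> / 2 ^ j)) (\<lambda>s. ereal (v s))\<bar> \<partial>M)
         \<le> ennreal (E z * (2 / 3) ^ j) * emeasure M (ball z (\<rho> / 2 ^ j))"
    and close: "dist x y < \<rho> / 2 ^ Suc i"
  shows "\<bar>v x - v y\<bar> \<le> (4 * CD ^ 2) * (2 / 3) ^ i * (E x + E y)"
proof -
  define r where "r j = \<rho> / 2 ^ j" for j :: nat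
  define m where "m z j = mean_on M (ball z (r j)) (\<lambda>s. ereal (v s))" for z j
  have r: "0 < r j" "r j \<le> \<rho>" "r j = 2 * r (Suc j)" for j
    using \<open>0 < \<rho>\<close> by (auto simp: r_def field_simps)
  have rlim: "r \<longlonglongrightarrow> 0"
  proof -
    have "(\<lambda>j. \<rho> * (1 / 2) ^ j) \<longlonglongrightarrow> \<rho> * 0" by (intro tendsto_intros LIMSEQ_power_zero) simp
    moreover have "r = (\<lambda>j. \<rho> * (1 / 2) ^ j)" by (auto simp: r_def power_one_over)
    ultimately show ?thesis by simp
  qed
  have osc': "(\<integral>\<^sup>+ t\<in>ball z (r j). ennreal \<bar>v t - m z j\<bar> \<partial>M) \<le> ennreal (E z * (2 / 3) ^ j) * emeasure M (ball z (r j))"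
    if "z \<in> {x, y}" for z j
    using osc[OF that, of j] by (simp add: r_def m_def)
  have tail: "\<bar>v z - m z j\<bar> \<le> 3 * (CD * E z) * (2 / 3) ^ j" if z: "z \<in> {x, y}" for z j
  proof (rule geometric_tail_bound[where a = "m z" and l = "v z"])
    show "m z \<longlonglongrightarrow> v z"
      unfolding m_def[abs_def] using z v rlim r(1) by (intro mean_on_ball_tendsto[OF M v(1,2)]) auto
    show "0 \<le> CD * E z" using z assms by auto
    fix j
    have Ez: "0 \<le> E z" using z assms(8,9) by auto
    have sub: "ball z (r (Suc j)) \<subseteq> ball z (r j)"
      by (rule subset_ball) (use r(1)[of "Suc j"] r(3)[of j] in linarith)
    have "emeasure M (ball z (2 * r (Suc j))) \<le> ennreal CD * emeasure M (ball z (r (Suc j)))"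
      by (rule dbl[OF z r(1,2)])
    then have "emeasure M (ball z (r j)) \<le> ennreal CD * emeasure M (ball z (r (Suc j)))"
      by (simp only: r(3)[of j])
    from mean_on_diff_le[OF M v(1,2) r(1) _ _ sub this osc'[OF z]]
    have "\<bar>m z (Suc j) - m z j\<bar> \<le> CD * (E z * (2 / 3) ^ j)"
      using Ez \<open>1 \<le> CD\<close> by (simp add: m_def)
    then show "\<bar>m z (Suc j) - m z j\<bar> \<le> CD * E z * (2 / 3) ^ j" by (simp add: mult.assoc)
  qed
  \<comment> \<open>The balls about \<open>y\<close> are one step smaller, so as to be contained in those about \<open>x\<close>.\<close>
  have cross: "\<bar>m y (Suc i) - m x i\<bar> \<le> CD ^ 2 * (E x * (2 / 3) ^ i)"
  proof -
    have sub: "ball y (r (Suc i)) \<subseteq> ball x (r i)"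
    proof
      fix z assume "z \<in> ball y (r (Suc i))"
      then show "z \<in> ball x (r i)"
        using close r(3)[of i] dist_triangle[of x z y] by (simp add: r_def)
    qed
    have "ball x (r i) \<subseteq> ball y (2 * r i)"
    proof
      fix z assume "z \<in> ball x (r i)"
      then show "z \<in> ball y (2 * r i)"
        using close r(3)[of i] r(1)[of "Suc i"] dist_triangle[of y z x] by (simp add: r_def dist_commute)
    qed
    then have "emeasure M (ball x (r i)) \<le> emeasure M (ball y (2 * r i))"
      by (intro emeasure_mono) (simp_all add: metric_measure_space_open[OF M])
    also have "\<dots> \<le> ennreal CD * emeasure M (ball y (r i))" by (rule dbl[OF _ r(1,2)]) simp
    also have "\<dots> \<le> ennreal CD * (ennreal CD * emeasure M (ball y (r (Suc i))))"
    proof (rule mult_left_mono)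
      have "emeasure M (ball y (2 * r (Suc i))) \<le> ennreal CD * emeasure M (ball y (r (Suc i)))"
        by (rule dbl[OF _ r(1,2)]) simp
      then show "emeasure M (ball y (r i)) \<le> ennreal CD * emeasure M (ball y (r (Suc i)))"
        by (simp only: r(3)[of i])
    qed simp
    also have "\<dots> = ennreal (CD ^ 2) * emeasure M (ball y (r (Suc i)))"
    proof -
      have "ennreal (CD ^ 2) = ennreal CD * ennreal CD"
        unfolding power2_eq_square using \<open>1 \<le> CD\<close> by (intro ennreal_mult) auto
      then show ?thesis by (simp only: mult.assoc)
    qed
    finally have "emeasure M (ball x (r i)) \<le> ennreal (CD ^ 2) * emeasure M (ball y (r (Suc i)))" .
    from mean_on_diff_le[OF M v(1,2) r(1) _ _ sub this osc'[of x i]] show ?thesis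
      using \<open>0 \<le> E x\<close> by (simp add: m_def)
  qed
  have CD: "CD \<le> CD ^ 2" using assms(7) by (simp add: power2_eq_square)
  have 1: "\<bar>v x - m x i\<bar> \<le> 3 * CD ^ 2 * E x * (2 / 3) ^ i"
    using tail[of x i] CD assms mult_right_mono[OF mult_right_mono[OF CD, of "E x"], of "3 * (2 / 3) ^ i"]
    by (simp add: ac_simps)
  have 2: "\<bar>v y - m y (Suc i)\<bar> \<le> 3 * CD ^ 2 * E y * (2 / 3) ^ i"
  proof -
    have "\<bar>v y - m y (Suc i)\<bar> \<le> 3 * (CD * E y) * (2 / 3) ^ Suc i" by (rule tail) simp
    also have "\<dots> \<le> 3 * (CD * E y) * (2 / 3) ^ i"
      using assms by (intro mult_left_mono power_decreasing) auto
    also have "\<dots> \<le> 3 * (CD ^ 2 * E y) * (2 / 3) ^ i"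
      using CD assms by (intro mult_right_mono mult_left_mono) auto
    finally show ?thesis by (simp add: ac_simps)
  qed
  have "\<bar>v x - v y\<bar> \<le> \<bar>v x - m x i\<bar> + \<bar>m y (Suc i) - m x i\<bar> + \<bar>v y - m y (Suc i)\<bar>" by linarith
  also have "\<dots> \<le> 3 * CD ^ 2 * E x * (2 / 3) ^ i + CD ^ 2 * (E x * (2 / 3) ^ i) + 3 * CD ^ 2 * E y * (2 / 3) ^ i"
    using 1 2 cross by (intro add_mono)
  also have "\<dots> \<le> (4 * CD ^ 2) * (2 / 3) ^ i * (E x + E y)"
    using assms by (simp add: algebra_simps)
  finally show ?thesis .
qed

section \<open>Curves with small line integrals\<close>

lemma ennreal_powr_ennreal: "0 \<le> x \<Longrightarrow> ennreal_powr (ennreal x) q = ennreal (x powr q)"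
  by (simp add: ennreal_powr_def)

lemma ennreal_powr_mono: "a \<le> b \<Longrightarrow> 0 \<le> q \<Longrightarrow> ennreal_powr a q \<le> ennreal_powr b q"
  by (cases a; cases b) (auto simp: ennreal_powr_def top_unique intro!: ennreal_leI powr_mono2)

lemma borel_measurable_ennreal_powr:
  assumes [measurable]: "f \<in> borel_measurable N"
  shows "(\<lambda>x. ennreal_powr (f x) q) \<in> borel_measurable N"
  unfolding ennreal_powr_def by measurable

text \<open>
  Taking \<open>p\<close>-th roots in \<open>[0,\<infinity>]\<close>; the maximum keeps the weights bounded below by \<open>1\<close>.
\<close>
lemma le_SUP_powr_root:
  assumes p: "1 \<le> p" and le: "ennreal_powr G p \<le> (SUP n::nat. ennreal (c n))" and c: "\<And>n. 0 \<le> c n"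
  shows "G \<le> (SUP n. ennreal (max 1 (c n powr (1 / p))))"
proof (rule dense_le)
  fix t assume "t < G"
  then obtain r where r: "0 \<le> r" "t = ennreal r" by (cases t) auto
  have "ennreal (r powr p) < ennreal_powr G p"
  proof (cases G)
    case (real G')
    then have "r < G'" using \<open>t < G\<close> r by (simp add: ennreal_less_iff)
    then have "r powr p < G' powr p" using p r by (intro powr_less_mono2) auto
    then show ?thesis using real by (simp add: ennreal_powr_ennreal ennreal_less_iff)
  qed (simp add: ennreal_powr_def)
  also note le
  finally obtain n where "ennreal (r powr p) < ennreal (c n)" by (auto simp: less_SUP_iff)
  then have "r powr p < c n" by (simp add: ennreal_less_iff)
  then have "(r powr p) powr (1 / p) \<le> c n powr (1 / p)" using p by (intro powr_mono2) auto
  then have "r \<le> max 1 (c n powr (1 / p))" using p r by (simp add: powr_powr)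
  then show "t \<le> (SUP n. ennreal (max 1 (c n powr (1 / p))))"
    unfolding r(2) by (intro SUP_upper2[of n]) (auto intro: ennreal_leI)
qed

text \<open>
  The Poincare inequality for bounded Borel functions, with the mean value of the upper gradient
  replaced by a real bound: the form in which \<open>telescoping_estimate\<close> uses it.
\<close>
lemma poincare_osc:
  fixes v w :: "'a::metric_space \<Rightarrow> real"
  assumes M: "metric_measure_space M" and v: "v \<in> borel_measurable borel" "\<And>x. \<bar>v x\<bar> \<le> N"
    and ug: "upper_gradient_on (ball z (L * r)) (\<lambda>x. ennreal (w x)) (\<lambda>x. ereal (v x))"
    and "0 < r" "0 \<le> a"
    and poincare: "\<And>u g. Lp_on M 1 (ball z (L * r)) u \<Longrightarrow> upper_gradient_on (ball z (L * r)) g u \<Longrightarrow>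
         (\<integral>\<^sup>+ y\<in>ball z r. e2ennreal \<bar>u y - ereal (mean_on M (ball z r) u)\<bar> \<partial>M) / emeasure M (ball z r)
       \<le> ennreal (C * r) * ennreal_powr ((\<integral>\<^sup>+ y\<in>ball z (L * r). ennreal_powr (g y) p \<partial>M) / emeasure M (ball z (L * r))) (1 / p)"
    and p: "1 \<le> p" and C: "0 \<le> C"
    and le: "(\<integral>\<^sup>+ y\<in>ball z (L * r). ennreal_powr (ennreal (w y)) p \<partial>M) / emeasure M (ball z (L * r)) \<le> ennreal a"
  shows "(\<integral>\<^sup>+ t\<in>ball z r. ennreal \<bar>v t - mean_on M (ball z r) (\<lambda>s. ereal (v s))\<bar> \<partial>M)
     \<le> ennreal (C * r * a powr (1 / p)) * emeasure M (ball z r)"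
proof -
  have vM: "v \<in> borel_measurable M" using M v(1) by (rule metric_measure_space_measurable)
  have "Lp_on M 1 (ball z (L * r)) (\<lambda>x. ereal (v x))"
    unfolding Lp_on_def
  proof
    show "(\<lambda>x. ereal (v x)) \<in> borel_measurable (restrict_space M (ball z (L * r)))"
      using vM by (intro measurable_restrict_space1) simp
    have "(\<integral>\<^sup>+ x\<in>ball z (L * r). ennreal_powr (e2ennreal \<bar>ereal (v x)\<bar>) 1 \<partial>M)
       \<le> (\<integral>\<^sup>+ x. ennreal N * indicator (ball z (L * r)) x \<partial>M)"
      using v(2) by (intro nn_integral_mono mult_right_mono) (auto simp: ennreal_powr_ennreal intro: ennreal_leI)
    also have "\<dots> = ennreal N * emeasure M (ball z (L * r))"
      by (rule nn_integral_cmult_indicator) (simp add: metric_measure_space_open[OF M])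
    also have "\<dots> < \<infinity>" using metric_measure_spaceD(5)[OF M] by (simp add: ennreal_mult_less_top)
    finally show "(\<integral>\<^sup>+ x\<in>ball z (L * r). ennreal_powr (e2ennreal \<bar>ereal (v x)\<bar>) 1 \<partial>M) < \<infinity>" .
  qed
  from poincare[OF this ug]
  have "(\<integral>\<^sup>+ t\<in>ball z r. ennreal \<bar>v t - mean_on M (ball z r) (\<lambda>s. ereal (v s))\<bar> \<partial>M) / emeasure M (ball z r)
     \<le> ennreal (C * r) * ennreal_powr ((\<integral>\<^sup>+ y\<in>ball z (L * r). ennreal_powr (ennreal (w y)) p \<partial>M) / emeasure M (ball z (L * r))) (1 / p)"
    by simp
  also have "\<dots> \<le> ennreal (C * r) * ennreal_powr (ennreal a) (1 / p)"
    using le p by (intro mult_left_mono ennreal_powr_mono) auto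
  also have "\<dots> = ennreal (C * r * a powr (1 / p))"
    using assms by (simp add: ennreal_powr_ennreal ennreal_mult)
  finally have *: "(\<integral>\<^sup>+ t\<in>ball z r. ennreal \<bar>v t - mean_on M (ball z r) (\<lambda>s. ereal (v s))\<bar> \<partial>M) / emeasure M (ball z r)
     \<le> ennreal (C * r * a powr (1 / p))" .
  have m: "emeasure M (ball z r) \<noteq> 0" "emeasure M (ball z r) < top"
    using metric_measure_spaceD(4)[OF M \<open>0 < r\<close>, of z] metric_measure_spaceD(5)[OF M, of z r] by auto
  have "X = X / emeasure M (ball z r) * emeasure M (ball z r)" for X
    using m by (simp add: ennreal_divide_times)
  then show ?thesis using mult_right_mono[OF *, of "emeasure M (ball z r)"] by simp
qed

text \<open>
  \<open>Vitali_Caratheodory\<close> applied to the restriction of \<open>M\<close> to the Borel sets and to the ball.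
\<close>
lemma lsc_majorant_on_ball:
  fixes M :: "'a::metric_space measure"
  assumes M: "metric_measure_space M" and f: "f \<in> borel_measurable borel"
    and fin: "(\<integral>\<^sup>+ x\<in>ball x0 R. f x \<partial>M) < \<infinity>"
  obtains \<phi> where "continuous_incseq \<phi>" "\<And>x. f x \<le> (SUP n. ennreal (\<phi> n x))"
    "(\<integral>\<^sup>+ x\<in>ball x0 R. (SUP n. ennreal (\<phi> n x)) \<partial>M) < \<infinity>"
proof -
  note [measurable] = metric_measure_space_open[OF M open_ball]
  \<comment> \<open>The passage to \<open>borel\<close> is necessary since \<open>M\<close> may have more measurable sets.\<close>
  define D where "D = density M (indicator (ball x0 R))"
  define N where "N = distr D borel (\<lambda>x. x)"
  have id: "(\<lambda>x. x) \<in> measurable D borel"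
    unfolding D_def using metric_measure_space_measurable[OF M measurable_ident] by (simp add: id_def)
  have N: "sets N = sets borel" by (simp add: N_def)
  have int: "integral\<^sup>N N h = (\<integral>\<^sup>+ x\<in>ball x0 R. h x \<partial>M)" if h: "h \<in> borel_measurable borel" for h
  proof -
    have "integral\<^sup>N N h = integral\<^sup>N D h"
      unfolding N_def using id h by (intro nn_integral_distr) simp_all
    also have "\<dots> = (\<integral>\<^sup>+ x. indicator (ball x0 R) x * h x \<partial>M)"
      unfolding D_def using metric_measure_space_measurable[OF M h] by (intro nn_integral_density) auto
    finally show ?thesis by (simp add: mult.commute)
  qed
  have "emeasure N (space N) = integral\<^sup>N N (\<lambda>_. 1)" by simp
  also have "\<dots> = emeasure M (ball x0 R)" by (subst int) auto
  finally have "finite_measure N"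
    using metric_measure_spaceD(5)[OF M, of x0 R] by (intro finite_measureI) auto
  from Vitali_Caratheodory[OF this N f, rule_format, of 1] obtain \<phi> h where
    \<phi>: "continuous_incseq \<phi>" and h: "h \<in> borel_measurable borel"
    and lower: "\<And>x. f x \<le> (SUP n. ennreal (\<phi> n x))"
    and upper: "\<And>x. (SUP n. ennreal (\<phi> n x)) \<le> f x + h x" and hint: "integral\<^sup>N N h \<le> ennreal 1"
    by auto
  have "(\<integral>\<^sup>+ x\<in>ball x0 R. (SUP n. ennreal (\<phi> n x)) \<partial>M)
      \<le> (\<integral>\<^sup>+ x. f x * indicator (ball x0 R) x + h x * indicator (ball x0 R) x \<partial>M)"
    unfolding distrib_right[symmetric] using upper by (intro nn_integral_mono mult_right_mono) auto
  also have "\<dots> = (\<integral>\<^sup>+ x\<in>ball x0 R. f x \<partial>M) + integral\<^sup>N N h"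
    unfolding int[OF h]
    using metric_measure_space_measurable[OF M f] metric_measure_space_measurable[OF M h]
    by (intro nn_integral_add) auto
  also have "\<dots> < \<infinity>" using fin hint by (auto simp: less_top[symmetric] top_unique)
  finally show thesis by (rule that[OF \<phi> lower])
qed

text \<open>
  The radii are chosen so that the balls \<open>B(z, L * \<rho> / 2 ^ j)\<close> about points of the small ball lie in the
  compact set \<open>Z\<close>, to which chains and curves are confined, and \<open>Z\<close> lies in the ball where \<open>g\<^sup>p\<close> is
  integrable. The mean value of \<open>F\<close> over \<open>B(z, L * \<rho> / 2 ^ j)\<close> is at most \<open>(4 / 3) ^ j * S z\<close>, and
  the radius in the Poincare inequality contributes the factor \<open>2 ^ -j\<close>, which explains the ratio
  \<open>2 / 3\<close>.
\<close>
lemma local_curve_estimate: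
  fixes M :: "'a::metric_space measure" and g :: "'a \<Rightarrow> ennreal"
  assumes p: "1 \<le> p" and M: "metric_measure_space M" and "0 < R" and cpt: "compact (cball x0 R)"
    and doubling: "doubling_within M (ball x0 R)" and poincare: "poincare_within M p (ball x0 R)"
    and g: "g \<in> borel_measurable borel" "(\<integral>\<^sup>+ x\<in>ball x0 R. ennreal_powr (g x) p \<partial>M) < \<infinity>"
  obtains \<rho> K S where "0 < \<rho>" "0 \<le> K" "S \<in> borel_measurable M" "(\<integral>\<^sup>+ x\<in>ball x0 (\<rho> / 4). S x \<partial>M) < \<infinity>"
    "\<And>x y i. x \<in> ball x0 (\<rho> / 4) \<Longrightarrow> y \<in> ball x0 (\<rho> / 4) \<Longrightarrow> x \<noteq> y \<Longrightarrow> S x < \<infinity> \<Longrightarrow> S y < \<infinity> \<Longrightarrow>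
       dist x y < \<rho> / 2 ^ Suc i \<Longrightarrow>
       \<exists>\<gamma> l. arc_length_curve UNIV \<gamma> l \<and> \<gamma> 0 = x \<and> \<gamma> l = y \<and>
         (\<integral>\<^sup>+ t\<in>{0..l}. g (\<gamma> t) \<partial>lborel)
           \<le> ennreal (K * (2 / 3) ^ i * (enn2real (S x) powr (1 / p) + enn2real (S y) powr (1 / p)))"
proof -
  note [measurable] = metric_measure_space_open[OF M open_ball]
  obtain CD0 where CD0: "0 < CD0" "\<And>x r. 0 < r \<Longrightarrow> ball x r \<subseteq> ball x0 R \<Longrightarrow>
      emeasure M (ball x (2 * r)) \<le> ennreal CD0 * emeasure M (ball x r)"
    using doubling unfolding doubling_within_def by blast
  define CD where "CD = max 1 CD0"
  have CD: "1 \<le> CD" "\<And>x r. 0 < r \<Longrightarrow> ball x r \<subseteq> ball x0 R \<Longrightarrow>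
      emeasure M (ball x (2 * r)) \<le> ennreal CD * emeasure M (ball x r)"
  proof -
    show "1 \<le> CD" by (simp add: CD_def)
    fix x r assume "0 < r" "ball x r \<subseteq> ball x0 R"
    then have "emeasure M (ball x (2 * r)) \<le> ennreal CD0 * emeasure M (ball x r)" by (rule CD0)
    also have "\<dots> \<le> ennreal CD * emeasure M (ball x r)"
      by (intro mult_right_mono ennreal_leI) (auto simp: CD_def)
    finally show "emeasure M (ball x (2 * r)) \<le> ennreal CD * emeasure M (ball x r)" .
  qed
  obtain CP L where CP: "0 < CP" "1 \<le> L" and PI: "\<And>x r u g. 0 < r \<Longrightarrow> ball x r \<subseteq> ball x0 R \<Longrightarrow>
      Lp_on M 1 (ball x (L * r)) u \<Longrightarrow> upper_gradient_on (ball x (L * r)) g u \<Longrightarrow>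
           (\<integral>\<^sup>+ y\<in>ball x r. e2ennreal \<bar>u y - ereal (mean_on M (ball x r) u)\<bar> \<partial>M)
               / emeasure M (ball x r)
             \<le> ennreal (CP * r) *
               ennreal_powr
                 ((\<integral>\<^sup>+ y\<in>ball x (L * r). ennreal_powr (g y) p \<partial>M) / emeasure M (ball x (L * r)))
                 (1 / p)"
    using poincare unfolding poincare_within_def by blast
  \<comment> \<open>\<open>L * \<rho> = R / 4\<close>, so the dilated balls about points of \<open>B\<close> have distance less than \<open>R / 2\<close> from \<open>x0\<close>.\<close>
  define \<rho> where "\<rho> = R / (4 * L)"
  have \<rho>: "0 < \<rho>" "L * \<rho> = R / 4" "\<rho> \<le> R / 4"
    using \<open>0 < R\<close> CP by (auto simp: \<rho>_def field_simps)
  define B where "B = ball x0 (\<rho> / 4)"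
  define Z where "Z = cball x0 (R / 2)"
  have "compact Z"
  proof -
    have "Z = cball x0 R \<inter> Z" using \<open>0 < R\<close> by (auto simp: Z_def)
    then show ?thesis using cpt by (metis Z_def closed_cball compact_Int_closed)
  qed
  have ballZ: "ball z r \<subseteq> Z" if "z \<in> B" "r \<le> R / 4" for z r
  proof
    fix y assume "y \<in> ball z r"
    then show "y \<in> Z" using that \<rho> \<open>0 < R\<close> dist_triangle[of x0 y z] by (simp add: B_def Z_def)
  qed
  have ZR: "Z \<subseteq> ball x0 R" using \<open>0 < R\<close> by (auto simp: Z_def)
  have BZ: "z \<in> Z" if "z \<in> B" for z using ballZ[OF that, of "R / 4"] \<open>0 < R\<close> by auto

  \<comment> \<open>The weights must be at least \<open>1\<close>, so that chains of bounded cost have bounded length.\<close>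
  define f where "f x = max 1 (ennreal_powr (g x) p)" for x
  have f: "f \<in> borel_measurable borel"
    unfolding f_def using borel_measurable_ennreal_powr[OF g(1)] by simp
  have "(\<integral>\<^sup>+ x\<in>ball x0 R. f x \<partial>M)
     \<le> (\<integral>\<^sup>+ x. indicator (ball x0 R) x + ennreal_powr (g x) p * indicator (ball x0 R) x \<partial>M)"
    by (intro nn_integral_mono) (auto simp: f_def indicator_def max_def)
  also have "\<dots> = emeasure M (ball x0 R) + (\<integral>\<^sup>+ x\<in>ball x0 R. ennreal_powr (g x) p \<partial>M)"
    using metric_measure_space_measurable[OF M borel_measurable_ennreal_powr[OF g(1)]]
    by (subst nn_integral_add) auto
  also have "\<dots> < \<infinity>" using g(2) metric_measure_spaceD(5)[OF M, of x0 R] by simp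
  finally have ffin: "(\<integral>\<^sup>+ x\<in>ball x0 R. f x \<partial>M) < \<infinity>" .
  obtain \<phi> where \<phi>: "continuous_incseq \<phi>" and f_le: "\<And>x. f x \<le> (SUP n. ennreal (\<phi> n x))"
    and \<phi>fin: "(\<integral>\<^sup>+ x\<in>ball x0 R. (SUP n. ennreal (\<phi> n x)) \<partial>M) < \<infinity>"
    using lsc_majorant_on_ball[OF M f ffin] by blast
  have \<phi>D: "continuous_on UNIV (\<phi> n)" "0 \<le> \<phi> n x" "incseq (\<lambda>n. \<phi> n x)" for n x
    using \<phi> by (auto simp: continuous_incseq_def)
  define F where "F x = (SUP n. ennreal (\<phi> n x)) * indicator (ball x0 R) x" for x
  have \<phi>M: "\<phi> n \<in> borel_measurable M" for n
    using \<phi>D(1) by (intro metric_measure_space_measurable[OF M] borel_measurable_continuous_onI)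
  have FM[measurable]: "F \<in> borel_measurable M"
    unfolding F_def using \<phi>M by measurable
  have Ffin: "(\<integral>\<^sup>+ x. F x \<partial>M) < \<infinity>" using \<phi>fin by (simp add: F_def)
  have F_ge: "1 \<le> F x" "ennreal (\<phi> n x) \<le> F x" if "x \<in> ball x0 R" for x n
    using that order_trans[OF _ f_le[of x], of 1] by (auto simp: F_def f_def intro: SUP_upper)

  define w where "w n x = max 1 (\<phi> n x powr (1 / p))" for n x
  have w1: "1 \<le> w n x" for n x by (simp add: w_def)
  have wcont: "continuous_on UNIV (w n)" for n
    unfolding w_def[abs_def] using \<phi>D p by (intro continuous_intros continuous_on_powr') auto
  have winc: "incseq (\<lambda>n. w n x)" for x
    unfolding w_def incseq_def
    using \<phi>D(2) incseqD[OF \<phi>D(3)] p by (intro allI impI max.mono powr_mono2) auto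
  have w_powr: "ennreal_powr (ennreal (w n x)) p \<le> F x" if "x \<in> ball x0 R" for n x
  proof -
    have "w n x powr p = max 1 (\<phi> n x)"
    proof (cases "1 \<le> \<phi> n x powr (1 / p)")
      case True
      then have "1 powr p \<le> (\<phi> n x powr (1 / p)) powr p" using p by (intro powr_mono2) auto
      then show ?thesis using True p \<phi>D(2)[of n x] by (simp add: w_def powr_powr max_def)
    next
      case False
      then have "(\<phi> n x powr (1 / p)) powr p \<le> 1 powr p" using p by (intro powr_mono2) auto
      then have "\<phi> n x \<le> 1" using p \<phi>D(2)[of n x] by (simp add: powr_powr)
      then show ?thesis using False by (simp add: w_def max_def)
    qed
    moreover have "0 \<le> w n x" using w1[of n x] by linarith
    ultimately have "ennreal_powr (ennreal (w n x)) p = max 1 (ennreal (\<phi> n x))"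
      by (auto simp: ennreal_powr_ennreal max_def)
    then show ?thesis using F_ge[OF that] by simp
  qed
  have g_le: "g x \<le> (SUP n. ennreal (w n x))" for x
    unfolding w_def
    using f_le[of x] \<phi>D(2) by (intro le_SUP_powr_root[OF p]) (auto simp: f_def)

  define A where "A j x = (\<integral>\<^sup>+ y\<in>ball x (L * (\<rho> / 2 ^ j)). F y \<partial>M) / emeasure M (ball x (L * (\<rho> / 2 ^ j)))" for j :: nat and x
  have rj: "0 < \<rho> / 2 ^ j" "\<rho> / 2 ^ j \<le> \<rho>" "0 < L * (\<rho> / 2 ^ j)" "L * (\<rho> / 2 ^ j) \<le> R / 4" for j :: nat
  proof -
    show 1: "0 < \<rho> / 2 ^ j" "\<rho> / 2 ^ j \<le> \<rho>" using \<rho>(1) by (auto simp: field_simps)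
    show "0 < L * (\<rho> / 2 ^ j)" using 1 CP by simp
    have "L * (\<rho> / 2 ^ j) \<le> L * \<rho>" using 1 CP by (intro mult_left_mono) auto
    then show "L * (\<rho> / 2 ^ j) \<le> R / 4" using \<rho>(2) by simp
  qed
  have AM[measurable]: "A j \<in> borel_measurable M" for j
    unfolding A_def[abs_def] by (rule average_measurable[OF M FM])
  define S where "S x = (\<Sum>j. ennreal ((3 / 4) ^ j) * A j x)" for x
  have SM: "S \<in> borel_measurable M" unfolding S_def[abs_def] by measurable
  have Bs[measurable]: "B \<in> sets M" by (simp add: B_def)
  have "(\<integral>\<^sup>+ x\<in>B. S x \<partial>M) = (\<Sum>j. ennreal ((3 / 4) ^ j) * (\<integral>\<^sup>+ x\<in>B. A j x \<partial>M))"
  proof -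
    have "(\<integral>\<^sup>+ x\<in>B. S x \<partial>M) = (\<integral>\<^sup>+ x. (\<Sum>j. ennreal ((3 / 4) ^ j) * (A j x * indicator B x)) \<partial>M)"
      by (simp add: S_def mult.assoc[symmetric])
    also have "\<dots> = (\<Sum>j. \<integral>\<^sup>+ x. ennreal ((3 / 4) ^ j) * (A j x * indicator B x) \<partial>M)"
      by (rule nn_integral_suminf) measurable
    also have "\<dots> = (\<Sum>j. ennreal ((3 / 4) ^ j) * (\<integral>\<^sup>+ x\<in>B. A j x \<partial>M))"
      by (intro suminf_cong nn_integral_cmult) measurable
    finally show ?thesis .
  qed
  also have "\<dots> \<le> (\<Sum>j. ennreal ((3 / 4) ^ j) * (ennreal CD * (\<integral>\<^sup>+ x. F x \<partial>M)))"
  proof (intro suminf_le mult_left_mono summableI)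
    fix j
    show "(\<integral>\<^sup>+ x\<in>B. A j x \<partial>M) \<le> ennreal CD * (\<integral>\<^sup>+ x. F x \<partial>M)"
      unfolding A_def
    proof (rule integral_average_le[OF M FM Bs rj(3)])
      fix x assume "x \<in> B"
      then have "ball x (L * (\<rho> / 2 ^ j)) \<subseteq> ball x0 R" using ballZ[OF _ rj(4)] ZR by blast
      then show "emeasure M (ball x (2 * (L * (\<rho> / 2 ^ j)))) \<le> ennreal CD * emeasure M (ball x (L * (\<rho> / 2 ^ j)))"
        by (rule CD(2)[OF rj(3)])
    qed
  qed simp
  also have "\<dots> = (\<Sum>j. ennreal ((3 / 4) ^ j)) * (ennreal CD * (\<integral>\<^sup>+ x. F x \<partial>M))" by simp
  also have "(\<Sum>j. ennreal ((3 / 4) ^ j)) = ennreal 4"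
    using geometric_sums[of "3 / 4 :: real"] by (intro suminf_ennreal_eq) auto
  also have "ennreal 4 * (ennreal CD * (\<integral>\<^sup>+ x. F x \<partial>M)) < \<infinity>"
    using Ffin by (simp add: ennreal_mult_less_top)
  finally have Sfin: "(\<integral>\<^sup>+ x\<in>B. S x \<partial>M) < \<infinity>" .

  define s where "s x = enn2real (S x)" for x
  have A_le: "A j x \<le> ennreal ((4 / 3) ^ j * s x)" if "S x < \<infinity>" for j x
  proof -
    have "ennreal ((3 / 4) ^ j) * A j x \<le> S x"
      unfolding S_def using sum_le_suminf[of "\<lambda>j. ennreal ((3 / 4) ^ j) * A j x" "{j}"] by simp
    also have "S x = ennreal (s x)" using that by (simp add: s_def)
    finally have "ennreal ((4 / 3) ^ j) * (ennreal ((3 / 4) ^ j) * A j x) \<le> ennreal ((4 / 3) ^ j) * ennreal (s x)"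
      by (rule mult_left_mono) simp
    moreover have "ennreal ((4 / 3) ^ j) * ennreal ((3 / 4) ^ j) = 1"
      by (simp flip: ennreal_mult power_mult_distrib)
    ultimately show ?thesis
      by (simp add: s_def ennreal_mult flip: mult.assoc)
  qed
  have s_ge: "1 \<le> s x" if "x \<in> B" "S x < \<infinity>" for x
  proof -
    let ?b = "ball x (L * (\<rho> / 2 ^ 0))"
    have "emeasure M ?b = (\<integral>\<^sup>+ y. indicator ?b y \<partial>M)" by simp
    also have "\<dots> \<le> (\<integral>\<^sup>+ y\<in>?b. F y \<partial>M)"
    proof (rule nn_integral_mono)
      fix y show "indicator ?b y \<le> F y * indicator ?b y"
      proof (cases "y \<in> ?b")
        case True
        then have "y \<in> ball x0 R" using ballZ[OF that(1) rj(4)] ZR by blast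
        then show ?thesis using F_ge(1)[of y] True by simp
      qed simp
    qed
    finally have "emeasure M ?b / emeasure M ?b \<le> A 0 x"
      unfolding A_def by (rule divide_right_mono_ennreal)
    moreover have "emeasure M ?b / emeasure M ?b = 1"
      using metric_measure_spaceD(4)[OF M rj(3)[of 0], of x] metric_measure_spaceD(5)[OF M, of x "L * (\<rho> / 2 ^ 0)"]
      by (intro ennreal_divide_self) auto
    ultimately have "1 \<le> A 0 x" by simp
    also have "\<dots> \<le> ennreal (s x)" using A_le[OF that(2), of 0] by simp
    finally show ?thesis by simp
  qed
  define T where "T x = s x powr (1 / p)" for x
  define K0 where "K0 = 4 * CD ^ 2 * (CP * \<rho>)"
  have "0 < K0" using CD CP \<rho> by (simp add: K0_def)
  show thesis
  proof (rule that[OF \<rho>(1) _ SM])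
    show "(\<integral>\<^sup>+ x\<in>ball x0 (\<rho> / 4). S x \<partial>M) < \<infinity>" using Sfin by (simp add: B_def)
    show "0 \<le> 2 * K0" using \<open>0 < K0\<close> by simp
    fix x y i assume "x \<in> ball x0 (\<rho> / 4)" "y \<in> ball x0 (\<rho> / 4)" "x \<noteq> y"
      and Sxy: "S x < \<infinity>" "S y < \<infinity>" and close: "dist x y < \<rho> / 2 ^ Suc i"
    then have xy: "x \<in> B" "y \<in> B" by (auto simp: B_def)
    have T: "1 \<le> T x" "1 \<le> T y"
      using s_ge xy Sxy p by (auto simp: T_def intro!: ge_one_powr_ge_zero)
    \<comment> \<open>An infimum at most \<open>a0\<close> provides chains of cost less than \<open>2 * a0\<close>, as \<open>a0\<close> is positive.\<close>
    define a0 where "a0 = K0 * (2 / 3) ^ i * (T x + T y)"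
    have "0 < a0" using \<open>0 < K0\<close> T by (simp add: a0_def)
    have chains: "\<exists>c\<le>2 * a0. chain Z (1 / real (Suc n)) (w n) x y c" for n
    proof -
      define \<delta> where "\<delta> = 1 / real (Suc n)"
      have "0 < \<delta>" by (simp add: \<delta>_def)
      define v where "v = chain_dist Z \<delta> (w n) (2 * a0) x"
      have N: "0 \<le> 2 * a0" using \<open>0 < a0\<close> by simp
      have wZ: "continuous_on Z (w n)" using wcont by (rule continuous_on_subset) simp
      have vcont: "continuous_on Z v"
        unfolding v_def by (rule continuous_on_chain_dist[of "w n", OF w1 N \<open>0 < \<delta>\<close> wZ \<open>compact Z\<close>])
      have v: "v \<in> borel_measurable borel" "\<bar>v t\<bar> \<le> 2 * a0" for t
        unfolding v_def
        using borel_measurable_chain_dist[of "w n", OF w1 N \<open>0 < \<delta>\<close> wZ \<open>compact Z\<close>]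
          chain_dist_basics(1,2)[of "w n" "2 * a0", OF w1 N] by auto
      have vC: "isCont v z" if "z \<in> B" for z
      proof -
        have "ball z (R / 4) \<subseteq> Z" using that by (rule ballZ) simp
        then have "continuous_on (ball z (R / 4)) v" using vcont continuous_on_subset by blast
        then show ?thesis using \<open>0 < R\<close> by (simp add: continuous_on_eq_continuous_at)
      qed
      have "\<bar>v x - v y\<bar> \<le> (4 * CD ^ 2) * (2 / 3) ^ i * (CP * \<rho> * T x + CP * \<rho> * T y)"
      proof (rule telescoping_estimate[OF M v vC[OF xy(1)] vC[OF xy(2)] \<rho>(1) CD(1) _ _ _ _ close])
        show "0 \<le> CP * \<rho> * T x" "0 \<le> CP * \<rho> * T y" using CP \<rho> T by auto
        fix z assume "z \<in> {x, y}"
        then have z: "z \<in> B" "S z < \<infinity>" using xy Sxy by auto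
        show "emeasure M (ball z (2 * r)) \<le> ennreal CD * emeasure M (ball z r)" if "0 < r" "r \<le> \<rho>" for r
          using that ballZ[OF z(1), of r] ZR \<rho>(3) by (intro CD(2) subset_trans[OF _ ZR] ballZ[OF z(1)]) linarith+
        fix j
        let ?r = "\<rho> / 2 ^ j"
        have sub: "ball z (L * ?r) \<subseteq> Z" "ball z ?r \<subseteq> ball x0 R"
        proof -
          show "ball z (L * ?r) \<subseteq> Z" by (rule ballZ[OF z(1) rj(4)])
          have "ball z ?r \<subseteq> Z" using rj(2)[of j] \<rho>(3) by (intro ballZ[OF z(1)]) linarith
          then show "ball z ?r \<subseteq> ball x0 R" using ZR by (rule subset_trans)
        qed
        have "upper_gradient_on (ball z (L * ?r)) (\<lambda>t. ennreal (w n t)) (\<lambda>t. ereal (v t))"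
        proof (rule upper_gradient_on_local[OF wcont _ \<open>0 < \<delta>\<close>])
          show "0 \<le> w n t" for t using w1[of n t] by linarith
          show "\<bar>v a - v b\<bar> \<le> max (w n a) (w n b) * dist a b"
            if "a \<in> ball z (L * ?r)" "b \<in> ball z (L * ?r)" "dist a b < \<delta>" for a b
            unfolding v_def using that sub by (intro chain_dist_local[of "w n", OF w1 N]) auto
        qed
        moreover have "(\<integral>\<^sup>+ t\<in>ball z (L * ?r). ennreal_powr (ennreal (w n t)) p \<partial>M) / emeasure M (ball z (L * ?r))
          \<le> ennreal ((4 / 3) ^ j * s z)"
        proof -
          have "(\<integral>\<^sup>+ t\<in>ball z (L * ?r). ennreal_powr (ennreal (w n t)) p \<partial>M) \<le> (\<integral>\<^sup>+ t\<in>ball z (L * ?r). F t \<partial>M)"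
          proof (rule nn_integral_mono)
            fix t show "ennreal_powr (ennreal (w n t)) p * indicator (ball z (L * ?r)) t \<le> F t * indicator (ball z (L * ?r)) t"
            proof (cases "t \<in> ball z (L * ?r)")
              case True
              then have "t \<in> ball x0 R" using sub(1) ZR by blast
              then show ?thesis using w_powr[of t n] True by simp
            qed simp
          qed
          then have "(\<integral>\<^sup>+ t\<in>ball z (L * ?r). ennreal_powr (ennreal (w n t)) p \<partial>M) / emeasure M (ball z (L * ?r)) \<le> A j z"
            unfolding A_def by (rule divide_right_mono_ennreal)
          also have "\<dots> \<le> ennreal ((4 / 3) ^ j * s z)" by (rule A_le[OF z(2)])
          finally show ?thesis .
        qed
        moreover have "0 \<le> (4 / 3) ^ j * s z" by (simp add: s_def)
        ultimately have "(\<integral>\<^sup>+ t\<in>ball z ?r. ennreal \<bar>v t - mean_on M (ball z ?r) (\<lambda>s. ereal (v s))\<bar> \<partial>M)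
            \<le> ennreal (CP * ?r * ((4 / 3) ^ j * s z) powr (1 / p)) * emeasure M (ball z ?r)"
          using poincare_osc[OF M v, of z L ?r "w n" "(4 / 3) ^ j * s z" CP p] PI[OF rj(1) sub(2)] rj(1)[of j] p CP
          by auto
        also have "\<dots> \<le> ennreal (CP * \<rho> * T z * (2 / 3) ^ j) * emeasure M (ball z ?r)"
        proof (intro mult_right_mono ennreal_leI)
          have "((4 / 3) ^ j * s z) powr (1 / p) = ((4 / 3 :: real) ^ j) powr (1 / p) * T z"
            unfolding T_def by (rule powr_mult)
          also have "\<dots> \<le> ((4 / 3) ^ j) powr 1 * T z"
            using p by (intro mult_right_mono powr_mono) (auto simp: T_def)
          finally have "CP * ?r * ((4 / 3) ^ j * s z) powr (1 / p) \<le> CP * ?r * ((4 / 3) ^ j * T z)"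
            using CP \<rho>(1) by (intro mult_left_mono) auto
          also have "\<dots> = CP * \<rho> * T z * ((4 / 3) ^ j / 2 ^ j)" by (simp add: field_simps)
          also have "(4 / 3 :: real) ^ j / 2 ^ j = (2 / 3) ^ j" by (simp flip: power_divide)
          finally show "CP * ?r * ((4 / 3) ^ j * s z) powr (1 / p) \<le> CP * \<rho> * T z * (2 / 3) ^ j" .
        qed simp
        finally show "(\<integral>\<^sup>+ t\<in>ball z ?r. ennreal \<bar>v t - mean_on M (ball z ?r) (\<lambda>s. ereal (v s))\<bar> \<partial>M)
            \<le> ennreal (CP * \<rho> * T z * (2 / 3) ^ j) * emeasure M (ball z ?r)" .
      qed
      also have "\<dots> = a0" by (simp add: a0_def K0_def algebra_simps)
      finally have "v y \<le> a0"
        using chain_dist_self[of "w n", OF w1 N BZ[OF xy(1)], of \<delta>] by (simp add: v_def)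
      then have "v y < 2 * a0" using \<open>0 < a0\<close> by simp
      then obtain c where "c < 2 * a0" "chain Z \<delta> (w n) x y c"
        using chain_dist_basics(4)[of "w n" "2 * a0", OF w1 N] unfolding v_def by blast
      then show ?thesis by (auto simp: \<delta>_def intro: less_imp_le)
    qed
    have wZ: "continuous_on Z (w n)" for n using wcont by (rule continuous_on_subset) simp
    obtain \<eta> l where \<eta>: "arc_length_curve Z \<eta> l" "\<eta> 0 = x" "\<eta> l = y"
      "(\<integral>\<^sup>+ t\<in>{0..l}. (SUP n. ennreal (w n (\<eta> t))) \<partial>lborel) \<le> ennreal (2 * a0)"
      using arc_length_curve_of_chains[of Z w, OF \<open>compact Z\<close> wZ w1 winc chains \<open>x \<noteq> y\<close>] by blast
    have "(\<integral>\<^sup>+ t\<in>{0..l}. g (\<eta> t) \<partial>lborel) \<le> (\<integral>\<^sup>+ t\<in>{0..l}. (SUP n. ennreal (w n (\<eta> t))) \<partial>lborel)"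
      by (intro nn_integral_mono mult_right_mono g_le) simp
    also note \<eta>(4)
    also have "2 * a0 = 2 * K0 * (2 / 3) ^ i * (enn2real (S x) powr (1 / p) + enn2real (S y) powr (1 / p))"
      by (simp add: a0_def T_def s_def)
    finally have "(\<integral>\<^sup>+ t\<in>{0..l}. g (\<eta> t) \<partial>lborel)
      \<le> ennreal (2 * K0 * (2 / 3) ^ i * (enn2real (S x) powr (1 / p) + enn2real (S y) powr (1 / p)))" .
    moreover have "arc_length_curve UNIV \<eta> l" using \<eta>(1) by (auto simp: arc_length_curve_def)
    ultimately show "\<exists>\<gamma> l. arc_length_curve UNIV \<gamma> l \<and> \<gamma> 0 = x \<and> \<gamma> l = y \<and>
         (\<integral>\<^sup>+ t\<in>{0..l}. g (\<gamma> t) \<partial>lborel)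
           \<le> ennreal (2 * K0 * (2 / 3) ^ i * (enn2real (S x) powr (1 / p) + enn2real (S y) powr (1 / p)))"
      using \<eta>(2,3) by blast
  qed
qed

section \<open>Measurability and local integrability\<close>

lemma doubling_within_mono: "doubling_within M \<Omega> \<Longrightarrow> \<Omega>' \<subseteq> \<Omega> \<Longrightarrow> doubling_within M \<Omega>'"
  unfolding doubling_within_def by (meson subset_trans)

lemma poincare_within_mono: "poincare_within M p \<Omega> \<Longrightarrow> \<Omega>' \<subseteq> \<Omega> \<Longrightarrow> poincare_within M p \<Omega>'"
  unfolding poincare_within_def by (meson subset_trans)

lemma continuous_on_measurable_restrict:
  fixes f :: "'a::metric_space \<Rightarrow> 'b::topological_space"
  assumes M: "metric_measure_space M" and f: "continuous_on A f"
  shows "f \<in> borel_measurable (restrict_space M A)"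
proof (rule measurableI)
  fix Y :: "'b set" assume "Y \<in> sets borel"
  then have "f -` Y \<inter> space (restrict_space borel A) \<in> sets (restrict_space borel A)"
    using borel_measurable_continuous_on_restrict[OF f] by (rule measurable_sets[rotated])
  then show "f -` Y \<inter> space (restrict_space M A) \<in> sets (restrict_space M A)"
    using metric_measure_spaceD(1,2)[OF M] by (auto simp: sets_restrict_space space_restrict_space)
qed simp

lemma measurable_restrict_null:
  assumes "complete_measure M" "A \<in> null_sets M"
  shows "f \<in> borel_measurable (restrict_space M A)"
proof (rule measurableI)
  interpret complete_measure M by fact
  fix Y
  have "f -` Y \<inter> A \<in> sets M" by (rule complete[OF _ assms(2)]) auto
  moreover have "f -` Y \<inter> space (restrict_space M A) = (f -` Y \<inter> A) \<inter> A"
    using assms(2) sets.sets_into_space[of A M] by (auto simp: space_restrict_space)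
  ultimately show "f -` Y \<inter> space (restrict_space M A) \<in> sets (restrict_space M A)"
    by (auto simp: sets_restrict_space)
qed simp

lemma powr_add_le:
  fixes a b p :: real
  assumes "0 \<le> a" "0 \<le> b" "0 \<le> p"
  shows "(a + b) powr p \<le> (2 * a) powr p + (2 * b) powr p"
proof -
  have "(a + b) powr p \<le> (2 * max a b) powr p" using assms by (intro powr_mono2) auto
  also have "\<dots> \<le> (2 * a) powr p + (2 * b) powr p" by (auto simp: max_def)
  finally show ?thesis .
qed

text \<open>
  By separability, countably many balls on which \<open>u\<close> is measurable cover the space.
\<close>
lemma measurable_of_local:
  fixes M :: "'a::metric_space measure"
  assumes M: "metric_measure_space M"
    and loc: "\<And>x. \<exists>r>0. u \<in> measurable (restrict_space M (ball x r)) N"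
  shows "u \<in> measurable M N"
proof -
  obtain D :: "'a set" where D: "countable D" "\<And>x e. 0 < e \<Longrightarrow> \<exists>q\<in>D. dist x q < e"
    using metric_measure_space_separable[OF M] by blast
  define C where "C = {A \<in> (\<lambda>(q, n). ball q (1 / real (Suc n))) ` (D \<times> UNIV). u \<in> measurable (restrict_space M A) N}"
  show ?thesis
  proof (rule measurable_piecewise_restrict[of C])
    have "countable ((\<lambda>(q, n). ball q (1 / real (Suc n))) ` (D \<times> (UNIV :: nat set)))"
      using D(1) by auto
    then show "countable C" by (rule countable_subset[rotated]) (auto simp: C_def)
    show "X \<inter> space M \<in> sets M" if "X \<in> C" for X
      using that metric_measure_space_open[OF M] metric_measure_spaceD(1)[OF M] by (auto simp: C_def)
    show "u \<in> measurable (restrict_space M X) N" if "X \<in> C" for X using that by (simp add: C_def)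
    show "space M \<subseteq> \<Union> C"
    proof
      fix x
      obtain r where r: "0 < r" "u \<in> measurable (restrict_space M (ball x r)) N" using loc by blast
      have "0 < r / 2" using r by simp
      then obtain n where n: "1 / real (Suc n) < r / 2"
        using reals_Archimedean[OF \<open>0 < r / 2\<close>] by (auto simp: inverse_eq_divide)
      have "0 < 1 / real (Suc n)" by simp
      then obtain q where q: "q \<in> D" "dist x q < 1 / real (Suc n)" using D(2) by blast
      have "ball q (1 / real (Suc n)) \<subseteq> ball x r"
      proof
        fix y assume "y \<in> ball q (1 / real (Suc n))"
        then have "dist q y < 1 / real (Suc n)" by simp
        with q n have "dist x y < r" using dist_triangle[of x y q] by linarith
        then show "y \<in> ball x r" by simp
      qed
      with r(2) have "u \<in> measurable (restrict_space M (ball q (1 / real (Suc n)))) N"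
        by (rule measurable_restrict_mono)
      then have "ball q (1 / real (Suc n)) \<in> C" unfolding C_def using q(1) by (intro CollectI conjI image_eqI[of _ _ "(q, n)"]) auto
      moreover have "x \<in> ball q (1 / real (Suc n))" using q(2) by (simp add: dist_commute)
      ultimately show "x \<in> \<Union> C" by blast
    qed
  qed
qed

text \<open>
  A sufficiently small ball about an isolated point is a singleton.
\<close>
lemma Lp_on_isolated:
  fixes M :: "'a::metric_space measure"
  assumes M: "metric_measure_space M" and "open {x}" "\<bar>u x\<bar> \<noteq> \<infinity>"
  shows "\<exists>r>0. Lp_on M p (ball x r) u"
proof -
  obtain r where r: "0 < r" "ball x r \<subseteq> {x}" using assms(2) by (auto simp: open_contains_ball)
  then have eq: "ball x r = {x}" by auto
  have "u \<in> borel_measurable (restrict_space M {x})"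
    by (rule measurable_cong[THEN iffD2, of _ _ "\<lambda>_. u x"]) (auto simp: space_restrict_space)
  moreover have "(\<integral>\<^sup>+ y\<in>{x}. ennreal_powr (e2ennreal \<bar>u y\<bar>) p \<partial>M) < \<infinity>"
  proof -
    have "(\<integral>\<^sup>+ y\<in>{x}. ennreal_powr (e2ennreal \<bar>u y\<bar>) p \<partial>M)
       = (\<integral>\<^sup>+ y. ennreal_powr (e2ennreal \<bar>u x\<bar>) p * indicator (ball x r) y \<partial>M)"
      unfolding eq by (intro nn_integral_cong) (auto simp: indicator_def)
    also have "\<dots> = ennreal_powr (e2ennreal \<bar>u x\<bar>) p * emeasure M (ball x r)"
      by (rule nn_integral_cmult_indicator) (simp add: metric_measure_space_open[OF M])
    also have "\<dots> < \<infinity>"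
    proof -
      obtain c where "u x = ereal c" using assms(3) by (cases "u x") auto
      then show ?thesis
        using metric_measure_spaceD(5)[OF M, of x r] by (simp add: ennreal_powr_ennreal ennreal_mult_less_top)
    qed
    finally show ?thesis .
  qed
  ultimately show ?thesis using r(1) eq by (auto simp: Lp_on_def)
qed

text \<open>
  Let \<open>E\<close> be the set of full measure in the ball \<open>B\<close> where \<open>S\<close> is finite. Any two distinct points of \<open>E\<close> are
  joined by a curve on which \<open>g\<close> has finite integral, which forces \<open>u\<close> to be finite at both ends. As the
  centre is not isolated, \<open>E\<close> contains more than one point, and \<open>u\<close> is finite on all of \<open>E\<close>.
\<close>
lemma Lp_on_nonisolated:
  fixes M :: "'a::metric_space measure" and g :: "'a \<Rightarrow> ennreal" and u :: "'a \<Rightarrow> ereal"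
  assumes p: "1 \<le> p" and M: "metric_measure_space M" and "0 < R" and cpt: "compact (cball x0 R)"
    and doubling: "doubling_within M (ball x0 R)" and poincare: "poincare_within M p (ball x0 R)"
    and ug: "upper_gradient_on UNIV g u"
    and gfin: "(\<integral>\<^sup>+ x\<in>ball x0 R. ennreal_powr (g x) p \<partial>M) < \<infinity>"
    and "\<not> open {x0}"
  shows "\<exists>r>0. Lp_on M p (ball x0 r) u"
proof -
  have g: "g \<in> borel_measurable borel"
  proof -
    have "sets (restrict_space borel UNIV) = sets (borel :: 'a measure)"
      by (simp add: sets_restrict_space)
    then have "borel_measurable (restrict_space borel UNIV) = borel_measurable (borel :: 'a measure)"
      by (rule measurable_cong_sets) simp
    then show ?thesis using ug unfolding upper_gradient_on_def by blast
  qed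
  obtain \<rho> K S where \<rho>: "0 < \<rho>" "0 \<le> K" and SM[measurable]: "S \<in> borel_measurable M"
    and Sfin: "(\<integral>\<^sup>+ x\<in>ball x0 (\<rho> / 4). S x \<partial>M) < \<infinity>"
    and curves: "\<And>x y i. x \<in> ball x0 (\<rho> / 4) \<Longrightarrow> y \<in> ball x0 (\<rho> / 4) \<Longrightarrow> x \<noteq> y \<Longrightarrow> S x < \<infinity> \<Longrightarrow> S y < \<infinity> \<Longrightarrow>
       dist x y < \<rho> / 2 ^ Suc i \<Longrightarrow>
       \<exists>\<gamma> l. arc_length_curve UNIV \<gamma> l \<and> \<gamma> 0 = x \<and> \<gamma> l = y \<and>
         (\<integral>\<^sup>+ t\<in>{0..l}. g (\<gamma> t) \<partial>lborel)
           \<le> ennreal (K * (2 / 3) ^ i * (enn2real (S x) powr (1 / p) + enn2real (S y) powr (1 / p)))"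
    by (rule local_curve_estimate[OF p M \<open>0 < R\<close> cpt doubling poincare g gfin]) (rule that)
  define B where "B = ball x0 (\<rho> / 4)"
  have Bs[measurable]: "B \<in> sets M" unfolding B_def by (rule metric_measure_space_open[OF M open_ball])
  define E where "E = {x \<in> B. S x < \<infinity>}"
  define T where "T x = enn2real (S x) powr (1 / p)" for x
  have T0: "0 \<le> T x" for x by (simp add: T_def)
  define N0 where "N0 = {x \<in> B. S x = \<infinity>}"
  have N0: "N0 \<in> null_sets M"
  proof -
    have "(\<integral>\<^sup>+ x. S x * indicator B x \<partial>M) \<noteq> \<infinity>" using Sfin by (simp add: B_def)
    then have "AE x in M. S x * indicator B x \<noteq> \<infinity>" by (intro nn_integral_noteq_infinite) auto
    then have ae: "AE x in M. x \<notin> N0" by eventually_elim (auto simp: N0_def)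
    have "N0 = {x \<in> space M. x \<in> B \<and> S x = \<infinity>}" using metric_measure_spaceD(1)[OF M] by (auto simp: N0_def)
    also have "\<dots> \<in> sets M" by measurable
    finally show ?thesis using ae by (simp add: AE_iff_null_sets)
  qed
  have BE: "B = E \<union> N0" by (auto simp: E_def N0_def less_top)
  have diff: "\<bar>u x\<bar> \<noteq> \<infinity>" "\<bar>u y\<bar> \<noteq> \<infinity>"
    "\<bar>real_of_ereal (u x) - real_of_ereal (u y)\<bar> \<le> K * (2 / 3) ^ i * (T x + T y)"
    if xy: "x \<in> E" "y \<in> E" "x \<noteq> y" "dist x y < \<rho> / 2 ^ Suc i" for x y i
  proof -
    let ?k = "K * (2 / 3) ^ i * (T x + T y)"
    have "0 \<le> ?k" using \<rho> T0 by (intro mult_nonneg_nonneg add_nonneg_nonneg) auto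
    obtain \<gamma> l where \<gamma>: "arc_length_curve UNIV \<gamma> l" "\<gamma> 0 = x" "\<gamma> l = y"
       "(\<integral>\<^sup>+ t\<in>{0..l}. g (\<gamma> t) \<partial>lborel) \<le> ennreal ?k"
      using curves[of x y i] xy by (auto simp: E_def B_def T_def)
    have "(if \<bar>u (\<gamma> 0)\<bar> = \<infinity> \<or> \<bar>u (\<gamma> l)\<bar> = \<infinity> then \<infinity> else e2ennreal \<bar>u (\<gamma> 0) - u (\<gamma> l)\<bar>)
          \<le> (\<integral>\<^sup>+ t\<in>{0..l}. g (\<gamma> t) \<partial>lborel)"
      using ug \<gamma>(1) by (simp add: upper_gradient_on_def)
    also note \<gamma>(4)
    finally have le: "(if \<bar>u x\<bar> = \<infinity> \<or> \<bar>u y\<bar> = \<infinity> then \<infinity> else e2ennreal \<bar>u x - u y\<bar>) \<le> ennreal ?k"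
      by (simp only: \<gamma>)
    then show fin: "\<bar>u x\<bar> \<noteq> \<infinity>" "\<bar>u y\<bar> \<noteq> \<infinity>" by (auto simp: top_unique split: if_splits)
    then obtain a b where ab: "u x = ereal a" "u y = ereal b" by (cases "u x"; cases "u y") auto
    then have "ennreal \<bar>a - b\<bar> \<le> ennreal ?k" using le by simp
    then show "\<bar>real_of_ereal (u x) - real_of_ereal (u y)\<bar> \<le> ?k"
      using ab \<open>0 \<le> ?k\<close> by (simp add: ennreal_le_iff)
  qed
  have near: "dist x y < \<rho> / 2 ^ Suc 0" if "x \<in> E" "y \<in> E" for x y
    using that dist_triangle2[of x y x0] by (simp add: E_def B_def dist_commute)
  have not_single: "\<not> E \<subseteq> {a}" for a
  proof
    \<comment> \<open>Otherwise the nonempty open set \<open>B - {a}\<close> would be a null set.\<close>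
    assume "E \<subseteq> {a}"
    have "B \<noteq> {x0}" using \<open>\<not> open {x0}\<close> unfolding B_def by (metis open_ball)
    moreover have "x0 \<in> B" using \<rho> by (simp add: B_def)
    ultimately have "B - {a} \<noteq> {}" by blast
    moreover have "open (B - {a})" by (auto simp: B_def)
    ultimately obtain z e where "0 < e" "ball z e \<subseteq> B - {a}"
      unfolding open_contains_ball by blast
    then have "ball z e \<subseteq> N0" using BE \<open>E \<subseteq> {a}\<close> by blast
    then have "emeasure M (ball z e) \<le> emeasure M N0" using N0 by (intro emeasure_mono) auto
    with N0 metric_measure_spaceD(4)[OF M \<open>0 < e\<close>, of z] show False by auto
  qed
  obtain a where a: "a \<in> E" using not_single by blast
  have ufin: "\<bar>u x\<bar> \<noteq> \<infinity>" if "x \<in> E" for x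
  proof -
    obtain y where "y \<in> E" "y \<noteq> x" using not_single[of x] by blast
    then show ?thesis using diff(1)[OF that \<open>y \<in> E\<close> _ near[OF that \<open>y \<in> E\<close>]] by simp
  qed
  define U where "U x = real_of_ereal (u x)" for x
  have uU: "u x = ereal (U x)" if "x \<in> E" for x
    using ufin[OF that] by (simp add: U_def ereal_real')
  have dU: "\<bar>U x - U y\<bar> \<le> K * (2 / 3) ^ i * (T x + T y)"
    if "x \<in> E" "y \<in> E" "dist x y < \<rho> / 2 ^ Suc i" for x y i
  proof (cases "x = y")
    case True
    have "0 \<le> K * (2 / 3) ^ i * (T x + T y)" using \<rho> T0 by (intro mult_nonneg_nonneg add_nonneg_nonneg) auto
    then show ?thesis using True by simp
  qed (use that diff(3) in \<open>simp add: U_def\<close>)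

  define Ek where "Ek k = {x \<in> B. S x \<le> of_nat k}" for k :: nat
  have EkE: "Ek k \<subseteq> E" for k
    by (auto simp: Ek_def E_def le_less_trans[OF _ of_nat_less_top])
  have Ek_sets: "Ek k \<in> sets M" for k
  proof -
    have "Ek k = {x \<in> space M. x \<in> B \<and> S x \<le> of_nat k}" using metric_measure_spaceD(1)[OF M] by (auto simp: Ek_def)
    also have "\<dots> \<in> sets M" by measurable
    finally show ?thesis .
  qed
  have E_cover: "E \<subseteq> (\<Union>k. Ek k)"
  proof
    fix x assume x: "x \<in> E"
    then have "S x = ennreal (enn2real (S x))" by (simp add: E_def)
    moreover obtain k :: nat where "enn2real (S x) \<le> real k" using real_arch_simple by blast
    ultimately have "S x \<le> of_nat k" by (metis ennreal_leI ennreal_of_nat_eq_real_of_nat)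
    with x show "x \<in> (\<Union>k. Ek k)" by (auto simp: Ek_def E_def)
  qed
  have Ucont: "continuous_on (Ek k) U" for k
  proof (rule continuous_onI)
    fix x and e :: real assume x: "x \<in> Ek k" and "0 < e"
    have T_le: "T y \<le> real k powr (1 / p)" if "y \<in> Ek k" for y
    proof -
      have "enn2real (S y) \<le> real k"
        using that by (intro enn2real_leI) (auto simp: Ek_def ennreal_of_nat_eq_real_of_nat)
      then show ?thesis unfolding T_def using p by (intro powr_mono2) auto
    qed
    define c where "c = K * (2 * real k powr (1 / p))"
    have "(\<lambda>i. c * (2 / 3) ^ i) \<longlonglongrightarrow> c * 0" by (intro tendsto_intros LIMSEQ_power_zero) simp
    then have "eventually (\<lambda>i. c * (2 / 3) ^ i < e) sequentially"
      using \<open>0 < e\<close> by (intro order_tendstoD(2)) auto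
    then obtain i where i: "c * (2 / 3) ^ i < e" by (auto simp: eventually_sequentially)
    show "\<exists>d>0. \<forall>y\<in>Ek k. dist y x < d \<longrightarrow> dist (U y) (U x) \<le> e"
    proof (intro exI[of _ "\<rho> / 2 ^ Suc i"] conjI ballI impI)
      fix y assume y: "y \<in> Ek k" "dist y x < \<rho> / 2 ^ Suc i"
      have "\<bar>U y - U x\<bar> \<le> K * (2 / 3) ^ i * (T y + T x)" using x y EkE by (intro dU) auto
      also have "\<dots> \<le> K * (2 / 3) ^ i * (real k powr (1 / p) + real k powr (1 / p))"
        using T_le[OF x] T_le[OF y(1)] \<rho>(2) by (intro mult_left_mono add_mono) auto
      also have "\<dots> = c * (2 / 3) ^ i" by (simp add: c_def)
      finally show "dist (U y) (U x) \<le> e" using i by (simp add: dist_real_def)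
    qed (use \<rho> in simp)
  qed
  \<comment> \<open>The null set \<open>N0\<close>, where nothing is known about \<open>u\<close>, is harmless by completeness of \<open>M\<close>.\<close>
  define u' where "u' x = (if x \<in> B then u x else 0)" for x
  have u'M: "u' \<in> borel_measurable M"
  proof (rule measurable_piecewise_restrict[of "{N0, - B} \<union> range Ek"])
    show "countable ({N0, - B} \<union> range Ek)" by simp
    show "X \<inter> space M \<in> sets M" if "X \<in> {N0, - B} \<union> range Ek" for X
    proof -
      have "- B = space M - B" using metric_measure_spaceD(1)[OF M] by auto
      then have "- B \<in> sets M" using Bs by simp
      then show ?thesis using that N0 Ek_sets metric_measure_spaceD(1)[OF M] by auto
    qed
    show "space M \<subseteq> \<Union> ({N0, - B} \<union> range Ek)" using E_cover BE by blast
    fix X assume "X \<in> {N0, - B} \<union> range Ek"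
    then consider "X = N0" | "X = - B" | k where "X = Ek k" by auto
    then show "u' \<in> borel_measurable (restrict_space M X)"
    proof cases
      case 1
      then show ?thesis using measurable_restrict_null[OF metric_measure_spaceD(3)[OF M] N0] by simp
    next
      case 2
      show ?thesis
        by (rule measurable_cong[THEN iffD2, of _ _ "\<lambda>_. 0"]) (auto simp: space_restrict_space 2 u'_def)
    next
      case 3
      have "U \<in> borel_measurable (restrict_space M X)"
        unfolding 3 using M Ucont by (rule continuous_on_measurable_restrict)
      then have "(\<lambda>x. ereal (U x)) \<in> borel_measurable (restrict_space M X)" by simp
      then show ?thesis
      proof (rule measurable_cong[THEN iffD2, rotated])
        fix x assume "x \<in> space (restrict_space M X)"
        then have "x \<in> Ek k" using 3 by (simp add: space_restrict_space)
        then show "u' x = ereal (U x)" using uU EkE by (auto simp: u'_def Ek_def)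
      qed
    qed
  qed
  have "u' \<in> borel_measurable (restrict_space M B)" using u'M by (rule measurable_restrict_space1)
  then have uM: "u \<in> borel_measurable (restrict_space M B)"
    by (rule measurable_cong[THEN iffD2, rotated]) (auto simp: space_restrict_space u'_def)

  define c where "c = \<bar>U a\<bar> + K * T a"
  have c0: "0 \<le> c" using \<rho> T0 by (simp add: c_def)
  have point: "ennreal_powr (e2ennreal \<bar>u x\<bar>) p \<le> ennreal ((2 * c) powr p) + ennreal ((2 * K) powr p) * S x"
    if x: "x \<in> E" for x
  proof -
    have "\<bar>U x\<bar> \<le> c + K * T x"
      using dU[OF x a near[OF x a]] by (simp add: c_def algebra_simps)
    then have "\<bar>U x\<bar> powr p \<le> (c + K * T x) powr p" using p by (intro powr_mono2) auto
    also have "\<dots> \<le> (2 * c) powr p + (2 * (K * T x)) powr p"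
      using c0 \<rho> T0 p by (intro powr_add_le) auto
    also have "(2 * (K * T x)) powr p = (2 * K) powr p * T x powr p"
      by (metis mult.assoc powr_mult)
    also have "T x powr p = enn2real (S x)" using p by (simp add: T_def powr_powr)
    finally have "ennreal (\<bar>U x\<bar> powr p) \<le> ennreal ((2 * c) powr p + (2 * K) powr p * enn2real (S x))"
      by (rule ennreal_leI)
    also have "\<dots> = ennreal ((2 * c) powr p) + ennreal ((2 * K) powr p) * S x"
      using x by (simp add: ennreal_mult E_def)
    finally show ?thesis by (simp add: uU[OF x] ennreal_powr_ennreal)
  qed
  have "AE x in M. x \<notin> N0" using N0 by (rule AE_not_in)
  then have "AE x in M. ennreal_powr (e2ennreal \<bar>u x\<bar>) p * indicator B x
      \<le> ennreal ((2 * c) powr p) * indicator B x + ennreal ((2 * K) powr p) * (S x * indicator B x)"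
  proof eventually_elim
    case (elim x)
    then show ?case using point[of x] BE by (auto simp: indicator_def)
  qed
  then have "(\<integral>\<^sup>+ x\<in>B. ennreal_powr (e2ennreal \<bar>u x\<bar>) p \<partial>M)
      \<le> (\<integral>\<^sup>+ x. ennreal ((2 * c) powr p) * indicator B x + ennreal ((2 * K) powr p) * (S x * indicator B x) \<partial>M)"
    by (rule nn_integral_mono_AE)
  also have "\<dots> = ennreal ((2 * c) powr p) * emeasure M B + ennreal ((2 * K) powr p) * (\<integral>\<^sup>+ x\<in>B. S x \<partial>M)"
    by (subst nn_integral_add) (auto simp: nn_integral_cmult nn_integral_cmult_indicator)
  also have "\<dots> < \<infinity>"
    using Sfin metric_measure_spaceD(5)[OF M] by (simp add: B_def ennreal_mult_less_top)
  finally have "Lp_on M p B u" using uM by (simp add: Lp_on_def)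
  then show ?thesis unfolding B_def using \<rho>(1) by (intro exI[of _ "\<rho> / 4"]) simp
qed

theorem theorem3p4:
  fixes M :: "'a::metric_space measure"
    and p :: real
    and g :: "'a \<Rightarrow> ennreal"
    and u :: "'a \<Rightarrow> ereal"
  assumes "1 \<le> p"
    and "metric_measure_space M"
    and "locally_compact_space (euclidean :: 'a topology)"
    and "locally_doubling M"
    and "local_poincare M p"
    and "Lp_loc M p (\<lambda>x. enn2ereal (g x))"
    and "upper_gradient_on UNIV g u"
    and "\<And>x. open {x} \<Longrightarrow> \<bar>u x\<bar> \<noteq> \<infinity>"
  shows "Lp_loc M p u \<and> u \<in> borel_measurable M"
proof -
  have loc: "\<exists>r>0. Lp_on M p (ball x r) u" for x
  proof (cases "open {x}")
    case True
    then show ?thesis using assms by (intro Lp_on_isolated)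
  next
    case False
    obtain r1 where r1: "0 < r1" "doubling_within M (ball x r1)"
      using assms(4) by (auto simp: locally_doubling_def)
    obtain r2 where r2: "0 < r2" "poincare_within M p (ball x r2)"
      using assms(5) by (auto simp: local_poincare_def)
    have "\<exists>U K. open U \<and> compact K \<and> x \<in> U \<and> U \<subseteq> K"
      using assms(3) by (simp add: locally_compact_space_def)
    then obtain O' C where OC: "open O'" "compact C" "x \<in> O'" "O' \<subseteq> C" by blast
    obtain r3 where r3: "0 < r3" "cball x r3 \<subseteq> O'" using OC by (meson open_contains_cball)
    obtain y r where yr: "x \<in> ball y r" "Lp_on M p (ball y r) (\<lambda>x. enn2ereal (g x))"
      using assms(6) unfolding Lp_loc_def by blast
    obtain r4 where r4: "0 < r4" "ball x r4 \<subseteq> ball y r"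
      using yr(1) by (meson open_ball open_contains_ball)
    define R where "R = min (min r1 r2) (min r3 r4)"
    have R: "0 < R" "R \<le> r1" "R \<le> r2" "R \<le> r3" "R \<le> r4" using r1 r2 r3 r4 by (auto simp: R_def)
    have "cball x R \<subseteq> C" using R r3 OC by (meson subset_cball subset_trans)
    then have cpt: "compact (cball x R)"
      using OC(2) by (metis closed_cball compact_Int_closed inf.absorb_iff2)
    have dbl: "doubling_within M (ball x R)" using r1(2) by (rule doubling_within_mono) (simp add: R subset_ball)
    have poin: "poincare_within M p (ball x R)" using r2(2) by (rule poincare_within_mono) (simp add: R subset_ball)
    have sub: "ball x R \<subseteq> ball y r" using r4(2) subset_ball[OF R(5)] by blast
    have "(\<integral>\<^sup>+ z\<in>ball x R. ennreal_powr (g z) p \<partial>M) \<le> (\<integral>\<^sup>+ z\<in>ball y r. ennreal_powr (g z) p \<partial>M)"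
      using sub by (intro nn_integral_mono) (auto simp: indicator_def)
    also have "\<dots> < \<infinity>" using yr(2) by (simp add: Lp_on_def)
    finally have "(\<integral>\<^sup>+ z\<in>ball x R. ennreal_powr (g z) p \<partial>M) < \<infinity>" .
    from Lp_on_nonisolated[OF assms(1,2) R(1) cpt dbl poin assms(7) this False] show ?thesis .
  qed
  have "Lp_loc M p u"
    unfolding Lp_loc_def
  proof
    fix x
    obtain r where "0 < r" "Lp_on M p (ball x r) u" using loc by blast
    then show "\<exists>y r. 0 < r \<and> x \<in> ball y r \<and> Lp_on M p (ball y r) u" by (intro exI[of _ x] exI[of _ r]) simp
  qed
  moreover have "u \<in> borel_measurable M"
    using loc by (intro measurable_of_local[OF assms(2)]) (auto simp: Lp_on_def)
  ultimately show ?thesis ..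
qed

end
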